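(* Let $m\in\mathbb{N}$ and $\nu\in\mathbb{Z}$. If $\nu\le-1$ or $\nu\ge m+1$, the family $\{\boldsymbol{\varphi}^{(m)}_{\nu,k}\mid k\ge1\}$ is a Hilbert basis of $\mathcal{E}_m$. If $\nu\in\{0,1,\dots,m\}$, the family $\{1,x,\dots,x^m\}\cup\{\boldsymbol{\varphi}^{(m)}_{\nu,k}\mid k\ge1\}$ is a Hilbert basis of $\mathcal{E}_m$.
   Context: $\mathbb{N}=\{0,1,2,\dots\}$. $E$ is the space of complex functions $f$ on $\mathbb{R}^+=[0,\infty)$ such that $x\in[0,1]\mapsto f(x)$ and $x\in(0,1]\mapsto f(1/x)$ are continuous and bounded. For $m\in\mathbb{N}$, $E$ carries the norm $\|f\|_m^2=\int_0^1|f(x)|^2x\,dx+\int_1^\infty|f(x)|^2\frac{dx}{x^{3+2m}}$, with associated Hermitian product $(\cdot,\cdot)_m$, and $\mathcal{E}_m$ is the completion of $E$ for $\|\cdot\|_m$. $J_n$ is the Bessel function of the first kind of integer order $n$. For $\nu\in\mathbb{Z}$, $L_{m,\nu}(z)=-z^m\frac{d}{dz}\bigl(z^{-m}J_\nu(z)J_{\nu-m}(z)\bigr)$ (entire after extension) and $\mathcal{Z}_{m,\nu}=\{\lambda\in\mathbb{C}^*: L_{m,\nu}(\lambda)=0\}$, an infinite discrete subset of $\mathbb{R}^*$. The values $\lambda^2/4$, $\lambda\in\mathcal{Z}_{m,\nu}$, are put in increasing order, and $\lambda_k>0$ denotes the element of $\mathcal{Z}_{m,\nu}$ giving the $k$-th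 value ($k\ge1$). The function $\boldsymbol{\varphi}^{(m)}_{\nu,k}\in\mathcal{E}_m$ is $$\boldsymbol{\varphi}^{(m)}_{\nu,k}(x)=J_\nu(\lambda_kx)\ \text{ for }0\le x\le1,\qquad \boldsymbol{\varphi}^{(m)}_{\nu,k}(x)=\frac{J_\nu(\lambda_k)}{J_{\nu-m}(\lambda_k)}\,x^mJ_{\nu-m}(\lambda_k/x)\ \text{ for }x>1,$$ it being taken that, for $m\ge1$, $J_\nu(\lambda)J_{\nu-m}(\lambda)\ne0$ for $\lambda\in\mathcal{Z}_{m,\nu}$. For $m=0$ and $J_\nu(\lambda_k)=0$, it is instead $-J_\nu(\lambda_kx)$ for $0\le x\le1$ and $J_\nu(\lambda_k/x)$ for $x>1$.
   Formalization: For 0≤ν≤m with m≥1 the monomials 1,…,x^m are not orthogonal, so the second claim fails; proved instead: {1,…,x^m}∪{φ_k} is total and {x^ν}∪{φ_k} is a Hilbert basis. Hilbert basis is meant up to normalisation of the vectors. *)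

theory Defs
  imports "HOL-Analysis.Analysis"
begin

text \<open>
  Functions on \<open>[0, \<infinity>)\<close> are represented by functions on the real line whose values at negative
  arguments are never looked at.
\<close>

definition E_space :: "(real \<Rightarrow> complex) set" where
  "E_space = {f. continuous_on {0..1} f \<and> bounded (f ` {0..1}) \<and>
                 continuous_on {0<..1} (\<lambda>x. f (1 / x)) \<and> bounded ((\<lambda>x. f (1 / x)) ` {0<..1})}"

definition herm :: "nat \<Rightarrow> (real \<Rightarrow> complex) \<Rightarrow> (real \<Rightarrow> complex) \<Rightarrow> complex" where
  "herm m f g = (LINT x:{0..1}|lborel. f x * cnj (g x) * of_real x)
              + (LINT x:{1..}|lborel. f x * cnj (g x) / of_real (x ^ (3 + 2 * m)))"

definition normE :: "nat \<Rightarrow> (real \<Rightarrow> complex) \<Rightarrow> real" where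
  "normE m f = sqrt ((LINT x:{0..1}|lborel. (cmod (f x))\<^sup>2 * x)
                   + (LINT x:{1..}|lborel. (cmod (f x))\<^sup>2 / x ^ (3 + 2 * m)))"

definition sq_integrable :: "nat \<Rightarrow> (real \<Rightarrow> complex) \<Rightarrow> bool" where
  "sq_integrable m f \<longleftrightarrow> set_borel_measurable lborel {0..} f
     \<and> set_integrable lborel {0..1} (\<lambda>x. (cmod (f x))\<^sup>2 * x)
     \<and> set_integrable lborel {1..} (\<lambda>x. (cmod (f x))\<^sup>2 / x ^ (3 + 2 * m))"

text \<open>
  The completion of \<open>E_space\<close> for \<open>normE m\<close>, realised as the closure of \<open>E_space\<close> in the (complete)
  weighted square integrable space. Its elements are functions rather than classes modulo
  equality almost everywhere, so \<open>normE m\<close> is a seminorm on it; a vector is zero in the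
  completion iff its seminorm vanishes.
\<close>

definition E_compl :: "nat \<Rightarrow> (real \<Rightarrow> complex) set" where
  "E_compl m = {f. sq_integrable m f \<and> (\<forall>\<epsilon>>0. \<exists>e\<in>E_space. normE m (\<lambda>x. f x - e x) < \<epsilon>)}"

definition orthogonal_family :: "nat \<Rightarrow> 'i set \<Rightarrow> ('i \<Rightarrow> real \<Rightarrow> complex) \<Rightarrow> bool" where
  "orthogonal_family m I u \<longleftrightarrow> (\<forall>i\<in>I. u i \<in> E_compl m \<and> normE m (u i) \<noteq> 0)
     \<and> (\<forall>i\<in>I. \<forall>j\<in>I. i \<noteq> j \<longrightarrow> herm m (u i) (u j) = 0)"

text \<open>The finite linear combinations of the family are dense in the completion.\<close>

definition total_family :: "nat \<Rightarrow> 'i set \<Rightarrow> ('i \<Rightarrow> real \<Rightarrow> complex) \<Rightarrow> bool" where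
  "total_family m I u \<longleftrightarrow> (\<forall>i\<in>I. u i \<in> E_compl m)
     \<and> (\<forall>f\<in>E_compl m. \<forall>\<epsilon>>0. \<exists>F c. finite F \<and> F \<subseteq> I
            \<and> normE m (\<lambda>x. f x - (\<Sum>i\<in>F. c i * u i x)) < \<epsilon>)"

text \<open>
  Hilbert basis up to normalisation of the vectors: the family of all \<open>u i / normE m (u i)\<close> is a
  total orthonormal family. The functions considered below are not normalised.
\<close>

definition hilbert_basis :: "nat \<Rightarrow> 'i set \<Rightarrow> ('i \<Rightarrow> real \<Rightarrow> complex) \<Rightarrow> bool" where
  "hilbert_basis m I u \<longleftrightarrow> orthogonal_family m I u \<and> total_family m I u"

definition bessel_J_nat :: "nat \<Rightarrow> complex \<Rightarrow> complex" where
  "bessel_J_nat n z = (\<Sum>k. (-1) ^ k / (fact k * fact (k + n)) * (z / 2) ^ (2 * k + n))"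

definition bessel_J :: "int \<Rightarrow> complex \<Rightarrow> complex" where
  "bessel_J n z = (if n \<ge> 0 then bessel_J_nat (nat n) z
                   else (-1) ^ nat (- n) * bessel_J_nat (nat (- n)) z)"

text \<open>Only the values of \<open>L_fun\<close> at nonzero arguments are used, so the removable singularity
  at 0 is left alone.\<close>

definition L_fun :: "nat \<Rightarrow> int \<Rightarrow> complex \<Rightarrow> complex" where
  "L_fun m \<nu> z = - (z ^ m) * deriv (\<lambda>w. bessel_J \<nu> w * bessel_J (\<nu> - int m) w / w ^ m) z"

definition Zset :: "nat \<Rightarrow> int \<Rightarrow> complex set" where
  "Zset m \<nu> = {z. z \<noteq> 0 \<and> L_fun m \<nu> z = 0}"

text \<open>The set \<open>Zset m \<nu>\<close> is an infinite discrete set of reals, so its elements are written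
  \<open>of_real l\<close>.\<close>

definition eigenvalues :: "nat \<Rightarrow> int \<Rightarrow> real set" where
  "eigenvalues m \<nu> = {l\<^sup>2 / 4 | l :: real. of_real l \<in> Zset m \<nu>}"

text \<open>For \<open>k \<ge> 1\<close>, the cardinality condition says that \<open>l\<^sup>2 / 4\<close> is the \<open>k\<close>-th smallest eigenvalue
  (infinite sets have cardinality 0).\<close>

definition lam :: "nat \<Rightarrow> int \<Rightarrow> nat \<Rightarrow> real" where
  "lam m \<nu> k = (THE l. l > 0 \<and> of_real l \<in> Zset m \<nu> \<and> card {t \<in> eigenvalues m \<nu>. t \<le> l\<^sup>2 / 4} = k)"

definition phi :: "nat \<Rightarrow> int \<Rightarrow> nat \<Rightarrow> real \<Rightarrow> complex" where
  "phi m \<nu> k x = (let l = lam m \<nu> k in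
     if m = 0 \<and> bessel_J \<nu> (of_real l) = 0 then
       (if x \<le> 1 then - bessel_J \<nu> (of_real (l * x)) else bessel_J \<nu> (of_real (l / x)))
     else
       (if x \<le> 1 then bessel_J \<nu> (of_real (l * x))
        else bessel_J \<nu> (of_real l) / bessel_J (\<nu> - int m) (of_real l)
             * of_real (x ^ m) * bessel_J (\<nu> - int m) (of_real (l / x))))"

definition monomial :: "nat \<Rightarrow> real \<Rightarrow> complex" where
  "monomial j x = of_real (x ^ j)"

text \<open>The monomials together with the functions \<open>phi m \<nu> k\<close>, as a family indexed by a disjoint
  sum.\<close>

definition mono_phi :: "nat \<Rightarrow> int \<Rightarrow> nat + nat \<Rightarrow> real \<Rightarrow> complex" where
  "mono_phi m \<nu> = case_sum monomial (phi m \<nu>)"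

text \<open>
  For \<open>m \<ge> 1\<close> the monomials of degree at most \<open>m\<close> are not orthogonal to each other (their scalar
  products are positive), and for \<open>0 \<le> \<nu> \<le> m\<close> only \<open>x ^ \<nu>\<close> is orthogonal to all \<open>phi m \<nu> k\<close>; with
  it the latter already form a basis. Hence the family with all the monomials
  is total but not \<open>hilbert_basis\<close>, and the two predicates are kept apart.
\<close>

end

theory Submission
  imports Defs
begin

text \<open>
Send a function \<open>f\<close> on the half line to the pair \<open>(F, G)\<close> of functions on the unit interval given by
\<open>F t = f t\<close> and \<open>G t = t ^ m * f (1 / t)\<close>. The substitution \<open>x = 1 / t\<close> turns the weighted norm into
the square norm of pairs for the weight \<open>t\<close>. With \<open>n = \<bar>\<nu>\<bar>\<close> and \<open>n' = \<bar>\<nu> - m\<bar>\<close>, the functions \<open>phi\<close>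
become pairs of multiples of \<open>J\<^sub>n (\<lambda> t)\<close> and \<open>J\<^sub>n\<^sub>' (\<lambda> t)\<close> that satisfy
\<open>F 1 = G 1\<close> and \<open>F' 1 + G' 1 = m * F 1\<close>, and the equation \<open>L_fun = 0\<close> says that these two conditions
can be met. So they are the eigenvectors, with eigenvalues \<open>\<lambda>\<^sup>2\<close>, of the Bessel operator
\<open>A (F, G) = (- F'' - F' / t + n\<^sup>2 F / t\<^sup>2, - G'' - G' / t + n'\<^sup>2 G / t\<^sup>2)\<close> on two unit intervals glued
at the end point \<open>1\<close>. Under the two conditions \<open>A\<close> is symmetric, and it is nonnegative because
\<open>m \<le> n + n'\<close>. The value \<open>0\<close> is an eigenvalue exactly when \<open>n + n' = m\<close>, that is \<open>0 \<le> \<nu> \<le> m\<close>, and its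
eigenvector is \<open>x ^ \<nu>\<close>. Symmetry gives orthogonality.

Totality is proved without a spectral theorem. Let \<open>f\<close> be orthogonal to all eigenvectors with
eigenvalue at most \<open>L\<close>. For \<open>w \<le> L\<close> the equation \<open>(A - w) u\<^sub>w = f\<close> then has a solution that satisfies the
gluing conditions and depends continuously on \<open>w\<close>: the solution is found by Cramer's rule, the zeros
of the determinant \<open>\<Delta> w\<close> are simple, and orthogonality makes the numerators vanish there
(\<open>resolvent_family\<close>). The function \<open>g w = \<langle>u\<^sub>w, f\<rangle>\<close> has the derivative \<open>\<langle>u\<^sub>w, u\<^sub>w\<rangle>\<close>, so
\<open>(L - w)\<^sup>2 * g w - (L - w) * \<langle>f, f\<rangle>\<close> has the derivative \<open>\<parallel>(L - w) u\<^sub>w - f\<parallel>\<^sup>2 \<ge> 0\<close>; it vanishes at \<open>w = L\<close>,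
and its value at \<open>-1\<close> gives \<open>(L + 1) * \<langle>u\<^sub>-\<^sub>1, f\<rangle> \<le> \<langle>f, f\<rangle>\<close> (\<open>resolvent_bound\<close>).

Let \<open>y\<close> be what remains of \<open>x\<close> after its projections to the eigenvectors with eigenvalue at most \<open>L\<close>
are removed, and apply this to \<open>f = (A + 1) y\<close>, for which \<open>u\<^sub>-\<^sub>1 = y\<close>. Nonnegativity of \<open>A\<close> gives
\<open>\<langle>y, y\<rangle> \<le> \<langle>y, f\<rangle>\<close>, and Bessel's inequality bounds \<open>f\<close>, so \<open>(L + 1) * \<langle>y, y\<rangle> \<le> \<parallel>(A + 1) x\<parallel>\<^sup>2\<close>
(\<open>remainder_bound\<close>) and the remainder tends to zero. The same bound shows that there are infinitely
many eigenvalues (\<open>zeros_infinite\<close>), as otherwise every such \<open>x\<close> would be a finite combination of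
eigenvectors. Finally the pairs \<open>t ^ n * (1 - t\<^sup>2)\<^sup>2 * P (t\<^sup>2)\<close>, \<open>t ^ n' * (1 - t\<^sup>2)\<^sup>2 * Q (t\<^sup>2)\<close> with
polynomials \<open>P\<close> and \<open>Q\<close> satisfy the gluing conditions and are dense by the theorem of Weierstrass
(\<open>polynomial_density\<close>).

Throughout, a function is encoded by the sequence of its coefficients with respect to the terms of the
Bessel series. In this encoding \<open>A\<close> is the negative of the left shift, the eigenvectors are geometric
sequences, and the resolvent is a finite convolution.
\<close>

section \<open>Exponentially bounded sequences and Bessel series\<close>

text \<open>
The coefficients of the Bessel function of order \<open>n\<close> with the signs and the argument taken out.
Measuring power series against them turns the Bessel operator into a shift of coefficients.
\<close>

definition bcoef :: "nat \<Rightarrow> nat \<Rightarrow> real" where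
  "bcoef n j = 1 / (4 ^ j * fact j * fact (n + j))"

definition bser :: "nat \<Rightarrow> (nat \<Rightarrow> 'a) \<Rightarrow> 'a \<Rightarrow> 'a::{real_normed_field,banach}" where
  "bser n p t = t ^ n * (\<Sum>j. of_real (bcoef n j) * p j * (t\<^sup>2) ^ j)"

text \<open>
Geometric growth is the right class of sequences: it contains the eigenvectors, is closed under the
resolvent, and the factorials in \<open>bcoef\<close> make all series converge everywhere.
\<close>

definition expbd :: "(nat \<Rightarrow> 'a::real_normed_vector) \<Rightarrow> bool" where
  "expbd p \<longleftrightarrow> (\<exists>C r. \<forall>j. norm (p j) \<le> C * r ^ j)"

text \<open>
The effect of \<open>t d/dt\<close> on the coefficients; it keeps all derivatives inside the same class of series
and avoids singular terms at \<open>t = 0\<close>.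
\<close>

definition euler :: "nat \<Rightarrow> (nat \<Rightarrow> 'a) \<Rightarrow> nat \<Rightarrow> 'a::real_normed_field" where
  "euler n p j = of_nat (n + 2 * j) * p j"

text \<open>
The series of this sequence is, up to a constant factor, \<open>J\<^sub>n (\<surd>w * t)\<close>.
\<close>

definition geom :: "real \<Rightarrow> nat \<Rightarrow> real" where
  "geom w j = (- w) ^ j"

text \<open>
The solution of \<open>- q (Suc j) - w * q j = p j\<close> with \<open>q 0 = 0\<close>: the particular solution of \<open>(A - w) q = p\<close>
that vanishes to higher order at \<open>t = 0\<close>.
\<close>

definition resolv :: "real \<Rightarrow> (nat \<Rightarrow> 'a) \<Rightarrow> nat \<Rightarrow> 'a::real_normed_vector" where
  "resolv w p j = - (\<Sum>i<j. (- w) ^ (j - 1 - i) *\<^sub>R p i)"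

lemma bcoef_pos: "bcoef n j > 0"
  by (simp add: bcoef_def)

lemma bcoef_le: "bcoef n j \<le> 1 / fact j"
proof -
  have "1 * fact j * 1 \<le> (4 ^ j * fact j * fact (n + j) :: real)"
    by (intro mult_mono) (auto simp: fact_ge_1)
  then show ?thesis
    unfolding bcoef_def by (intro divide_left_mono) auto
qed

text \<open>
The factor \<open>4 (j + 1) (n + j + 1)\<close> equals \<open>(n + 2 (j + 1))\<^sup>2 - n\<^sup>2\<close>, which is what the Bessel operator
produces on \<open>t ^ (n + 2 (j + 1))\<close>; this is why it acts as a shift.
\<close>

lemma bcoef_Suc: "bcoef n (Suc j) * (4 * real (Suc j) * real (n + Suc j)) = bcoef n j"
proof -
  have gen: "1 / (4 * a * (x * b) * (y * c)) * (4 * x * y) = 1 / (a * b * c)"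
    if "x > 0" "y > 0" for a b c x y :: real
    using that by simp
  have e: "fact (n + Suc j) = real (n + Suc j) * fact (n + j)" by simp
  have "real (Suc j) > 0" "real (n + Suc j) > 0" by linarith+
  from gen[OF this] show ?thesis
    unfolding bcoef_def e power_Suc fact_Suc of_nat_mult .
qed

lemma expbdI: "(\<And>j. norm (p j) \<le> C * r ^ j) \<Longrightarrow> expbd p"
  unfolding expbd_def by blast

lemma expbdE:
  assumes "expbd p"
  obtains C r where "C \<ge> 0" "r \<ge> 1" "\<And>j. norm (p j) \<le> C * r ^ j"
proof -
  from assms obtain C r where *: "\<And>j. norm (p j) \<le> C * r ^ j"
    unfolding expbd_def by blast
  have "norm (p j) \<le> \<bar>C\<bar> * (max 1 \<bar>r\<bar>) ^ j" for j
  proof -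
    have "C * r ^ j \<le> \<bar>C\<bar> * \<bar>r\<bar> ^ j"
      by (metis abs_ge_self abs_mult power_abs)
    also have "\<dots> \<le> \<bar>C\<bar> * (max 1 \<bar>r\<bar>) ^ j"
      by (intro mult_left_mono power_mono) auto
    finally show ?thesis using *[of j] by simp
  qed
  then show thesis by (intro that[of "\<bar>C\<bar>" "max 1 \<bar>r\<bar>"]) auto
qed

lemma expbd_add:
  assumes "expbd p" "expbd q"
  shows "expbd (\<lambda>j. p j + q j)"
proof -
  from assms obtain C r C' r' where
    *: "C \<ge> 0" "r \<ge> 1" "\<And>j. norm (p j) \<le> C * r ^ j"
       "C' \<ge> 0" "r' \<ge> 1" "\<And>j. norm (q j) \<le> C' * r' ^ j"
    by (metis expbdE)
  have "norm (p j + q j) \<le> (C + C') * (max r r') ^ j" for j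
  proof -
    have "norm (p j + q j) \<le> C * r ^ j + C' * r' ^ j"
      using *(3,6)[of j] norm_triangle_ineq[of "p j" "q j"] by linarith
    also have "\<dots> \<le> C * (max r r') ^ j + C' * (max r r') ^ j"
      using * by (intro add_mono mult_left_mono power_mono) auto
    finally show ?thesis by (simp add: algebra_simps)
  qed
  then show ?thesis by (rule expbdI)
qed

lemma expbd_scale: 
  assumes "expbd p" shows "expbd (\<lambda>j. c *\<^sub>R p j)"
proof -
  from assms obtain C r where *: "C \<ge> 0" "r \<ge> 1" "\<And>j. norm (p j) \<le> C * r ^ j"
    by (metis expbdE)
  have "norm (c *\<^sub>R p j) \<le> (\<bar>c\<bar> * C) * r ^ j" for j
    using mult_left_mono[OF *(3)[of j], of "\<bar>c\<bar>"] by (simp add: mult.assoc)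
  then show ?thesis by (rule expbdI)
qed

lemma expbd_diff: "expbd p \<Longrightarrow> expbd q \<Longrightarrow> expbd (\<lambda>j. p j - q j)"
  using expbd_add[of p "\<lambda>j. (-1) *\<^sub>R q j"] expbd_scale[of q "-1"] by simp

lemma expbd_zero: "expbd (\<lambda>j. 0)"
  by (rule expbdI[of _ 0 0]) simp

lemma expbd_sum: "finite F \<Longrightarrow> (\<And>w. w \<in> F \<Longrightarrow> expbd (p w)) \<Longrightarrow> expbd (\<lambda>j. \<Sum>w\<in>F. p w j)"
proof (induction F rule: finite_induct)
  case (insert w F)
  then have "expbd (\<lambda>j. p w j + (\<Sum>w\<in>F. p w j))" by (intro expbd_add) blast+
  then show ?case using insert(1,2) by simp
qed (simp add: expbd_zero)

lemma expbd_geom: "expbd (\<lambda>j. (- w) ^ j *\<^sub>R c)"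
  by (rule expbdI[of _ "norm c" "\<bar>w\<bar>"]) (simp add: power_abs mult.commute)

lemma expbd_geom_real: "expbd (geom w)"
  using expbd_geom[of w "1::real"] by (simp add: geom_def[abs_def])

lemma expbd_Suc: 
  assumes "expbd p" shows "expbd (\<lambda>j. p (Suc j))"
proof -
  from assms obtain C r where *: "C \<ge> 0" "r \<ge> 1" "\<And>j. norm (p j) \<le> C * r ^ j"
    by (metis expbdE)
  have "norm (p (Suc j)) \<le> (C * r) * r ^ j" for j
    using *(3)[of "Suc j"] by (simp add: mult.assoc)
  then show ?thesis by (rule expbdI)
qed

abbreviation fsts :: "(nat \<Rightarrow> real \<times> real) \<Rightarrow> nat \<Rightarrow> real" where
  "fsts x \<equiv> (\<lambda>j. fst (x j))"

abbreviation snds :: "(nat \<Rightarrow> real \<times> real) \<Rightarrow> nat \<Rightarrow> real" where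
  "snds x \<equiv> (\<lambda>j. snd (x j))"

lemma expbd_fst: "expbd x \<Longrightarrow> expbd (fsts x)"
  unfolding expbd_def by (metis norm_fst_le order_trans prod.collapse)

lemma expbd_snd: "expbd x \<Longrightarrow> expbd (snds x)"
  unfolding expbd_def by (metis norm_snd_le order_trans prod.collapse)

lemma nat_le_two_power: "real (n + 2 * j) \<le> (real n + 2) * 2 ^ j"
proof -
  have "real n \<le> real n * 2 ^ j" by (simp add: mult_le_cancel_left1)
  moreover have "real j \<le> 2 ^ j" using of_nat_less_two_power[of j, where 'a=real] by linarith
  ultimately have "real n + 2 * real j \<le> real n * 2 ^ j + 2 * 2 ^ j" by linarith
  then show ?thesis by (simp add: algebra_simps)
qed

lemma euler_bound:
  assumes "norm (p j) \<le> C * r ^ j" "C \<ge> 0" "r \<ge> 0"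
  shows "norm (euler n p j) \<le> ((real n + 2) * C) * (2 * r) ^ j"
proof -
  have "norm (euler n p j) = real (n + 2 * j) * norm (p j)"
    by (simp add: euler_def norm_mult del: of_nat_add of_nat_mult)
  also have "\<dots> \<le> ((real n + 2) * 2 ^ j) * (C * r ^ j)"
    using assms nat_le_two_power[of n j] by (intro mult_mono) auto
  finally show ?thesis by (simp add: power_mult_distrib mult_ac)
qed

lemma expbd_euler: "expbd p \<Longrightarrow> expbd (euler n p)"
proof -
  assume "expbd p"
  then obtain C r where *: "C \<ge> 0" "r \<ge> 1" "\<And>j. norm (p j) \<le> C * r ^ j"
    using expbdE by blast
  have "norm (euler n p j) \<le> ((real n + 2) * C) * (2 * r) ^ j" for j
    by (rule euler_bound) (use * in auto)
  then show ?thesis by (rule expbdI)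
qed

lemma resolv_bound:
  assumes p: "\<And>i. norm (p i) \<le> C * r ^ i" and "C \<ge> 0" "r \<ge> 1" "\<bar>w\<bar> \<le> R"
  shows "norm (resolv w p j) \<le> C * (2 * max r R) ^ j"
proof -
  define s where "s = max r R"
  have s: "s \<ge> 1" "r \<le> s" "\<bar>w\<bar> \<le> s" using assms by (auto simp: s_def)
  have "norm (resolv w p j) \<le> (\<Sum>i<j. norm ((- w) ^ (j - 1 - i) *\<^sub>R p i))"
    unfolding resolv_def by (simp only: norm_minus_cancel norm_sum)
  also have "\<dots> \<le> (\<Sum>i<j. C * s ^ j)"
  proof (intro sum_mono)
    fix i assume i: "i \<in> {..<j}"
    have "norm ((- w) ^ (j - 1 - i) *\<^sub>R p i) = \<bar>w\<bar> ^ (j - 1 - i) * norm (p i)"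
      by (simp add: power_abs)
    also have "\<dots> \<le> s ^ (j - 1 - i) * (C * s ^ i)"
      using s assms by (intro mult_mono power_mono order_trans[OF p] mult_left_mono) auto
    also have "\<dots> = C * s ^ (j - 1)" using i
      by (simp add: power_add[symmetric] mult.left_commute)
    also have "\<dots> \<le> C * s ^ j"
      using s assms by (intro mult_left_mono power_increasing) auto
    finally show "norm ((- w) ^ (j - 1 - i) *\<^sub>R p i) \<le> C * s ^ j" .
  qed
  also have "\<dots> = real j * (C * s ^ j)" by simp
  also have "\<dots> \<le> 2 ^ j * (C * s ^ j)"
    using of_nat_less_two_power[of j, where 'a=real] s assms by (intro mult_right_mono) auto
  finally show ?thesis by (simp add: s_def power_mult_distrib mult_ac)
qed

lemma expbd_resolv: "expbd p \<Longrightarrow> expbd (resolv w p)"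
proof -
  assume "expbd p"
  then obtain C r where *: "C \<ge> 0" "r \<ge> 1" "\<And>j. norm (p j) \<le> C * r ^ j"
    using expbdE by blast
  show ?thesis
    by (rule expbdI, rule resolv_bound[OF *(3,1,2) order_refl])
qed

lemma bser_term_bound:
  fixes p :: "nat \<Rightarrow> 'a::{real_normed_field,banach}"
  assumes "norm (p j) \<le> C * r ^ j" "norm s \<le> R" "r \<ge> 0" "C \<ge> 0"
  shows "norm (of_real (bcoef n j) * p j * s ^ j) \<le> C * ((r * R) ^ j / fact j)"
proof -
  have "R \<ge> 0" using assms(2) norm_ge_zero order_trans by blast
  have "norm (of_real (bcoef n j) * p j * s ^ j) = bcoef n j * norm (p j) * norm s ^ j"
    using bcoef_pos[of n j] by (simp add: norm_mult norm_power)
  also have "\<dots> \<le> (1 / fact j) * (C * r ^ j) * R ^ j"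
    using assms bcoef_pos[of n j] bcoef_le[of n j] \<open>R \<ge> 0\<close>
    by (intro mult_mono power_mono) auto
  finally show ?thesis by (simp add: power_mult_distrib mult_ac)
qed

lemma summable_exp_bound: "summable (\<lambda>j. C * ((x::real) ^ j / fact j))"
  using summable_exp[of x] by (intro summable_mult) (simp add: divide_inverse mult.commute)

lemma bser_summable:
  fixes p :: "nat \<Rightarrow> 'a::{real_normed_field,banach}"
  assumes "expbd p"
  shows "summable (\<lambda>j. of_real (bcoef n j) * p j * s ^ j)"
proof -
  from assms obtain C r where *: "C \<ge> 0" "r \<ge> 1" "\<And>j. norm (p j) \<le> C * r ^ j"
    by (metis expbdE)
  have "norm (of_real (bcoef n j) * p j * s ^ j) \<le> C * ((r * norm s) ^ j / fact j)" for j
    by (rule bser_term_bound) (use * in auto)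
  then show ?thesis
    by (rule summable_comparison_test'[OF summable_exp_bound])
qed

lemma bser_add:
  assumes "expbd p" "expbd q"
  shows "bser n (\<lambda>j. p j + q j) t = bser n p t + bser n q t"
  unfolding bser_def using bser_summable[OF assms(1)] bser_summable[OF assms(2)]
  by (simp add: ring_distribs suminf_add[symmetric])

lemma bser_mult:
  assumes "expbd p"
  shows "bser n (\<lambda>j. c * p j) t = c * bser n p t"
proof -
  have "(\<Sum>j. of_real (bcoef n j) * (c * p j) * (t\<^sup>2) ^ j) = (\<Sum>j. c * (of_real (bcoef n j) * p j * (t\<^sup>2) ^ j))"
    by (simp add: mult_ac)
  also have "\<dots> = c * (\<Sum>j. of_real (bcoef n j) * p j * (t\<^sup>2) ^ j)"
    by (rule suminf_mult[OF bser_summable[OF assms]])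
  finally show ?thesis by (simp add: bser_def mult_ac)
qed

lemma bser_diff:
  assumes "expbd p" "expbd q"
  shows "bser n (\<lambda>j. p j - q j) t = bser n p t - bser n q t"
  unfolding bser_def using bser_summable[OF assms(1)] bser_summable[OF assms(2)]
  by (simp add: ring_distribs suminf_diff[symmetric])

lemma bser_zero: "bser n (\<lambda>j. 0) t = 0"
  by (simp add: bser_def)

text \<open>
Stated with a division by \<open>t\<close> so that the derivative is again a Bessel series.
\<close>

lemma bser_deriv:
  fixes p :: "nat \<Rightarrow> 'a::{real_normed_field,banach}"
  assumes p: "expbd p" and t: "t \<noteq> 0"
  shows "(bser n p has_field_derivative bser n (euler n p) t / t) (at t)"
proof -
  define c where "c j = of_real (bcoef n j) * p j" for j
  define h where "h s = (\<Sum>j. c j * s ^ j)" for s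
  define h' where "h' s = (\<Sum>j. diffs c j * s ^ j)" for s
  have sm: "summable (\<lambda>j. c j * s ^ j)" for s
    unfolding c_def by (rule bser_summable[OF p])
  have dh: "(h has_field_derivative h' s) (at s)" for s
    unfolding h_def h'_def by (rule termdiffs_strong_converges_everywhere[OF sm])
  have s1: "summable (\<lambda>j. of_nat j * c j * s ^ j)" for s
  proof -
    have "summable (\<lambda>j. of_real (bcoef n j) * (of_nat (0 + 2 * j) * p j) * s ^ j)"
      using bser_summable[OF expbd_euler[OF p, of 0]] by (simp add: euler_def)
    from summable_mult[OF this, of "1/2"] show ?thesis
      by (simp add: c_def mult_ac)
  qed
  have sd: "s * h' s = (\<Sum>j. of_nat j * c j * s ^ j)" for s
  proof -
    have "(\<Sum>j. of_nat j * c j * s ^ j) = (\<Sum>j. of_nat (Suc j) * c (Suc j) * s ^ Suc j)"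
      using suminf_split_head[OF s1, of s] by simp
    also have "\<dots> = (\<Sum>j. s * (diffs c j * s ^ j))"
      by (simp add: diffs_def mult_ac)
    also have "\<dots> = s * h' s"
      unfolding h'_def by (rule suminf_mult[OF termdiff_converges_all[OF sm]])
    finally show ?thesis ..
  qed
  have e: "bser n (euler n p) t = t ^ n * (of_nat n * h (t\<^sup>2) + 2 * (t\<^sup>2 * h' (t\<^sup>2)))"
  proof -
    have "(\<Sum>j. of_real (bcoef n j) * euler n p j * (t\<^sup>2) ^ j) =
      (\<Sum>j. of_nat n * (c j * (t\<^sup>2) ^ j) + 2 * (of_nat j * c j * (t\<^sup>2) ^ j))"
      by (simp add: euler_def c_def algebra_simps)
    also have "\<dots> = of_nat n * h (t\<^sup>2) + 2 * (t\<^sup>2 * h' (t\<^sup>2))"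
      unfolding sd h_def 
      by (subst suminf_add[symmetric]) (auto intro!: summable_mult sm s1 simp: suminf_mult[OF sm] suminf_mult[OF s1])
    finally show ?thesis by (simp add: bser_def)
  qed
  have "((\<lambda>t. t ^ n * h (t\<^sup>2)) has_field_derivative
      (of_nat n * t ^ (n - 1) * h (t\<^sup>2) + (h' (t\<^sup>2) * (2 * t)) * t ^ n)) (at t)"
    using DERIV_mult[OF DERIV_power[OF DERIV_ident, of n t UNIV] DERIV_chain2[OF dh DERIV_power[OF DERIV_ident, of 2 t UNIV]]]
    by simp
  moreover have "of_nat n * t ^ (n - 1) * h (t\<^sup>2) + (h' (t\<^sup>2) * (2 * t)) * t ^ n = bser n (euler n p) t / t"
  proof -
    have "of_nat n * t ^ (n - 1) * t = of_nat n * t ^ n"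
      by (cases n) simp_all
    then have "(of_nat n * t ^ (n - 1) * H + (H' * (2 * t)) * t ^ n) * t = t ^ n * (of_nat n * H + 2 * (t\<^sup>2 * H'))" for H H'
      by (simp add: algebra_simps power2_eq_square)
    then show ?thesis
      unfolding e using t by (simp only: eq_divide_eq if_False if_True not_False_eq_True)
  qed
  moreover have "bser n p = (\<lambda>t. t ^ n * h (t\<^sup>2))"
    by (simp add: bser_def h_def c_def fun_eq_iff)
  ultimately show ?thesis by (simp only:)
qed

lemma bser_euler_0: "bser n (euler n p) 0 = 0"
  by (cases n) (simp_all add: bser_def euler_def powser_zero)

text \<open>
Bessel's differential equation: \<open>(t d/dt)\<^sup>2 - n\<^sup>2\<close> is \<open>t\<^sup>2\<close> times the left shift.
\<close>

lemma bser_euler_euler: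
  fixes p :: "nat \<Rightarrow> 'a::{real_normed_field,banach}"
  assumes p: "expbd p"
  shows "bser n (euler n (euler n p)) t = of_nat n ^ 2 * bser n p t + t\<^sup>2 * bser n (\<lambda>j. p (Suc j)) t"
proof -
  define q where "q j = 4 * of_nat j * of_nat (n + j) * p j" for j
  have ee: "euler n (euler n p) = (\<lambda>j. of_nat n ^ 2 * p j + q j)"
    by (simp add: euler_def q_def fun_eq_iff algebra_simps power2_eq_square)
  have q: "expbd q"
    using expbd_diff[OF expbd_euler[OF expbd_euler[OF p]], of "\<lambda>j. of_nat n ^ 2 * p j" n n]
      expbd_scale[OF p, of "real n ^ 2"] unfolding ee
    by (simp add: scaleR_conv_of_real)
  have p': "expbd (\<lambda>j. of_nat n ^ 2 * p j)"
    using expbd_scale[OF p, of "real n ^ 2"] by (simp add: scaleR_conv_of_real)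
  have "(\<Sum>j. of_real (bcoef n j) * q j * (t\<^sup>2) ^ j) =
        (\<Sum>j. of_real (bcoef n (Suc j)) * q (Suc j) * (t\<^sup>2) ^ Suc j)"
    using suminf_split_head[OF bser_summable[OF q, of n "t\<^sup>2"]] by (simp add: q_def)
  also have "\<dots> = (\<Sum>j. t\<^sup>2 * (of_real (bcoef n j) * p (Suc j) * (t\<^sup>2) ^ j))"
  proof -
    have "of_real (bcoef n (Suc j)) * q (Suc j) = of_real (bcoef n j) * p (Suc j)" for j
    proof -
      have "of_real (bcoef n (Suc j)) * q (Suc j) =
        of_real (bcoef n (Suc j) * (4 * real (Suc j) * real (n + Suc j))) * p (Suc j)"
        unfolding q_def by (simp only: of_real_mult of_real_of_nat_eq of_real_numeral mult.assoc)
      then show ?thesis by (simp only: bcoef_Suc)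
    qed
    then show ?thesis by (simp add: mult_ac)
  qed
  also have "\<dots> = t\<^sup>2 * (\<Sum>j. of_real (bcoef n j) * p (Suc j) * (t\<^sup>2) ^ j)"
    by (rule suminf_mult[OF bser_summable[OF expbd_Suc[OF p]]])
  finally have "bser n q t = t\<^sup>2 * bser n (\<lambda>j. p (Suc j)) t"
    by (simp add: bser_def mult_ac)
  then show ?thesis
    unfolding ee bser_add[OF p' q] bser_mult[OF p] by simp
qed

text \<open>
Families of sequences for which the Weierstrass test applies locally uniformly in the parameter.
\<close>

definition locbd :: "(real \<Rightarrow> nat \<Rightarrow> real) \<Rightarrow> bool" where
  "locbd P \<longleftrightarrow> (\<forall>j. continuous_on UNIV (\<lambda>w. P w j)) \<and>
     (\<forall>R. \<exists>C r. C \<ge> 0 \<and> r \<ge> 0 \<and> (\<forall>w j. \<bar>w\<bar> \<le> R \<longrightarrow> \<bar>P w j\<bar> \<le> C * r ^ j))"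

lemma bser_continuous_param:
  assumes "locbd P"
  shows "continuous_on UNIV (\<lambda>(w,t). bser n (P w) t)"
proof -
  define S where "S R = {-R<..<R} \<times> {-R<..<(R::real)}" for R
  have "continuous_on (S R) (\<lambda>z. \<Sum>j. of_real (bcoef n j) * P (fst z) j * ((snd z)\<^sup>2) ^ j)" for R
  proof -
    obtain C r where *: "C \<ge> 0" "r \<ge> 0" "\<And>w j. \<bar>w\<bar> \<le> R \<Longrightarrow> \<bar>P w j\<bar> \<le> C * r ^ j"
      using assms unfolding locbd_def by metis
    have b: "norm (of_real (bcoef n j) * P (fst z) j * ((snd z)\<^sup>2) ^ j) \<le> C * ((r * R\<^sup>2) ^ j / fact j)"
      if "z \<in> S R" for z j
    proof (rule bser_term_bound)
      show "norm (P (fst z) j) \<le> C * r ^ j"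
        using that *(3)[of "fst z" j] by (auto simp: S_def)
      have "\<bar>snd z\<bar> \<le> R" using that by (auto simp: S_def)
      then have "(snd z)\<^sup>2 \<le> R\<^sup>2" using abs_le_square_iff by fastforce
      then show "norm ((snd z)\<^sup>2) \<le> R\<^sup>2" by simp
    qed (use * in auto)
    have "uniform_limit (S R) (\<lambda>k z. \<Sum>j<k. of_real (bcoef n j) * P (fst z) j * ((snd z)\<^sup>2) ^ j)
        (\<lambda>z. \<Sum>j. of_real (bcoef n j) * P (fst z) j * ((snd z)\<^sup>2) ^ j) sequentially"
    proof (rule Weierstrass_m_test)
      show "norm (of_real (bcoef n j) * P (fst z) j * ((snd z)\<^sup>2) ^ j) \<le> C * ((r * R\<^sup>2) ^ j / fact j)"
        if "z \<in> S R" for z j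
        using that by (rule b)
    qed (rule summable_exp_bound)
    moreover have "continuous_on (S R) (\<lambda>z. P (fst z) j)" for j
    proof (rule continuous_on_compose2[of UNIV "\<lambda>w. P w j"])
      show "continuous_on UNIV (\<lambda>w. P w j)" using assms unfolding locbd_def by blast
    qed (auto intro!: continuous_intros)
    then have "continuous_on (S R) (\<lambda>z. \<Sum>j<k. of_real (bcoef n j) * P (fst z) j * ((snd z)\<^sup>2) ^ j)" for k
      by (intro continuous_on_sum continuous_on_mult continuous_on_const continuous_on_power
          continuous_on_snd continuous_on_id)
    then have "\<forall>\<^sub>F k in sequentially.
        continuous_on (S R) (\<lambda>z. \<Sum>j<k. of_real (bcoef n j) * P (fst z) j * ((snd z)\<^sup>2) ^ j)"
      by simp
    ultimately show ?thesis
      by (intro uniform_limit_theorem[OF _ _ trivial_limit_sequentially])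
  qed
  then have "continuous_on (\<Union>R. S R) (\<lambda>z. \<Sum>j. of_real (bcoef n j) * P (fst z) j * ((snd z)\<^sup>2) ^ j)"
    by (intro continuous_on_open_UN) (auto simp: S_def intro!: open_Times)
  moreover have "(\<Union>R. S R) = UNIV"
  proof -
    have "z \<in> S (\<bar>fst z\<bar> + \<bar>snd z\<bar> + 1)" for z :: "real \<times> real"
      by (cases z) (auto simp: S_def)
    then show ?thesis by blast
  qed
  ultimately have "continuous_on UNIV (\<lambda>z. snd z ^ n * (\<Sum>j. of_real (bcoef n j) * P (fst z) j * ((snd z)\<^sup>2) ^ j))"
    by (auto intro!: continuous_intros)
  then show ?thesis by (simp add: bser_def case_prod_beta)
qed

lemma locbdI:
  assumes "\<And>j. continuous_on UNIV (\<lambda>w. P w j)"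
    and "\<And>R. C R \<ge> 0" "\<And>R. r R \<ge> 0" "\<And>R w j. \<bar>w\<bar> \<le> R \<Longrightarrow> \<bar>P w j\<bar> \<le> C R * r R ^ j"
  shows "locbd P"
  unfolding locbd_def using assms by blast

lemma locbd_const: 
  assumes "expbd p" shows "locbd (\<lambda>w. p)"
proof -
  obtain C r where *: "C \<ge> 0" "r \<ge> 1" "\<And>j. norm (p j) \<le> C * r ^ j"
    using expbdE[OF assms] by blast
  show ?thesis
    by (rule locbdI[where C = "\<lambda>_. C" and r = "\<lambda>_. r"]) (use * in auto)
qed

lemma locbd_geom: "locbd geom"
  by (rule locbdI[where C = "\<lambda>_. 1" and r = "\<lambda>R. \<bar>R\<bar>"])
     (auto simp: geom_def power_abs intro!: power_mono continuous_on_power continuous_on_minus continuous_on_id)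

lemma locbd_resolv: 
  assumes "expbd p" shows "locbd (\<lambda>w. resolv w p)"
proof -
  obtain C r where *: "C \<ge> 0" "r \<ge> 1" "\<And>j. norm (p j) \<le> C * r ^ j"
    using expbdE[OF assms] by blast
  show ?thesis
  proof (rule locbdI[where C = "\<lambda>_. C" and r = "\<lambda>R. 2 * max r R"])
    show "\<bar>resolv w p j\<bar> \<le> C * (2 * max r R) ^ j" if "\<bar>w\<bar> \<le> R" for w R j
      using resolv_bound[OF *(3,1,2) that, of j] by simp
    show "continuous_on UNIV (\<lambda>w. resolv w p j)" for j
      unfolding resolv_def by (intro continuous_on_minus continuous_on_sum continuous_on_scaleR 
          continuous_on_power continuous_on_id continuous_on_const)
  qed (use * in auto)
qed

lemma locbd_euler:
  assumes "locbd P" shows "locbd (\<lambda>w. euler n (P w))"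
proof -
  have "\<exists>C r. C \<ge> 0 \<and> r \<ge> 0 \<and> (\<forall>w j. \<bar>w\<bar> \<le> R \<longrightarrow> \<bar>euler n (P w) j\<bar> \<le> C * r ^ j)" for R
  proof -
    obtain C r where *: "C \<ge> 0" "r \<ge> 0" "\<And>w j. \<bar>w\<bar> \<le> R \<Longrightarrow> \<bar>P w j\<bar> \<le> C * r ^ j"
      using assms unfolding locbd_def by metis
    have "\<bar>euler n (P w) j\<bar> \<le> ((real n + 2) * C) * (2 * r) ^ j" if "\<bar>w\<bar> \<le> R" for w j
      using euler_bound[of "P w" j C r n] *(1,2) *(3)[OF that, of j] by simp
    with * show ?thesis by (intro exI[of _ "(real n + 2) * C"] exI[of _ "2*r"]) auto
  qed
  moreover have "continuous_on UNIV (\<lambda>w. euler n (P w) j)" for j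
    using assms unfolding locbd_def euler_def by (intro continuous_on_mult continuous_on_const) blast
  ultimately show ?thesis unfolding locbd_def by blast
qed

lemma bser_continuous: 
  assumes "expbd p" shows "continuous_on A (bser n p :: real \<Rightarrow> real)"
proof -
  have "continuous_on A (\<lambda>t. (0::real, t::real))"
    by (intro continuous_on_Pair continuous_on_const continuous_on_id)
  from continuous_on_compose2[OF bser_continuous_param[OF locbd_const[OF assms], of n] this]
  show ?thesis by simp
qed

lemma resolv_Suc: "resolv w p (Suc j) = - w *\<^sub>R resolv w p j - p j"
proof -
  have "(\<Sum>i<j. (- w) ^ (j - i) *\<^sub>R p i) = (\<Sum>i<j. (- w) *\<^sub>R ((- w) ^ (j - 1 - i) *\<^sub>R p i))"
    by (intro sum.cong) (auto simp: power_eq_if)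
  then show ?thesis
    by (simp add: resolv_def scaleR_sum_right sum_negf)
qed

lemma resolv_0: "resolv w p 0 = 0"
  by (simp add: resolv_def)

text \<open>
The resolvent identity. Together with \<open>geom_diff\<close> it exhibits every difference quotient in the spectral
parameter as a resolvent, so that differentiability in \<open>w\<close> follows from continuity alone.
\<close>

lemma resolv_diff: "resolv w p j - resolv v p j = (w - v) *\<^sub>R resolv w (resolv v p) j"
proof (induction j)
  case (Suc j)
  have "resolv w p (Suc j) - resolv v p (Suc j) =
      - w *\<^sub>R (resolv w p j - resolv v p j) - (w - v) *\<^sub>R resolv v p j"
    unfolding resolv_Suc scaleR_diff_left scaleR_diff_right scaleR_minus_left by simp
  also have "\<dots> = (w - v) *\<^sub>R resolv w (resolv v p) (Suc j)"
    unfolding Suc.IH resolv_Suc scaleR_diff_right scaleR_scaleR by (simp add: mult.commute)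
  finally show ?case .
qed (simp add: resolv_0)

lemma geom_diff: "geom w j - geom v j = (w - v) * resolv w (geom v) j"
proof (induction j)
  case (Suc j)
  have "geom w (Suc j) - geom v (Suc j) = - w * (geom w j - geom v j) - (w - v) * geom v j"
    unfolding geom_def power_Suc left_diff_distrib right_diff_distrib minus_mult_left by simp
  also have "\<dots> = (w - v) * resolv w (geom v) (Suc j)"
    unfolding Suc.IH resolv_Suc right_diff_distrib real_scaleR_def by (simp add: mult.left_commute)
  finally show ?case .
qed (simp add: resolv_0 geom_def)

section \<open>Green's identities and the end data of the Bessel series\<close>

text \<open>
The Wronskian \<open>t (F' G - F G')\<close> is an antiderivative of the integrand and vanishes at \<open>t = 0\<close>.
\<close>

lemma green_scalar:
  assumes p: "expbd p" and q: "expbd q"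
  shows "((\<lambda>t. t * (bser n (\<lambda>j. p (Suc j)) t * bser n q t - bser n p t * bser n (\<lambda>j. q (Suc j)) t))
     has_integral (bser n (euler n p) 1 * bser n q 1 - bser n p 1 * bser n (euler n q) 1)) {0..1::real}"
proof -
  define W where "W t = bser n (euler n p) t * bser n q t - bser n p t * bser n (euler n q) t" for t :: real
  have "((\<lambda>t. t * (bser n (\<lambda>j. p (Suc j)) t * bser n q t - bser n p t * bser n (\<lambda>j. q (Suc j)) t))
     has_integral (W 1 - W 0)) {0..1}"
  proof (rule fundamental_theorem_of_calculus_interior)
    show "continuous_on {0..1} W" unfolding W_def
      by (intro continuous_on_diff continuous_on_mult bser_continuous expbd_euler p q)
    fix t :: real assume t: "t \<in> {0<..<1}"
    then have t0: "t \<noteq> 0" by simp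
    have "(W has_field_derivative
        (bser n (euler n (euler n p)) t / t * bser n q t + bser n (euler n q) t / t * bser n (euler n p) t
        - (bser n (euler n p) t / t * bser n (euler n q) t + bser n (euler n (euler n q)) t / t * bser n p t))) (at t)"
      unfolding W_def by (intro DERIV_diff DERIV_mult bser_deriv expbd_euler p q t0)
    also have "(bser n (euler n (euler n p)) t / t * bser n q t + bser n (euler n q) t / t * bser n (euler n p) t
        - (bser n (euler n p) t / t * bser n (euler n q) t + bser n (euler n (euler n q)) t / t * bser n p t))
       = t * (bser n (\<lambda>j. p (Suc j)) t * bser n q t - bser n p t * bser n (\<lambda>j. q (Suc j)) t)"
      using t0 unfolding bser_euler_euler[OF p] bser_euler_euler[OF q]
      by (simp add: field_simps power2_eq_square)
    finally show "(W has_vector_derivative t * (bser n (\<lambda>j. p (Suc j)) t * bser n q t - bser n p t * bser n (\<lambda>j. q (Suc j)) t)) (at t)"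
      by (simp add: has_real_derivative_iff_has_vector_derivative)
  qed simp
  moreover have "W 0 = 0" by (simp add: W_def bser_euler_0)
  ultimately show ?thesis by (simp add: W_def)
qed

text \<open>
Completing the square: the integrand differs from a derivative by \<open>(t F' - n F)\<^sup>2 / t \<ge> 0\<close>. Using
\<open>t F' - n F\<close> instead of the usual energy \<open>t F'\<^sup>2 + n\<^sup>2 F\<^sup>2 / t\<close> gives the sharp boundary term.
\<close>

lemma energy_scalar:
  assumes p: "expbd p"
  shows "integral {0..1::real} (\<lambda>t. t * (bser n (\<lambda>j. p (Suc j)) t * bser n p t))
      \<le> bser n (euler n p) 1 * bser n p 1 - real n * (bser n p 1)\<^sup>2"
proof -
  define h where "h t = bser n (euler n p) t * bser n p t - real n * (bser n p t * bser n p t)" for t :: real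
  define k where "k t = t * (bser n (\<lambda>j. p (Suc j)) t * bser n p t) + (bser n (euler n p) t - real n * bser n p t)\<^sup>2 / t" for t :: real
  have "(k has_integral (h 1 - h 0)) {0..1}"
  proof (rule fundamental_theorem_of_calculus_interior)
    show "continuous_on {0..1} h" unfolding h_def
      by (intro continuous_on_diff continuous_on_mult continuous_on_const bser_continuous expbd_euler p)
    fix t :: real assume t: "t \<in> {0<..<1}"
    then have t0: "t \<noteq> 0" by simp
    have "(h has_field_derivative
        (bser n (euler n (euler n p)) t / t * bser n p t + bser n (euler n p) t / t * bser n (euler n p) t
        - real n * (bser n (euler n p) t / t * bser n p t + bser n (euler n p) t / t * bser n p t))) (at t)"
      unfolding h_def by (intro DERIV_diff DERIV_mult DERIV_cmult bser_deriv expbd_euler p t0)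
    also have "(bser n (euler n (euler n p)) t / t * bser n p t + bser n (euler n p) t / t * bser n (euler n p) t
        - real n * (bser n (euler n p) t / t * bser n p t + bser n (euler n p) t / t * bser n p t)) = k t"
      using t0 unfolding bser_euler_euler[OF p] k_def
      by (simp add: field_simps power2_eq_square)
    finally show "(h has_vector_derivative k t) (at t)"
      by (simp add: has_real_derivative_iff_has_vector_derivative)
  qed simp
  moreover have "h 0 = 0" by (cases n) (simp_all add: h_def bser_euler_0, simp add: bser_def)
  ultimately have "(k has_integral h 1) {0..1}" by simp
  moreover have "(\<lambda>t. t * (bser n (\<lambda>j. p (Suc j)) t * bser n p t)) integrable_on {0..1}"
    by (intro integrable_continuous_real continuous_on_mult continuous_on_id bser_continuous expbd_Suc p)
  ultimately have "integral {0..1} (\<lambda>t. t * (bser n (\<lambda>j. p (Suc j)) t * bser n p t)) \<le> h 1"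
    by (intro has_integral_le[OF integrable_integral]) (auto simp: k_def)
  then show ?thesis by (simp add: h_def power2_eq_square)
qed


definition bval :: "nat \<Rightarrow> real \<Rightarrow> real" where
  "bval n w = bser n (geom w) 1"

definition bslope :: "nat \<Rightarrow> real \<Rightarrow> real" where
  "bslope n w = bser n (euler n (geom w)) 1"

text \<open>
The determinant of the linear system that expresses the two gluing conditions for multiples of the
two regular solutions. It is \<open>L_fun\<close> in the variable \<open>w = z\<^sup>2\<close>, up to nonzero factors.
\<close>

definition char_fn :: "nat \<Rightarrow> nat \<Rightarrow> nat \<Rightarrow> real \<Rightarrow> real" where
  "char_fn n n' m w = bval n w * bslope n' w + bslope n w * bval n' w - real m * bval n w * bval n' w"

lemma bser_geom_pos:
  assumes "w \<le> 0" "t > 0" shows "bser n (geom w) (t::real) > 0"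
proof -
  have nn: "0 \<le> bcoef n j * geom w j * (t\<^sup>2) ^ j" for j
    using bcoef_pos[of n j] assms by (simp add: geom_def)
  have "(\<Sum>j. bcoef n j * geom w j * (t\<^sup>2) ^ j) > 0"
    using bser_summable[OF expbd_geom_real, of n w "t\<^sup>2"] nn bcoef_pos[of n 0]
    by (intro suminf_pos2[of _ 0]) (auto simp: geom_def)
  then show ?thesis using assms by (simp add: bser_def)
qed

lemma bslope_neg:
  assumes "w < 0" shows "bslope n w > real n * bval n w"
proof -
  have "bslope n w - real n * bval n w = bser n (\<lambda>j. euler n (geom w) j - real n * geom w j) 1"
    using expbd_scale[OF expbd_geom_real[of w], of "real n"]
    by (simp add: bslope_def bval_def bser_diff expbd_euler expbd_geom_real bser_mult)
  also have "\<dots> = (\<Sum>j. bcoef n j * (2 * real j * (- w) ^ j))"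
    by (simp add: bser_def euler_def geom_def algebra_simps)
  also have "\<dots> > 0"
  proof (rule suminf_pos2[of _ 1])
    show "summable (\<lambda>j. bcoef n j * (2 * real j * (- w) ^ j))"
      using bser_summable[OF expbd_euler[OF expbd_geom_real[of w], of 0], of n 1]
      by (simp add: euler_def geom_def)
    show "0 \<le> bcoef n j * (2 * real j * (- w) ^ j)" for j 
      using bcoef_pos[of n j] assms by simp
    show "0 < bcoef n 1 * (2 * real 1 * (- w) ^ 1)"
      using bcoef_pos[of n 1] assms by (simp add: mult_neg_pos)
  qed
  finally show ?thesis by simp
qed

lemma char_fn_neg:
  assumes "m \<le> n + n'" "w < 0" shows "char_fn n n' m w > 0"
proof -
  have a: "bval n w > 0" "bval n' w > 0" using bser_geom_pos[of w 1] assms by (auto simp: bval_def)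
  have "0 \<le> (real n + real n' - real m) * (bval n w * bval n' w)"
    using a assms(1) by (intro mult_nonneg_nonneg) auto
  also have "\<dots> = bval n w * (real n' * bval n' w) + (real n * bval n w) * bval n' w - real m * bval n w * bval n' w"
    by (simp add: algebra_simps)
  also have "\<dots> < char_fn n n' m w"
    unfolding char_fn_def using a bslope_neg[OF assms(2), of n] bslope_neg[OF assms(2), of n']
    by (intro diff_strict_right_mono add_strict_mono mult_strict_left_mono mult_strict_right_mono)
  finally show ?thesis .
qed

text \<open>
Divide by \<open>t ^ n\<close> and let \<open>t\<close> tend to \<open>0\<close>.
\<close>

lemma bser_eq_0_head:
  assumes p: "expbd p" and z: "\<And>t. 0 < t \<Longrightarrow> t < 1 \<Longrightarrow> bser n p t = (0::real)"
  shows "p 0 = 0"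
proof -
  define g where "g t = (\<Sum>j. bcoef n j * p j * (t\<^sup>2) ^ j)" for t
  have sm: "summable (\<lambda>j. (bcoef n j * p j) * s ^ j)" for s
    using bser_summable[OF p, of n s] by simp
  have "isCont (\<lambda>s. \<Sum>j. (bcoef n j * p j) * s ^ j) s" for s
    by (rule isCont_powser_converges_everywhere) (rule sm)
  then have "isCont g 0"
    unfolding g_def by (rule isCont_o2[where f = "\<lambda>t. t\<^sup>2", rotated]) (simp add: isCont_power)
  then have "(g \<longlongrightarrow> g 0) (at_right 0)"
    by (simp add: isCont_def filterlim_at_split)
  moreover have "\<forall>\<^sub>F t in at_right 0. g t = 0"
    using eventually_at_right_real[OF zero_less_one] z
    by (auto simp: bser_def g_def elim!: eventually_mono)
  then have "(g \<longlongrightarrow> 0) (at_right 0)"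
    by (rule tendsto_eventually)
  ultimately have "g 0 = 0" using tendsto_unique trivial_limit_at_right_real by blast
  moreover have "g 0 = bcoef n 0 * p 0" by (simp add: g_def powser_zero)
  ultimately show ?thesis using bcoef_pos[of n 0] by simp
qed

lemma bser_eq_0_euler:
  assumes p: "expbd p" and z: "\<And>t. 0 < t \<Longrightarrow> t < 1 \<Longrightarrow> bser n p t = (0::real)" and t: "0 < t" "t < 1"
  shows "bser n (euler n p) t = 0"
proof -
  have "((\<lambda>_. 0) has_field_derivative bser n (euler n p) t / t) (at t)"
  proof (rule DERIV_cong_ev[OF refl _ refl, THEN iffD1, OF _ bser_deriv[OF p]])
    show "\<forall>\<^sub>F x in nhds t. bser n p x = 0"
      using eventually_nhds_in_open[of "{0<..<1}" t] t z by (auto elim!: eventually_mono)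
  qed (use t in simp)
  then have "bser n (euler n p) t / t = 0" using DERIV_const DERIV_unique by blast
  then show ?thesis using t by simp
qed

text \<open>
If the series vanishes then so does its image under the Bessel operator, which is the series of the
shifted sequence; so each coefficient in turn becomes the leading one.
\<close>

lemma bser_eq_0:
  assumes "expbd p" "\<And>t. 0 < t \<Longrightarrow> t < 1 \<Longrightarrow> bser n p t = (0::real)"
  shows "p j = 0"
  using assms
proof (induction j arbitrary: p)
  case 0
  then show ?case by (rule bser_eq_0_head)
next
  case (Suc j)
  show ?case
  proof (rule Suc.IH)
    show "expbd (\<lambda>j. p (Suc j))" by (rule expbd_Suc[OF Suc.prems(1)])
    fix t :: real assume t: "0 < t" "t < 1"
    have "bser n (euler n p) s = 0" if "0 < s" "s < 1" for s
      by (rule bser_eq_0_euler[OF Suc.prems that])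
    then have "bser n (euler n (euler n p)) t = 0"
      using bser_eq_0_euler[OF expbd_euler[OF Suc.prems(1)]] t by blast
    then show "bser n (\<lambda>j. p (Suc j)) t = 0"
      using bser_euler_euler[OF Suc.prems(1), of n t] Suc.prems(2)[OF t] t by simp
  qed
qed

lemma weighted_square_eq_0:
  fixes h :: "real \<Rightarrow> real"
  assumes c: "continuous_on {0..1} h" and nn: "\<And>t. t \<in> {0..1} \<Longrightarrow> h t \<ge> 0" 
    and le: "integral {0..1} (\<lambda>t. t * h t) \<le> 0" and t: "0 < t" "t \<le> 1"
  shows "h t = 0"
proof -
  have c': "continuous_on {0..1} (\<lambda>t. t * h t)"
    by (intro continuous_on_mult continuous_on_id c)
  have nn': "t * h t \<ge> 0" if "t \<in> {0..1}" for t using nn[OF that] that by simp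
  have "integral {0..1} (\<lambda>t. t * h t) \<ge> 0"
    using c' nn' by (intro integral_nonneg integrable_continuous_real) auto
  with le have "integral {0..1} (\<lambda>t. t * h t) = 0" by simp
  then have "\<forall>t\<in>{0..1}. t * h t = 0"
    using integral_eq_0_iff[OF c' zero_less_one nn'] by simp
  then have "t * h t = 0" by (rule bspec) (use t in simp)
  then show ?thesis using t by simp
qed

lemma geom_energy_pos: "integral {0..1} (\<lambda>t. t * (bser n (geom w) t * bser n (geom w) t)) > (0::real)"
proof (rule ccontr)
  assume "\<not> ?thesis"
  then have "integral {0..1} (\<lambda>t. t * (bser n (geom w) t * bser n (geom w) t)) \<le> 0" by simp
  then have "bser n (geom w) t * bser n (geom w) t = 0" if "0 < t" "t < 1" for t
    using weighted_square_eq_0[of "\<lambda>t. bser n (geom w) t * bser n (geom w) t" t] that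
      continuous_on_mult[OF bser_continuous bser_continuous, OF expbd_geom_real expbd_geom_real, of "{0..1}" n w n w]
    by simp
  then have "geom w 0 = 0"
    by (intro bser_eq_0[OF expbd_geom_real, of n]) auto
  then show False by (simp add: geom_def)
qed

text \<open>
Caratheodory's form of differentiability, to be fed with the resolvent identities.
\<close>

lemma has_derivative_from_param:
  assumes "\<And>w. f w - f v = (w - v) * g w" "continuous_on UNIV g"
  shows "(f has_real_derivative g v) (at v)"
  unfolding CARAT_DERIV using assms
  by (intro exI[of _ g]) (auto simp: continuous_on_eq_continuous_at algebra_simps)

lemma continuous_on_bser_param:
  assumes "locbd P" shows "continuous_on UNIV (\<lambda>w. bser n (P w) t)"
proof -
  have "continuous_on UNIV (\<lambda>w::real. (w, t))"
    by (intro continuous_on_Pair continuous_on_const continuous_on_id)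
  from continuous_on_compose2[OF bser_continuous_param[OF assms, of n] this]
  show ?thesis by simp
qed

lemma bser_resolv_deriv:
  assumes p: "expbd p"
  shows "((\<lambda>w. bser n (resolv w p) t) has_real_derivative bser n (resolv v (resolv v p)) t) (at v)"
proof (rule has_derivative_from_param[where g = "\<lambda>w. bser n (resolv w (resolv v p)) t"])
  show "bser n (resolv w p) t - bser n (resolv v p) t = (w - v) * bser n (resolv w (resolv v p)) t" for w
    using resolv_diff[of w p _ v]
    by (simp add: bser_diff[symmetric] expbd_resolv p bser_mult[symmetric])
  show "continuous_on UNIV (\<lambda>w. bser n (resolv w (resolv v p)) t)"
    by (intro continuous_on_bser_param locbd_resolv expbd_resolv p)
qed

lemma euler_diff: "euler n (\<lambda>j. p j - q j) j = euler n p j - euler n q j"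
  by (simp add: euler_def algebra_simps)

lemma euler_mult: "euler n (\<lambda>j. c * p j) j = c * euler n p j"
  by (simp add: euler_def algebra_simps)

lemma euler_resolv_deriv:
  assumes p: "expbd p"
  shows "((\<lambda>w. bser n (euler n (resolv w p)) t) has_real_derivative bser n (euler n (resolv v (resolv v p))) t) (at v)"
proof (rule has_derivative_from_param[where g = "\<lambda>w. bser n (euler n (resolv w (resolv v p))) t"])
  show "bser n (euler n (resolv w p)) t - bser n (euler n (resolv v p)) t = (w - v) * bser n (euler n (resolv w (resolv v p))) t" for w
    using resolv_diff[of w p _ v]
    by (simp add: bser_diff[symmetric] expbd_resolv expbd_euler p bser_mult[symmetric] euler_diff[symmetric] euler_mult[symmetric])
  show "continuous_on UNIV (\<lambda>w. bser n (euler n (resolv w (resolv v p))) t)"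
    by (intro continuous_on_bser_param locbd_euler locbd_resolv expbd_resolv p)
qed

lemma bval_deriv: "(bval n has_real_derivative bser n (resolv v (geom v)) 1) (at v)"
proof (rule has_derivative_from_param[where g = "\<lambda>w. bser n (resolv w (geom v)) 1"])
  show "bval n w - bval n v = (w - v) * bser n (resolv w (geom v)) 1" for w
    unfolding bval_def using geom_diff[of w _ v]
    by (simp add: bser_diff[symmetric] expbd_resolv expbd_geom_real bser_mult[symmetric])
  show "continuous_on UNIV (\<lambda>w. bser n (resolv w (geom v)) 1)"
    by (intro continuous_on_bser_param locbd_resolv expbd_geom_real)
qed

lemma bslope_deriv: "(bslope n has_real_derivative bser n (euler n (resolv v (geom v))) 1) (at v)"
proof (rule has_derivative_from_param[where g = "\<lambda>w. bser n (euler n (resolv w (geom v))) 1"])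
  show "bslope n w - bslope n v = (w - v) * bser n (euler n (resolv w (geom v))) 1" for w
    unfolding bslope_def using geom_diff[of w _ v]
    by (simp add: bser_diff[symmetric] expbd_euler expbd_resolv expbd_geom_real bser_mult[symmetric] euler_diff[symmetric] euler_mult[symmetric])
  show "continuous_on UNIV (\<lambda>w. bser n (euler n (resolv w (geom v))) 1)"
    by (intro continuous_on_bser_param locbd_euler locbd_resolv expbd_geom_real)
qed

text \<open>
Green's identity between the regular solution and the particular solution: pairings with an
eigenvector can be read off from boundary data.
\<close>

lemma source_pairing:
  assumes p: "expbd p"
  shows "((\<lambda>t. t * (bser n p t * bser n (geom w) t)) has_integral
     (bser n (resolv w p) 1 * bslope n w - bser n (euler n (resolv w p)) 1 * bval n w)) {0..1::real}"
proof -
  have "bser n (\<lambda>j. resolv w p (Suc j)) t = - w * bser n (resolv w p) t - bser n p t" for t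
  proof -
    have "expbd (\<lambda>j. - w * resolv w p j)"
      using expbd_scale[OF expbd_resolv[OF p, of w], of "- w"] by simp
    then show ?thesis
      unfolding resolv_Suc real_scaleR_def
      by (simp only: bser_diff[OF _ p] bser_mult[OF expbd_resolv[OF p]])
  qed
  moreover have "bser n (\<lambda>j. geom w (Suc j)) t = - w * bser n (geom w) t" for t
  proof -
    have "(\<lambda>j. geom w (Suc j)) = (\<lambda>j. - w * geom w j)" by (simp add: geom_def fun_eq_iff)
    then show ?thesis by (simp only: bser_mult[OF expbd_geom_real])
  qed
  ultimately have "((\<lambda>t. t * ((- w * bser n (resolv w p) t - bser n p t) * bser n (geom w) t 
      - bser n (resolv w p) t * (- w * bser n (geom w) t))) has_integral
     (bser n (euler n (resolv w p)) 1 * bval n w - bser n (resolv w p) 1 * bslope n w)) {0..1::real}"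
    using green_scalar[OF expbd_resolv[OF p, of w] expbd_geom_real[of w], of n] by (simp add: bval_def bslope_def)
  from has_integral_neg[OF this] show ?thesis
    by (simp add: algebra_simps)
qed

text \<open>
Here the source is the regular solution itself, so the pairing is a square integral. The two boundary
data on the left involve the derivatives of \<open>bval\<close> and \<open>bslope\<close> with respect to \<open>w\<close>; this is the
source of the simplicity of the eigenvalues.
\<close>

lemma wronskian_pos: 
  "bser n (resolv w (geom w)) 1 * bslope n w - bser n (euler n (resolv w (geom w))) 1 * bval n w > 0"
  using geom_energy_pos[of n w] integral_unique[OF source_pairing[OF expbd_geom_real[of w], of n w]] by simp

section \<open>Two unit intervals glued at their end points\<close>

lemma has_real_derivative_nonzero_isolated:
  fixes f :: "real \<Rightarrow> real"
  assumes "(f has_real_derivative d) (at w)" "d \<noteq> 0" "f w = 0"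
  shows "\<forall>\<^sub>F v in at w. f v \<noteq> 0"
proof -
  have "((\<lambda>v. (f v - f w) / (v - w)) \<longlongrightarrow> d) (at w)"
    using assms(1) by (simp add: has_field_derivative_iff)
  from tendsto_imp_eventually_ne[OF this assms(2)] show ?thesis
    by (rule eventually_mono) (use assms(3) in auto)
qed

lemma quotient_limit:
  fixes f g :: "real \<Rightarrow> real"
  assumes f: "(f has_real_derivative c) (at w)" "f w = 0"
    and g: "(g has_real_derivative d) (at w)" "g w = 0" "d \<noteq> 0"
  shows "((\<lambda>v. f v / g v) \<longlongrightarrow> c / d) (at w)"
proof (rule Lim_transform_eventually)
  show "((\<lambda>v. ((f v - f w) / (v - w)) / ((g v - g w) / (v - w))) \<longlongrightarrow> c / d) (at w)"
    using f(1) g(1,3) by (intro tendsto_divide) (simp_all add: has_field_derivative_iff)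
  show "\<forall>\<^sub>F v in at w. ((f v - f w) / (v - w)) / ((g v - g w) / (v - w)) = f v / g v"
    by (simp add: eventually_at_filter f(2) g(2))
qed

lemma eventually_eq_isCont:
  fixes f :: "real \<Rightarrow> real"
  assumes "isCont f w" "\<forall>\<^sub>F v in at w. f v = c" shows "f w = c"
proof -
  have "(f \<longlongrightarrow> f w) (at w)" using assms(1) by (simp add: isCont_def)
  moreover have "(f \<longlongrightarrow> c) (at w)" by (rule tendsto_eventually[OF assms(2)])
  ultimately show ?thesis using tendsto_unique[of "at w"] by auto
qed

text \<open>
Two edges, with Bessel operators of orders \<open>n\<close> and \<open>n'\<close>, glued at one vertex. The second assumption
excludes common zeros of the two regular solutions at an eigenvalue; for \<open>m = 0\<close> the edges are equal and
such zeros belong to the eigenvectors that are antisymmetric under exchange of the edges.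
\<close>

locale star_graph =
  fixes n n' m :: nat
  assumes m_le: "m \<le> n + n'"
    and nonresonant: "m = 0 \<and> n = n' \<or> (\<forall>w. char_fn n n' m w = 0 \<longrightarrow> bval n w \<noteq> 0 \<and> bval n' w \<noteq> 0)"
begin

abbreviation "\<Delta> \<equiv> char_fn n n' m"

lemma char_fn_deriv:
  assumes "(bval n has_real_derivative A) (at w)" "(bslope n has_real_derivative A1) (at w)"
    "(bval n' has_real_derivative B) (at w)" "(bslope n' has_real_derivative B1) (at w)"
  shows "(\<Delta> has_real_derivative (A * bslope n' w + B1 * bval n w + (A1 * bval n' w + B * bslope n w)
      - (real m * A * bval n' w + B * (real m * bval n w)))) (at w)"
  unfolding char_fn_def[abs_def] 
  by (intro DERIV_diff DERIV_add DERIV_mult DERIV_cmult assms)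

lemma zero_cases:
  assumes "\<Delta> w = 0"
  obtains "bval n w \<noteq> 0" "bval n' w \<noteq> 0" | "m = 0" "n = n'" "bval n w = 0"
  using nonresonant assms by blast

text \<open>
Multiplying the derivative by \<open>bval n w * bval n' w\<close> and using \<open>\<Delta> w = 0\<close> leaves minus a
positive combination of the two Wronskians. In the antisymmetric case the derivative is twice one
Wronskian.
\<close>

lemma char_fn_simple:
  assumes z: "\<Delta> w = 0"
  obtains d where "(\<Delta> has_real_derivative d) (at w)" "d \<noteq> 0"
proof -
  define A where "A = bser n (resolv w (geom w)) 1"
  define A1 where "A1 = bser n (euler n (resolv w (geom w))) 1"
  define B where "B = bser n' (resolv w (geom w)) 1"
  define B1 where "B1 = bser n' (euler n' (resolv w (geom w))) 1"
  note defs = A_def A1_def B_def B1_def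
  define d where "d = A * bslope n' w + B1 * bval n w + (A1 * bval n' w + B * bslope n w)
      - (real m * A * bval n' w + B * (real m * bval n w))"
  have I: "A * bslope n w - A1 * bval n w > 0" "B * bslope n' w - B1 * bval n' w > 0"
    unfolding defs by (rule wronskian_pos)+
  have D: "(\<Delta> has_real_derivative d) (at w)"
    unfolding d_def defs by (intro char_fn_deriv bval_deriv bslope_deriv)
  have "d \<noteq> 0"
    using z
  proof (cases rule: zero_cases)
    case 1
    have "bval n w * bval n' w * d = (A * bval n' w + bval n w * B) * \<Delta> w
       - ((bval n' w)\<^sup>2 * (A * bslope n w - A1 * bval n w) + (bval n w)\<^sup>2 * (B * bslope n' w - B1 * bval n' w))"
      unfolding d_def char_fn_def by (simp add: algebra_simps power2_eq_square)
    moreover have "(bval n' w)\<^sup>2 * (A * bslope n w - A1 * bval n w) + (bval n w)\<^sup>2 * (B * bslope n' w - B1 * bval n' w) > 0"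
      using I 1 by (intro add_pos_pos mult_pos_pos) auto
    ultimately show ?thesis using z by auto
  next
    case 2
    then have "A = B" "A1 = B1" by (simp_all add: defs)
    then show ?thesis using 2 I unfolding d_def by auto
  qed
  with D show thesis by (rule that)
qed

lemma char_fn_cont: "isCont \<Delta> w"
  using DERIV_isCont[OF char_fn_deriv[OF bval_deriv bslope_deriv bval_deriv bslope_deriv]] .

lemma char_fn_isolated:
  "\<forall>\<^sub>F v in at w. \<Delta> v \<noteq> 0"
proof (cases "\<Delta> w = 0")
  case True
  then show ?thesis
    by (metis char_fn_simple has_real_derivative_nonzero_isolated)
next
  case False
  then show ?thesis using char_fn_cont tendsto_imp_eventually_ne unfolding isCont_def by blast
qed

lemma zero_nonneg: "\<Delta> w = 0 \<Longrightarrow> w \<ge> 0"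
  using char_fn_neg[OF m_le, of w] by force

abbreviation zeros :: "real \<Rightarrow> real set" where
  "zeros L \<equiv> {w. \<Delta> w = 0 \<and> w \<le> L}"

text \<open>
Simple zeros are isolated, so they cannot accumulate in the compact interval from \<open>0\<close> to \<open>L\<close>.
\<close>

lemma zeros_finite: "finite (zeros L)"
proof (rule ccontr)
  assume "infinite (zeros L)"
  moreover have "(zeros L) \<subseteq> {0..L}" using zero_nonneg by auto
  ultimately obtain x where x: "x islimpt (zeros L)"
    using Heine_Borel_imp_Bolzano_Weierstrass[OF compact_Icc[of 0 L]] by blast
  have "\<forall>\<^sub>F v in at x. v \<notin> (zeros L)"
    using char_fn_isolated[of x] by (rule eventually_mono) simp
  with x show False
    unfolding islimpt_iff_eventually by simp
qed

definition val :: "(nat \<Rightarrow> real \<times> real) \<Rightarrow> real \<Rightarrow> real \<times> real" where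
  "val x t = (bser n (fsts x) t, bser n' (snds x) t)"

text \<open>
The values of \<open>t d/dt\<close> at \<open>t = 1\<close>, that is the derivatives at the vertex.
\<close>

definition slope :: "(nat \<Rightarrow> real \<times> real) \<Rightarrow> real \<times> real" where
  "slope x = (bser n (euler n (fsts x)) 1, bser n' (euler n' (snds x)) 1)"

abbreviation dot :: "real \<times> real \<Rightarrow> real \<times> real \<Rightarrow> real" where
  "dot u v \<equiv> fst u * fst v + snd u * snd v"

text \<open>
The inner product of pairs for the weight \<open>t\<close>, pulled back to coefficient sequences.
\<close>

definition ip :: "(nat \<Rightarrow> real \<times> real) \<Rightarrow> (nat \<Rightarrow> real \<times> real) \<Rightarrow> real" where
  "ip x y = integral {0..1} (\<lambda>t. t * (dot (val x t) (val y t)))"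

definition glued :: "(nat \<Rightarrow> real \<times> real) \<Rightarrow> bool" where
  "glued x \<longleftrightarrow> fst (val x 1) = snd (val x 1) \<and> fst (slope x) + snd (slope x) = real m * fst (val x 1)"

abbreviation shift :: "(nat \<Rightarrow> real \<times> real) \<Rightarrow> nat \<Rightarrow> real \<times> real" where
  "shift x \<equiv> (\<lambda>j. x (Suc j))"

lemma val_add: "expbd x \<Longrightarrow> expbd y \<Longrightarrow> val (\<lambda>j. x j + y j) t = val x t + val y t"
  by (simp add: val_def bser_add expbd_fst expbd_snd)

lemma val_diff: "expbd x \<Longrightarrow> expbd y \<Longrightarrow> val (\<lambda>j. x j - y j) t = val x t - val y t"
  by (simp add: val_def bser_diff expbd_fst expbd_snd)

lemma val_scale: "expbd x \<Longrightarrow> val (\<lambda>j. c *\<^sub>R x j) t = c *\<^sub>R val x t"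
  by (simp add: val_def bser_mult expbd_fst expbd_snd)

lemma slope_add: 
  assumes "expbd x" "expbd y" shows "slope (\<lambda>j. x j + y j) = slope x + slope y"
proof -
  have e: "euler k (\<lambda>j. p j + q j) = (\<lambda>j. euler k p j + euler k q j)" for k and p q :: "nat \<Rightarrow> real"
    by (simp add: euler_def fun_eq_iff algebra_simps)
  show ?thesis
    using assms by (simp add: slope_def e bser_add expbd_euler expbd_fst expbd_snd)
qed

lemma slope_scale: 
  assumes "expbd x" shows "slope (\<lambda>j. c *\<^sub>R x j) = c *\<^sub>R slope x"
proof -
  have e: "euler k (\<lambda>j. c * p j) = (\<lambda>j. c * euler k p j)" for k and p :: "nat \<Rightarrow> real"
    by (simp add: euler_def fun_eq_iff algebra_simps)
  show ?thesis
    using assms by (simp add: slope_def e bser_mult expbd_euler expbd_fst expbd_snd)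
qed

lemma glued_add: "expbd x \<Longrightarrow> expbd y \<Longrightarrow> glued x \<Longrightarrow> glued y \<Longrightarrow> glued (\<lambda>j. x j + y j)"
  by (simp add: glued_def val_add slope_add algebra_simps)

lemma glued_scale: 
  assumes "expbd x" "glued x" shows "glued (\<lambda>j. c *\<^sub>R x j)"
proof -
  have "fst (slope x) + snd (slope x) = real m * fst (val x 1)" using assms by (simp add: glued_def)
  then have "c * (fst (slope x) + snd (slope x)) = c * (real m * fst (val x 1))" by simp
  then show ?thesis using assms by (simp add: glued_def val_scale slope_scale algebra_simps)
qed

lemma glued_diff: "expbd x \<Longrightarrow> expbd y \<Longrightarrow> glued x \<Longrightarrow> glued y \<Longrightarrow> glued (\<lambda>j. x j - y j)"
  using glued_add[of x "\<lambda>j. (-1) *\<^sub>R y j"] expbd_scale[of y "-1"] glued_scale[of y "-1"] by simp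

lemma glued_zero: "glued (\<lambda>j. 0)"
  by (simp add: glued_def val_def slope_def euler_def[abs_def] bser_zero)

lemma glued_sum: 
  assumes "finite F" "\<And>w. w \<in> F \<Longrightarrow> expbd (x w)" "\<And>w. w \<in> F \<Longrightarrow> glued (x w)"
  shows "glued (\<lambda>j. \<Sum>w\<in>F. x w j)"
  using assms
proof (induction F rule: finite_induct)
  case (insert w F)
  then have "glued (\<lambda>j. x w j + (\<Sum>w\<in>F. x w j))" by (intro glued_add expbd_sum) blast+
  then show ?case using insert(1,2) by simp
qed (simp add: glued_zero)

lemma val_continuous: 
  assumes "expbd x"
  shows "continuous_on A (\<lambda>t. fst (val x t))" "continuous_on A (\<lambda>t. snd (val x t))"
  using assms by (simp_all add: val_def bser_continuous expbd_fst expbd_snd)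

lemma ip_integrable:
  assumes "expbd x" "expbd y"
  shows "(\<lambda>t. t * (dot (val x t) (val y t))) integrable_on {0..1}"
  by (intro integrable_continuous_real continuous_on_mult continuous_on_add continuous_on_id val_continuous assms)

lemma ip_add: 
  assumes "expbd x" "expbd y" "expbd z" shows "ip (\<lambda>j. x j + y j) z = ip x z + ip y z"
  unfolding ip_def val_add[OF assms(1,2)] integral_add[OF ip_integrable[OF assms(1,3)] ip_integrable[OF assms(2,3)], symmetric]
  by (simp add: algebra_simps)

lemma ip_scale: 
  assumes "expbd x" shows "ip (\<lambda>j. c *\<^sub>R x j) z = c * ip x z"
proof -
  have "ip (\<lambda>j. c *\<^sub>R x j) z = integral {0..1} (\<lambda>t. c * (t * (fst (val x t) * fst (val z t) + snd (val x t) * snd (val z t))))"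
    unfolding ip_def val_scale[OF assms] by (simp add: algebra_simps)
  then show ?thesis by (simp add: ip_def)
qed

lemma ip_commute: "ip x y = ip y x"
  by (simp add: ip_def mult.commute)

lemma ip_diff: "expbd x \<Longrightarrow> expbd y \<Longrightarrow> expbd z \<Longrightarrow> ip (\<lambda>j. x j - y j) z = ip x z - ip y z"
  using ip_add[of x "\<lambda>j. (-1) *\<^sub>R y j" z] expbd_scale[of y "-1"] ip_scale[of y "-1" z] by simp

lemma ip_zero: "ip (\<lambda>j. 0) z = 0"
  by (simp add: ip_def val_def bser_zero)

lemma ip_sum: 
  assumes "finite F" "\<And>w. w \<in> F \<Longrightarrow> expbd (x w)" "expbd z"
  shows "ip (\<lambda>j. \<Sum>w\<in>F. x w j) z = (\<Sum>w\<in>F. ip (x w) z)"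
  using assms
proof (induction F rule: finite_induct)
  case (insert w F)
  then have "ip (\<lambda>j. x w j + (\<Sum>w\<in>F. x w j)) z = ip (x w) z + ip (\<lambda>j. \<Sum>w\<in>F. x w j) z" 
    by (intro ip_add expbd_sum) blast+
  then show ?case using insert by simp
qed (simp add: ip_zero)

lemma ip_nonneg: "expbd x \<Longrightarrow> ip x x \<ge> 0"
  unfolding ip_def by (intro integral_nonneg ip_integrable) auto

lemma ip_eq_0_val:
  assumes x: "expbd x" and "ip x x \<le> 0" and t: "0 < t" "t \<le> 1"
  shows "val x t = 0"
proof -
  have "dot (val x t) (val x t) = 0"
  proof (rule weighted_square_eq_0[where h = "\<lambda>t. dot (val x t) (val x t)"])
    show "continuous_on {0..1} (\<lambda>t. dot (val x t) (val x t))"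
      by (intro continuous_on_add continuous_on_mult val_continuous x)
    show "integral {0..1} (\<lambda>t. t * (dot (val x t) (val x t))) \<le> 0"
      using assms(2) by (simp add: ip_def)
  qed (use t in auto)
  then show ?thesis by (simp add: prod_eq_iff sum_squares_eq_zero_iff)
qed

lemma ip_eq_0_left:
  assumes x: "expbd x" and "ip x x \<le> 0"
  shows "ip x y = 0"
proof -
  have *: "t * (dot (val x t) (val y t)) = 0" if "t \<in> {0..1}" for t
    using ip_eq_0_val[OF assms, of t] that by (cases "t = 0") auto
  have "ip x y = integral {0..1::real} (\<lambda>t. 0::real)"
    unfolding ip_def by (rule Henstock_Kurzweil_Integration.integral_cong) (rule *)
  then show ?thesis by simp
qed

lemma green:
  assumes x: "expbd x" and y: "expbd y"
  shows "ip (shift x) y - ip x (shift y) =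
     fst (slope x) * fst (val y 1) + snd (slope x) * snd (val y 1)
   - (fst (val x 1) * fst (slope y) + snd (val x 1) * snd (slope y))"
proof -
  have "ip (shift x) y - ip x (shift y) = integral {0..1} 
     (\<lambda>t. t * (fst (val (shift x) t) * fst (val y t) + snd (val (shift x) t) * snd (val y t))
      - t * (fst (val x t) * fst (val (shift y) t) + snd (val x t) * snd (val (shift y) t)))"
    unfolding ip_def by (intro integral_diff[symmetric] ip_integrable expbd_Suc x y)
  also have "\<dots> = integral {0..1} 
     (\<lambda>t. t * (fst (val (shift x) t) * fst (val y t) - fst (val x t) * fst (val (shift y) t))
      + t * (snd (val (shift x) t) * snd (val y t) - snd (val x t) * snd (val (shift y) t)))"
    by (simp add: algebra_simps)
  also have "\<dots> = 
     fst (slope x) * fst (val y 1) - fst (val x 1) * fst (slope y) 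
     + (snd (slope x) * snd (val y 1) - snd (val x 1) * snd (slope y))"
    unfolding val_def slope_def fst_conv snd_conv
    by (intro integral_unique has_integral_add green_scalar expbd_fst expbd_snd x y)
  finally show ?thesis by simp
qed

text \<open>
The boundary terms of Green's identity cancel between the two edges.
\<close>

lemma shift_symmetric:
  assumes "expbd x" "expbd y" "glued x" "glued y"
  shows "ip (shift x) y = ip x (shift y)"
proof -
  obtain a b c d e f where *: "val x 1 = (a, a)" "slope x = (b, c)" "val y 1 = (d, d)" "slope y = (e, f)"
    "b + c = real m * a" "e + f = real m * d"
    using assms(3,4) unfolding glued_def by (metis prod.collapse)
  have "b * d + c * d - (a * e + a * f) = (b + c) * d - a * (e + f)" by (simp add: algebra_simps)
  also have "\<dots> = 0" using * by simp
  finally show ?thesis using green[OF assms(1,2)] * by simp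
qed

text \<open>
The boundary terms add up to \<open>(m - n - n') * a\<^sup>2\<close> where \<open>a\<close> is the common value at the vertex.
\<close>

lemma shift_nonpos:
  assumes x: "expbd x" and g: "glued x"
  shows "ip (shift x) x \<le> 0"
proof -
  obtain a b c where *: "val x 1 = (a, a)" "slope x = (b, c)" "b + c = real m * a"
    using g unfolding glued_def by (metis prod.collapse)
  have "ip (shift x) x = integral {0..1} (\<lambda>t. t * (fst (val (shift x) t) * fst (val x t)) + t * (snd (val (shift x) t) * snd (val x t)))"
    unfolding ip_def by (simp add: algebra_simps)
  also have "\<dots> = integral {0..1} (\<lambda>t. t * (fst (val (shift x) t) * fst (val x t))) + integral {0..1} (\<lambda>t. t * (snd (val (shift x) t) * snd (val x t)))"
    by (intro integral_add integrable_continuous_real continuous_on_mult continuous_on_id val_continuous expbd_Suc x)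
  also have "\<dots> \<le> (b * a - real n * a\<^sup>2) + (c * a - real n' * a\<^sup>2)"
    using energy_scalar[OF expbd_fst[OF x], of n] energy_scalar[OF expbd_snd[OF x], of n'] *
    unfolding val_def slope_def by (intro add_mono) auto
  also have "\<dots> = (b + c) * a - (real n + real n') * a\<^sup>2" by (simp add: algebra_simps)
  also have "\<dots> = - ((real n + real n' - real m) * a\<^sup>2)" using * by (simp add: algebra_simps power2_eq_square)
  also have "\<dots> \<le> 0" using m_le by simp
  finally show ?thesis .
qed

end

section \<open>Eigenvectors and the resolvent\<close>

context star_graph begin

text \<open>
The amplitudes of the two regular solutions in an eigenvector: they equalise the values at the vertex,
and in the exceptional case, where both values are zero, they balance the derivatives.
\<close>

definition amplitudes :: "real \<Rightarrow> real \<times> real" where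
  "amplitudes w = (if bval n w = 0 then (-1, 1) else (bval n' w, bval n w))"

definition mode :: "real \<Rightarrow> nat \<Rightarrow> real \<times> real" where
  "mode w j = (- w) ^ j *\<^sub>R amplitudes w"

lemma expbd_mode: "expbd (mode w)"
  unfolding mode_def[abs_def] by (rule expbd_geom)

lemma shift_mode: "shift (mode w) = (\<lambda>j. (- w) *\<^sub>R mode w j)"
  by (simp add: mode_def fun_eq_iff)

lemma val_geom: "val (\<lambda>j. (- w) ^ j *\<^sub>R c) t = (fst c * bser n (geom w) t, snd c * bser n' (geom w) t)"
proof -
  have e: "(\<lambda>j. (- w) ^ j * a) = (\<lambda>j. a * geom w j)" for a
    by (simp add: geom_def mult.commute fun_eq_iff)
  show ?thesis
    unfolding val_def fst_scaleR snd_scaleR real_scaleR_def e bser_mult[OF expbd_geom_real] ..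
qed

lemma slope_geom: "slope (\<lambda>j. (- w) ^ j *\<^sub>R c) = (fst c * bslope n w, snd c * bslope n' w)"
proof -
  have e: "euler k (\<lambda>j. (- w) ^ j * a) = (\<lambda>j. a * euler k (geom w) j)" for a k
    by (simp add: geom_def euler_def mult.left_commute mult.commute fun_eq_iff)
  show ?thesis
    unfolding slope_def fst_scaleR snd_scaleR real_scaleR_def e bser_mult[OF expbd_euler[OF expbd_geom_real]] bslope_def ..
qed

lemma glued_mode:
  assumes z: "\<Delta> w = 0" shows "glued (mode w)"
  using z
proof (cases rule: zero_cases)
  case 1
  then show ?thesis using z
    unfolding glued_def mode_def[abs_def] val_geom slope_geom bval_def[symmetric] char_fn_def amplitudes_def
    by (simp add: algebra_simps)
next
  case 2
  then show ?thesis
    unfolding glued_def mode_def[abs_def] val_geom slope_geom bval_def[symmetric] amplitudes_def by simp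
qed

lemma ip_mode_pos: "ip (mode w) (mode w) > 0"
proof (rule ccontr)
  assume "\<not> ?thesis"
  then have "val (mode w) t = 0" if "0 < t" "t < 1" for t
    using ip_eq_0_val[OF expbd_mode, of w t] that by simp
  then have "snd (mode w 0) = 0"
    by (intro bser_eq_0[OF expbd_snd[OF expbd_mode], of n']) (simp add: val_def prod_eq_iff)
  then show False by (simp add: mode_def amplitudes_def split: if_splits)
qed

lemma ip_mode_orthogonal:
  assumes "\<Delta> v = 0" "\<Delta> w = 0" "v \<noteq> w" shows "ip (mode v) (mode w) = 0"
proof -
  have "ip (shift (mode v)) (mode w) = ip (shift (mode w)) (mode v)"
    using shift_symmetric[OF expbd_mode expbd_mode glued_mode[OF assms(1)] glued_mode[OF assms(2)]]
      ip_commute by simp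
  then have "(w - v) * ip (mode v) (mode w) = 0"
    unfolding shift_mode ip_scale[OF expbd_mode] using ip_commute[of "mode v" "mode w"] by (auto simp: algebra_simps)
  then show ?thesis using assms(3) by simp
qed

lemma ip_mode:
  assumes f: "expbd f"
  shows "ip f (mode w) =
     fst (amplitudes w) * (bser n (resolv w (fsts f)) 1 * bslope n w - bser n (euler n (resolv w (fsts f))) 1 * bval n w)
   + snd (amplitudes w) * (bser n' (resolv w (snds f)) 1 * bslope n' w - bser n' (euler n' (resolv w (snds f))) 1 * bval n' w)"
proof -
  have "ip f (mode w) = integral {0..1} (\<lambda>t. 
      fst (amplitudes w) * (t * (bser n (fsts f) t * bser n (geom w) t))
    + snd (amplitudes w) * (t * (bser n' (snds f) t * bser n' (geom w) t)))"
    unfolding ip_def mode_def[abs_def] val_geom by (simp add: val_def algebra_simps)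
  also have "\<dots> = fst (amplitudes w) * (bser n (resolv w (fsts f)) 1 * bslope n w - bser n (euler n (resolv w (fsts f))) 1 * bval n w)
   + snd (amplitudes w) * (bser n' (resolv w (snds f)) 1 * bslope n' w - bser n' (euler n' (resolv w (snds f))) 1 * bval n' w)"
    by (intro integral_unique has_integral_add has_integral_mult_right source_pairing expbd_fst expbd_snd f)
  finally show ?thesis .
qed

text \<open>
A quotient with a simple zero in the denominator and a zero in the numerator extends continuously. The
extension beyond \<open>L\<close> is arbitrary at the zeros of \<open>\<Delta>\<close>.
\<close>

lemma cramer_extension:
  assumes N: "\<And>w. (N has_real_derivative N' w) (at w)"
    and z: "\<And>w. w \<le> L \<Longrightarrow> \<Delta> w = 0 \<Longrightarrow> N w = 0"
  obtains \<alpha> where "\<And>w. w \<le> L \<Longrightarrow> isCont \<alpha> w" "\<And>w. \<Delta> w \<noteq> 0 \<Longrightarrow> \<alpha> w = N w / \<Delta> w"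
proof -
  define d where "d w = deriv \<Delta> w" for w
  have d: "(\<Delta> has_real_derivative d w) (at w)" for w
    unfolding d_def by (rule DERIV_deriv_iff_real_differentiable[THEN iffD2])
      (use char_fn_deriv[OF bval_deriv bslope_deriv bval_deriv bslope_deriv, of w] real_differentiable_def in blast)
  have d0: "d w \<noteq> 0" if "\<Delta> w = 0" for w
    using char_fn_simple[OF that] d DERIV_unique by metis
  define \<alpha> where "\<alpha> w = (if \<Delta> w = 0 then N' w / d w else N w / \<Delta> w)" for w
  have "isCont \<alpha> w" if "w \<le> L" for w
  proof -
    have ev: "\<forall>\<^sub>F v in at w. N v / \<Delta> v = \<alpha> v"
      using char_fn_isolated[of w] by (rule eventually_mono) (simp add: \<alpha>_def)
    have "((\<lambda>v. N v / \<Delta> v) \<longlongrightarrow> \<alpha> w) (at w)"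
    proof (cases "\<Delta> w = 0")
      case True
      then show ?thesis using quotient_limit[OF N z[OF that True] d True d0[OF True]] by (simp add: \<alpha>_def)
    next
      case False
      have "isCont (\<lambda>v. N v / \<Delta> v) w"
        by (intro isCont_divide DERIV_isCont[OF N] char_fn_cont False)
      then show ?thesis using False by (simp add: \<alpha>_def isCont_def)
    qed
    then show ?thesis
      unfolding isCont_def by (rule Lim_transform_eventually) (rule ev)
  qed
  moreover have "\<alpha> w = N w / \<Delta> w" if "\<Delta> w \<noteq> 0" for w using that by (simp add: \<alpha>_def)
  ultimately show thesis by (rule that)
qed

text \<open>
The gluing conditions are a linear system for the amplitudes \<open>(\<alpha> w, \<beta> w)\<close> with determinant \<open>\<Delta> w\<close>.
Orthogonality to an eigenvector is, by \<open>ip_mode\<close>, the vanishing of the numerators in Cramer's rule; this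
is the Fredholm alternative. At a zero of \<open>\<Delta>\<close> the conditions hold by continuity.
\<close>

lemma resolvent_family:
  assumes f: "expbd f" and orth: "\<And>w. w \<le> L \<Longrightarrow> \<Delta> w = 0 \<Longrightarrow> ip f (mode w) = 0"
  obtains \<alpha> \<beta> where "\<And>w. w \<le> L \<Longrightarrow> isCont \<alpha> w" "\<And>w. w \<le> L \<Longrightarrow> isCont \<beta> w"
    "\<And>w. w \<le> L \<Longrightarrow> glued (\<lambda>j. resolv w f j + (- w) ^ j *\<^sub>R (\<alpha> w, \<beta> w))"
proof -
  define U where "U w = bser n (resolv w (fsts f)) 1" for w
  define U1 where "U1 w = bser n (euler n (resolv w (fsts f))) 1" for w
  define V where "V w = bser n' (resolv w (snds f)) 1" for w
  define V1 where "V1 w = bser n' (euler n' (resolv w (snds f))) 1" for w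
  define N1 where "N1 w = (V w - U w) * bslope n' w + (real m * U w - U1 w - V1 w) * bval n' w" for w
  define N2 where "N2 w = (real m * U w - U1 w - V1 w) * bval n w - (V w - U w) * (bslope n w - real m * bval n w)" for w
  note f12 = expbd_fst[OF f] expbd_snd[OF f]
  have diff: "g differentiable (at w)" if "(g has_real_derivative d) (at w)" for g d and w :: real
    using that real_differentiable_def by blast
  have dU: "U differentiable (at w)" for w
    unfolding U_def[abs_def] by (rule diff[OF bser_resolv_deriv[OF f12(1)]])
  have dU1: "U1 differentiable (at w)" for w
    unfolding U1_def[abs_def] by (rule diff[OF euler_resolv_deriv[OF f12(1)]])
  have dV: "V differentiable (at w)" for w
    unfolding V_def[abs_def] by (rule diff[OF bser_resolv_deriv[OF f12(2)]])
  have dV1: "V1 differentiable (at w)" for w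
    unfolding V1_def[abs_def] by (rule diff[OF euler_resolv_deriv[OF f12(2)]])
  note dall = dU dU1 dV dV1 diff[OF bval_deriv] diff[OF bslope_deriv]
  have dN: "N1 differentiable (at w)" "N2 differentiable (at w)" for w
    unfolding N1_def[abs_def] N2_def[abs_def]
    by (intro differentiable_add differentiable_diff differentiable_mult differentiable_const dall)+
  then have N: "(N1 has_real_derivative deriv N1 w) (at w)" "(N2 has_real_derivative deriv N2 w) (at w)" for w
    by (simp_all add: DERIV_deriv_iff_real_differentiable)
  have z: "N1 w = 0 \<and> N2 w = 0" if "w \<le> L" and c: "\<Delta> w = 0" for w
  proof -
    have o: "fst (amplitudes w) * (U w * bslope n w - U1 w * bval n w) + snd (amplitudes w) * (V w * bslope n' w - V1 w * bval n' w) = 0"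
      using orth[OF that] ip_mode[OF f, of w] by (simp add: U_def U1_def V_def V1_def)
    show ?thesis using c
    proof (cases rule: zero_cases)
      case 1
      then have o': "bval n' w * (U w * bslope n w - U1 w * bval n w) + bval n w * (V w * bslope n' w - V1 w * bval n' w) = 0"
        using o by (simp add: amplitudes_def)
      have "bval n w * N1 w = bval n' w * (U w * bslope n w - U1 w * bval n w) + bval n w * (V w * bslope n' w - V1 w * bval n' w)
         - U w * \<Delta> w"
        unfolding N1_def char_fn_def by (simp add: algebra_simps)
      moreover have "bval n' w * N2 w = bval n' w * (U w * bslope n w - U1 w * bval n w) + bval n w * (V w * bslope n' w - V1 w * bval n' w)
         - V w * \<Delta> w"
        unfolding N2_def char_fn_def by (simp add: algebra_simps)
      ultimately show ?thesis using o' c 1 by simp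
    next
      case 2
      have "amplitudes w = (-1, 1)" using 2(3) by (simp add: amplitudes_def)
      moreover have "bval n' w = 0" using 2(2,3) by simp
      ultimately have "V w * bslope n' w = U w * bslope n w" using o 2(3) by simp
      with 2 \<open>bval n' w = 0\<close> show ?thesis unfolding N1_def N2_def by (auto simp: algebra_simps)
    qed
  qed
  obtain \<alpha> where \<alpha>: "\<And>w. w \<le> L \<Longrightarrow> isCont \<alpha> w" "\<And>w. \<Delta> w \<noteq> 0 \<Longrightarrow> \<alpha> w = N1 w / \<Delta> w"
    using cramer_extension[OF N(1), of L] z by blast
  obtain \<beta> where \<beta>: "\<And>w. w \<le> L \<Longrightarrow> isCont \<beta> w" "\<And>w. \<Delta> w \<noteq> 0 \<Longrightarrow> \<beta> w = N2 w / \<Delta> w"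
    using cramer_extension[OF N(2), of L] z by blast
  \<comment> \<open>the defects of the two gluing conditions\<close>
  define E1 where "E1 w = U w + \<alpha> w * bval n w - (V w + \<beta> w * bval n' w)" for w
  define E2 where "E2 w = U1 w + \<alpha> w * bslope n w + (V1 w + \<beta> w * bslope n' w) - real m * (U w + \<alpha> w * bval n w)" for w
  have E: "E1 w = 0 \<and> E2 w = 0" if c: "\<Delta> w \<noteq> 0" for w
  proof -
    have a: "\<alpha> w * \<Delta> w = N1 w" "\<beta> w * \<Delta> w = N2 w" using \<alpha>(2)[OF c] \<beta>(2)[OF c] c by simp_all
    have "E1 w * \<Delta> w = (U w - V w) * \<Delta> w + (\<alpha> w * \<Delta> w) * bval n w - (\<beta> w * \<Delta> w) * bval n' w"
      by (simp add: E1_def algebra_simps)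
    also have "\<dots> = 0" unfolding a unfolding N1_def N2_def char_fn_def by (simp add: algebra_simps)
    finally have 1: "E1 w = 0" using c by simp
    have "E2 w * \<Delta> w = (U1 w + V1 w - real m * U w) * \<Delta> w + (\<alpha> w * \<Delta> w) * (bslope n w - real m * bval n w) + (\<beta> w * \<Delta> w) * bslope n' w"
      by (simp add: E2_def algebra_simps)
    also have "\<dots> = 0" unfolding a unfolding N1_def N2_def char_fn_def by (simp add: algebra_simps)
    finally show ?thesis using 1 c by simp
  qed
  have E0: "E1 w = 0 \<and> E2 w = 0" if "w \<le> L" for w
  proof -
    have ev: "\<forall>\<^sub>F v in at w. E1 v = 0" "\<forall>\<^sub>F v in at w. E2 v = 0"
      using char_fn_isolated[of w] by (rule eventually_mono, simp add: E)+
    note c = dall[THEN differentiable_imp_continuous_within]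
    have "isCont E1 w"
      unfolding E1_def[abs_def]
      by (intro continuous_diff continuous_add continuous_mult c \<alpha>(1) \<beta>(1) that)
    moreover have "isCont E2 w"
      unfolding E2_def[abs_def]
      by (intro continuous_diff continuous_add continuous_mult continuous_const c \<alpha>(1) \<beta>(1) that)
    ultimately show ?thesis using eventually_eq_isCont ev by blast
  qed
  have "glued (\<lambda>j. resolv w f j + (- w) ^ j *\<^sub>R (\<alpha> w, \<beta> w))" if "w \<le> L" for w
  proof -
    have ps: "(\<lambda>j. fst (resolv w f j)) = resolv w (fsts f)" "(\<lambda>j. snd (resolv w f j)) = resolv w (snds f)"
      by (simp_all add: resolv_def fun_eq_iff fst_sum snd_sum)
    have "val (resolv w f) 1 = (U w, V w)" "slope (resolv w f) = (U1 w, V1 w)"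
      by (simp_all add: val_def slope_def ps U_def V_def U1_def V1_def)
    then show ?thesis
      using E0[OF that] 
      unfolding glued_def val_add[OF expbd_resolv[OF f] expbd_geom] slope_add[OF expbd_resolv[OF f] expbd_geom]
        val_geom slope_geom E1_def E2_def bval_def by simp
  qed
  then show thesis using \<alpha>(1) \<beta>(1) that by blast
qed

end

section \<open>The spectral gap estimate\<close>

context star_graph begin

lemma continuous_on_ip_family:
  assumes f: "expbd f" and \<alpha>: "continuous_on T \<alpha>" and \<beta>: "continuous_on T \<beta>" and y: "expbd y"
  shows "continuous_on T (\<lambda>w. ip (\<lambda>j. resolv w f j + (- w) ^ j *\<^sub>R (\<alpha> w, \<beta> w)) y)"
proof -
  have ps: "(\<lambda>j. fst (resolv w f j)) = resolv w (fsts f)" "(\<lambda>j. snd (resolv w f j)) = resolv w (snds f)" for w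
    by (simp_all add: resolv_def fun_eq_iff fst_sum snd_sum)
  have e: "val (\<lambda>j. resolv w f j + (- w) ^ j *\<^sub>R (\<alpha> w, \<beta> w)) t =
     (bser n (resolv w (fsts f)) t + \<alpha> w * bser n (geom w) t,
      bser n' (resolv w (snds f)) t + \<beta> w * bser n' (geom w) t)" for w t
    unfolding val_add[OF expbd_resolv[OF f] expbd_geom] val_geom by (simp add: val_def ps)
  have c: "continuous_on (T \<times> cbox 0 1) (\<lambda>z. bser k (P (fst z)) (snd z))" if "locbd P" for k P
    using continuous_on_subset[OF bser_continuous_param[OF that], of _ k] by (auto simp: case_prod_beta)
  have ab: "continuous_on (T \<times> cbox 0 (1::real)) (\<lambda>z. \<alpha> (fst z))" "continuous_on (T \<times> cbox 0 (1::real)) (\<lambda>z. \<beta> (fst z))"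
    by (rule continuous_on_compose2[OF \<alpha>] continuous_on_compose2[OF \<beta>], auto intro: continuous_on_fst continuous_on_id)+
  have v: "continuous_on (T \<times> cbox 0 (1::real)) (\<lambda>z. fst (val y (snd z)))" "continuous_on (T \<times> cbox 0 (1::real)) (\<lambda>z. snd (val y (snd z)))"
    by (rule continuous_on_compose2[OF val_continuous(1)[OF y, of UNIV]] continuous_on_compose2[OF val_continuous(2)[OF y, of UNIV]],
        auto intro: continuous_on_snd continuous_on_id)+
  have "continuous_on (T \<times> cbox 0 1) (\<lambda>z. snd z * (
      (bser n (resolv (fst z) (fsts f)) (snd z) + \<alpha> (fst z) * bser n (geom (fst z)) (snd z)) * fst (val y (snd z))
    + (bser n' (resolv (fst z) (snds f)) (snd z) + \<beta> (fst z) * bser n' (geom (fst z)) (snd z)) * snd (val y (snd z))))"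
    by (intro continuous_on_mult continuous_on_add continuous_on_snd continuous_on_id ab v c
        locbd_geom locbd_resolv expbd_fst expbd_snd f)
  from integral_continuous_on_param[of T 0 1 "\<lambda>w t. t * (
      (bser n (resolv w (fsts f)) t + \<alpha> w * bser n (geom w) t) * fst (val y t)
    + (bser n' (resolv w (snds f)) t + \<beta> w * bser n' (geom w) t) * snd (val y t))"] this
  show ?thesis
    unfolding ip_def e by (simp add: case_prod_beta)
qed

text \<open>
This is \<open>\<parallel>c x - y\<parallel>\<^sup>2 \<ge> 0\<close>, written out in the form in which it bounds a derivative from below.
\<close>

lemma ip_square_diff:
  assumes "expbd x" "expbd y"
  shows "c\<^sup>2 * ip x x - 2 * c * ip x y + ip y y \<ge> 0"
proof -
  have s: "expbd (\<lambda>j. c *\<^sub>R x j)" by (rule expbd_scale[OF assms(1)])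
  have d: "expbd (\<lambda>j. c *\<^sub>R x j - y j)" by (rule expbd_diff[OF s assms(2)])
  have "ip (\<lambda>j. c *\<^sub>R x j - y j) z = c * ip x z - ip y z" if "expbd z" for z
    using that by (simp add: ip_diff s assms ip_scale)
  note l = this
  have "0 \<le> ip (\<lambda>j. c *\<^sub>R x j - y j) (\<lambda>j. c *\<^sub>R x j - y j)" by (rule ip_nonneg[OF d])
  also have "\<dots> = c * ip (\<lambda>j. c *\<^sub>R x j - y j) x - ip (\<lambda>j. c *\<^sub>R x j - y j) y"
    unfolding l[OF d] by (simp only: ip_commute)
  also have "\<dots> = c\<^sup>2 * ip x x - 2 * c * ip x y + ip y y"
    unfolding l[OF assms(1)] l[OF assms(2)] ip_commute[of y x] by (simp add: algebra_simps power2_eq_square)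
  finally show ?thesis .
qed

text \<open>
For an operator with a complete set of eigenvectors this would be clear, as \<open>f\<close> only sees eigenvalues
above \<open>L\<close>. Here it follows from the monotonicity of \<open>(L - w)\<^sup>2 * \<langle>u\<^sub>w, f\<rangle> - (L - w) * \<langle>f, f\<rangle>\<close> between \<open>-1\<close>
and \<open>L\<close>, which needs nothing but solvability of \<open>(A - w) u\<^sub>w = f\<close> and continuity in \<open>w\<close>.
\<close>

lemma resolvent_bound:
  assumes f: "expbd f" and L: "- 1 \<le> L" and orth: "\<And>w. w \<le> L \<Longrightarrow> \<Delta> w = 0 \<Longrightarrow> ip f (mode w) = 0"
  obtains u where "expbd u" "glued u" "\<And>j. u (Suc j) = u j - f j" "(L + 1) * ip u f \<le> ip f f"
proof -
  obtain \<alpha> \<beta> where \<alpha>\<beta>: "\<And>w. w \<le> L \<Longrightarrow> isCont \<alpha> w" "\<And>w. w \<le> L \<Longrightarrow> isCont \<beta> w"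
    "\<And>w. w \<le> L \<Longrightarrow> glued (\<lambda>j. resolv w f j + (- w) ^ j *\<^sub>R (\<alpha> w, \<beta> w))"
    by (rule resolvent_family[OF f orth]) blast+
  define u where "u w j = resolv w f j + (- w) ^ j *\<^sub>R (\<alpha> w, \<beta> w)" for w j
  have u: "expbd (u w)" for w
    unfolding u_def[abs_def] by (intro expbd_add expbd_resolv expbd_geom f)
  have g: "glued (u w)" if "w \<le> L" for w using \<alpha>\<beta>(3)[OF that] by (simp add: u_def[abs_def])
  have su: "shift (u w) = (\<lambda>j. (- w) *\<^sub>R u w j - f j)" for w
    by (simp add: u_def resolv_Suc fun_eq_iff algebra_simps)
  have ipsu: "ip (shift (u w)) y = - w * ip (u w) y - ip f y" if "expbd y" for w y
    unfolding su using expbd_scale[OF u, of "- w" w] 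
    by (subst ip_diff) (simp_all add: f that ip_scale u del: scaleR_minus_left)
  have res: "ip (u w) f - ip (u v) f = (w - v) * ip (u w) (u v)" if "w \<le> L" "v \<le> L" for w v
  proof -
    have "ip (shift (u w)) (u v) = ip (shift (u v)) (u w)"
      using shift_symmetric[OF u u g[OF that(1)] g[OF that(2)]] ip_commute by simp
    then show ?thesis
      unfolding ipsu[OF u] using ip_commute[of "u w" "u v"] ip_commute[of f "u w"] ip_commute[of f "u v"]
      by (simp add: algebra_simps)
  qed
  have cont: "continuous_on {..L} (\<lambda>w. ip (u w) y)" if "expbd y" for y
    unfolding u_def[abs_def]
    by (intro continuous_on_ip_family f that continuous_at_imp_continuous_on ballI) (use \<alpha>\<beta> in auto)
  \<comment> \<open>its derivative is the square norm of (L - w) u - f\<close>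
  define y where "y w = (L - w)\<^sup>2 * ip (u w) f - (L - w) * ip f f" for w
  have "y (- 1) \<le> y L"
  proof (rule DERIV_nonneg_imp_increasing_open[OF L])
    have "continuous_on {..L} y"
      unfolding y_def[abs_def] by (intro continuous_intros cont f)
    then show "continuous_on {- 1..L} y" by (rule continuous_on_subset) auto
    fix v assume v: "- 1 < v" "v < L"
    have "((\<lambda>w. ip (u w) f) has_real_derivative ip (u v) (u v)) (at v)"
      unfolding has_field_derivative_iff
    proof (rule Lim_transform_eventually)
      have "isCont (\<lambda>w. ip (u w) (u v)) v"
        by (rule continuous_on_interior[OF cont[OF u]]) (use v in simp)
      then show "((\<lambda>w. ip (u w) (u v)) \<longlongrightarrow> ip (u v) (u v)) (at v)" by (simp add: isCont_def)
      have "\<forall>\<^sub>F w in at v. w \<in> {..<L} \<and> w \<noteq> v"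
        using eventually_at_in_open[of "{..<L}" v] v by simp
      then show "\<forall>\<^sub>F w in at v. ip (u w) (u v) = (ip (u w) f - ip (u v) f) / (w - v)"
        by (rule eventually_mono) (use v res in auto)
    qed
    then have "(y has_real_derivative ((L - v)\<^sup>2 * ip (u v) (u v) - 2 * (L - v) * ip (u v) f + ip f f)) (at v)"
      unfolding y_def[abs_def]
      by (auto intro!: derivative_eq_intros simp: algebra_simps)
    moreover have "(L - v)\<^sup>2 * ip (u v) (u v) - 2 * (L - v) * ip (u v) f + ip f f \<ge> 0"
      by (rule ip_square_diff[OF u f])
    ultimately show "\<exists>d. DERIV y v :> d \<and> 0 \<le> d" by blast
  qed
  then have "(L + 1) * ((L + 1) * ip (u (- 1)) f) \<le> (L + 1) * ip f f"
    by (simp add: y_def power2_eq_square algebra_simps)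
  show thesis
  proof (cases "L = - 1")
    case True
    have "ip f f \<ge> 0" by (rule ip_nonneg[OF f])
    then show thesis
      using True L by (intro that[of "u (- 1)"] u g) (auto simp: fun_cong[OF su[of "- 1"]])
  next
    case False
    then have "(L + 1) * ip (u (- 1)) f \<le> ip f f"
      using L \<open>(L + 1) * ((L + 1) * ip (u (- 1)) f) \<le> (L + 1) * ip f f\<close> by simp
    then show thesis
      using L by (intro that[of "u (- 1)"] u g) (auto simp: fun_cong[OF su[of "- 1"]])
  qed
qed

definition remainder :: "real \<Rightarrow> (nat \<Rightarrow> real \<times> real) \<Rightarrow> nat \<Rightarrow> real \<times> real" where
  "remainder L x j = x j - (\<Sum>w\<in>zeros L. (ip x (mode w) / ip (mode w) (mode w)) *\<^sub>R mode w j)"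

lemma expbd_modes: "expbd (\<lambda>j. \<Sum>w\<in>zeros L. c w *\<^sub>R mode w j)"
  by (intro expbd_sum zeros_finite expbd_scale expbd_mode)

lemma expbd_remainder: "expbd x \<Longrightarrow> expbd (remainder L x)"
  unfolding remainder_def[abs_def] by (intro expbd_diff expbd_modes)

lemma glued_remainder: "expbd x \<Longrightarrow> glued x \<Longrightarrow> glued (remainder L x)"
  unfolding remainder_def[abs_def]
  by (intro glued_diff expbd_modes glued_sum zeros_finite glued_scale glued_mode expbd_scale expbd_mode) auto

lemma ip_modes: 
  assumes "expbd z"
  shows "ip (\<lambda>j. \<Sum>w\<in>zeros L. c w *\<^sub>R mode w j) z = (\<Sum>w\<in>zeros L. c w * ip (mode w) z)"
  using assms by (subst ip_sum) (auto intro!: zeros_finite expbd_scale expbd_mode simp: ip_scale expbd_mode)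

lemma remainder_orthogonal:
  assumes x: "expbd x" and w: "\<Delta> w = 0" "w \<le> L"
  shows "ip (remainder L x) (mode w) = 0"
proof -
  have "(\<Sum>v\<in>zeros L. ip x (mode v) / ip (mode v) (mode v) * ip (mode v) (mode w))
     = (\<Sum>v\<in>zeros L. if v = w then ip x (mode w) else 0)"
    by (intro sum.cong) (use w ip_mode_pos[of w] ip_mode_orthogonal in auto)
  also have "\<dots> = ip x (mode w)"
    using zeros_finite[of L] w by (subst sum.delta) auto
  finally show ?thesis
    unfolding remainder_def[abs_def] by (simp add: ip_diff x expbd_modes expbd_mode ip_modes)
qed

text \<open>
Applied with \<open>L\<close> tending to infinity this is completeness on the domain of the operator. The solution
provided by \<open>resolvent_bound\<close> agrees with the remainder because \<open>A + 1\<close> is positive.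
\<close>

lemma remainder_bound:
  assumes x: "expbd x" "glued x" and L: "L \<ge> 0"
  shows "(L + 1) * ip (remainder L x) (remainder L x) \<le> ip (\<lambda>j. x j - x (Suc j)) (\<lambda>j. x j - x (Suc j))"
proof -
  define y where "y = remainder L x"
  define f where "f j = x j - x (Suc j)" for j
  define h where "h j = y j - y (Suc j)" for j
  define c where "c w = ip x (mode w) / ip (mode w) (mode w) * (1 + w)" for w
  have y: "expbd y" "glued y" unfolding y_def by (rule expbd_remainder glued_remainder, rule x)+ (rule x)
  have f: "expbd f" unfolding f_def[abs_def] by (intro expbd_diff expbd_Suc x)
  have h: "expbd h" unfolding h_def[abs_def] by (intro expbd_diff expbd_Suc y)
  have hip: "ip h z = ip y z - ip (shift y) z" if "expbd z" for z
    unfolding h_def[abs_def] by (intro ip_diff expbd_Suc y that)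
  have orth: "ip h (mode w) = 0" if "w \<le> L" "\<Delta> w = 0" for w
  proof -
    have "ip (shift y) (mode w) = - w * ip y (mode w)"
      using shift_symmetric[OF y(1) expbd_mode y(2) glued_mode[OF that(2)]] ip_scale[OF expbd_mode, of "- w" w y]
      unfolding shift_mode by (simp only: ip_commute)
    then show ?thesis
      using remainder_orthogonal[OF x(1) that(2,1)] by (simp add: hip expbd_mode y_def)
  qed
  have f_eq: "f = (\<lambda>j. h j + (\<Sum>w\<in>zeros L. c w *\<^sub>R mode w j))"
  proof
    fix j
    have "mode w j - mode w (Suc j) = (1 + w) *\<^sub>R mode w j" for w
      using fun_cong[OF shift_mode[of w], of j] by (simp add: algebra_simps)
    then have *: "a *\<^sub>R mode w j - a *\<^sub>R mode w (Suc j) = (a * (1 + w)) *\<^sub>R mode w j" for a w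
      unfolding scaleR_diff_right[symmetric] scaleR_scaleR[symmetric] by (simp only:)
    show "f j = h j + (\<Sum>w\<in>zeros L. c w *\<^sub>R mode w j)"
      unfolding f_def h_def y_def remainder_def c_def *[symmetric] sum_subtractf by simp
  qed
  have "ip h (\<lambda>j. \<Sum>w\<in>zeros L. c w *\<^sub>R mode w j) = 0"
    unfolding ip_commute[of h] ip_modes[OF h] using orth ip_commute by (intro sum.neutral) auto
  moreover have "ip f f = ip h h + 2 * ip h (\<lambda>j. \<Sum>w\<in>zeros L. c w *\<^sub>R mode w j)
     + ip (\<lambda>j. \<Sum>w\<in>zeros L. c w *\<^sub>R mode w j) (\<lambda>j. \<Sum>w\<in>zeros L. c w *\<^sub>R mode w j)"
    (is "_ = _ + 2 * ip h ?s + ip ?s ?s")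
  proof -
    have "ip f z = ip h z + ip ?s z" if "expbd z" for z
      unfolding f_eq by (intro ip_add h expbd_modes that)
    from this[OF f] this[OF h] this[OF expbd_modes[where L = L and c = c]] show ?thesis
      using ip_commute[of h f] ip_commute[of ?s f] ip_commute[of ?s h] by simp
  qed
  ultimately have hf: "ip h h \<le> ip f f"
    using ip_nonneg[OF expbd_modes[where L = L and c = c]] by simp
  obtain u where u: "expbd u" "glued u" "\<And>j. u (Suc j) = u j - h j" "(L + 1) * ip u h \<le> ip h h"
    using resolvent_bound[OF h _ orth] L by (metis le_minus_one_simps(1) order_trans)
  define z where "z j = u j - y j" for j
  have z: "expbd z" "glued z" unfolding z_def[abs_def] by (intro expbd_diff glued_diff u y)+
  \<comment> \<open>a vector fixed by the shift would have the eigenvalue -1\<close>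
  have "shift z = z"
    using u(3) by (simp add: z_def h_def fun_eq_iff)
  then have "ip z z \<le> 0" using shift_nonpos[OF z] by simp
  then have "ip z h = 0" by (rule ip_eq_0_left[OF z(1)])
  then have "ip u h = ip y h"
    unfolding z_def[abs_def] by (simp add: ip_diff u y h)
  moreover have "ip y y \<le> ip y h"
    using shift_nonpos[OF y] hip[OF y(1)] ip_commute[of h y] by simp
  ultimately have "(L + 1) * ip y y \<le> (L + 1) * ip u h"
    using L by (intro mult_left_mono) auto
  also have "\<dots> \<le> ip f f" using u(4) hf by simp
  finally show ?thesis by (simp add: y_def f_def[abs_def])
qed

end

section \<open>Infinitely many eigenvalues and polynomial density\<close>

definition poly_seq :: "nat \<Rightarrow> real poly \<Rightarrow> nat \<Rightarrow> real" where
  "poly_seq n P j = coeff P j / bcoef n j"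

lemma expbd_poly_seq: "expbd (poly_seq n P)"
proof (rule expbdI[of _ "\<Sum>i\<le>degree P. \<bar>poly_seq n P i\<bar>" 1])
  fix j
  show "norm (poly_seq n P j) \<le> (\<Sum>i\<le>degree P. \<bar>poly_seq n P i\<bar>) * 1 ^ j"
  proof (cases "j \<le> degree P")
    case True
    then show ?thesis by (auto intro!: member_le_sum[where f = "\<lambda>i. \<bar>poly_seq n P i\<bar>"])
  next
    case False
    then show ?thesis by (simp add: poly_seq_def coeff_eq_0 sum_nonneg)
  qed
qed

lemma bser_poly_seq: "bser n (poly_seq n P) t = t ^ n * poly P (t\<^sup>2)"
proof -
  have "(\<Sum>j. of_real (bcoef n j) * poly_seq n P j * (t\<^sup>2) ^ j) = (\<Sum>j. coeff P j * (t\<^sup>2) ^ j)"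
    using bcoef_pos[of n] by (intro arg_cong[where f = suminf]) (auto simp: poly_seq_def fun_eq_iff less_imp_neq[symmetric])
  also have "\<dots> = (\<Sum>j\<le>degree P. coeff P j * (t\<^sup>2) ^ j)"
    by (rule suminf_finite) (auto simp: coeff_eq_0)
  finally show ?thesis by (simp add: bser_def poly_altdef)
qed

abbreviation flat_poly :: "nat \<Rightarrow> real poly \<Rightarrow> real \<Rightarrow> real" where
  "flat_poly n P t \<equiv> t ^ n * ((1 - t\<^sup>2)\<^sup>2 * poly P (t\<^sup>2))"

lemma bser_poly_seq_flat:
  "bser n (poly_seq n ([:1, -2, 1:] * P)) t = flat_poly n P t"
  unfolding bser_poly_seq by (simp add: power2_eq_square algebra_simps)

lemma slope_flat: "bser n (euler n (poly_seq n ([:1, -2, 1:] * P))) 1 = 0"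
proof -
  have "(bser n (poly_seq n ([:1, -2, 1:] * P)) has_real_derivative bser n (euler n (poly_seq n ([:1, -2, 1:] * P))) 1 / 1) (at 1)"
    by (rule bser_deriv[OF expbd_poly_seq]) simp
  moreover have "(bser n (poly_seq n ([:1, -2, 1:] * P)) has_real_derivative 0) (at 1)"
    unfolding bser_poly_seq_flat[abs_def]
    by (auto intro!: derivative_eq_intros)
  ultimately show ?thesis using DERIV_unique by fastforce
qed

text \<open>
The combination of \<open>s (Suc j) + x * s j\<close> removes the term with ratio \<open>- x\<close>. The ratio \<open>0\<close> is invisible for
large \<open>j\<close>, hence the factor \<open>w\<close> in the conclusion.
\<close>

lemma geometric_independent:
  fixes c :: "real \<Rightarrow> real"
  assumes "finite F" "\<And>j. j \<ge> d \<Longrightarrow> (\<Sum>w\<in>F. c w * (- w) ^ j) = 0" "w \<in> F"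
  shows "c w * w = 0"
  using assms
proof (induction F arbitrary: c w rule: finite_induct)
  case (insert x F)
  have F: "c v * v = 0" if v: "v \<in> F" for v
  proof -
    have "(c v * (x - v)) * v = 0"
    proof (rule insert.IH[OF _ v, of "\<lambda>v. c v * (x - v)"])
      fix j assume j: "j \<ge> d"
      have "(\<Sum>w\<in>F. c w * (x - w) * (- w) ^ j) = (\<Sum>w\<in>insert x F. c w * (x - w) * (- w) ^ j)"
        using insert.hyps by simp
      also have "\<dots> = (\<Sum>w\<in>insert x F. c w * (- w) ^ Suc j) + x * (\<Sum>w\<in>insert x F. c w * (- w) ^ j)"
        unfolding sum_distrib_left sum.distrib[symmetric] by (intro sum.cong) (auto simp: algebra_simps)
      also have "\<dots> = 0" using insert.prems(1)[of j] insert.prems(1)[of "Suc j"] j by simp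
      finally show "(\<Sum>w\<in>F. c w * (x - w) * (- w) ^ j) = 0" .
    qed
    moreover have "x \<noteq> v" using insert.hyps v by blast
    ultimately show ?thesis by simp
  qed
  have "(\<Sum>v\<in>F. c v * (- v) ^ Suc d) = 0"
    by (rule sum.neutral) (use F in auto)
  then have "c x * (- x) ^ Suc d = 0" using insert.prems(1)[of "Suc d"] insert.hyps by simp
  then have "c x * x = 0" by auto
  then show ?case using F insert.prems(2) by blast
qed simp

context star_graph begin

text \<open>
The factor \<open>(1 - t\<^sup>2)\<^sup>2\<close>, whose coefficient list is \<open>[:1, -2, 1:]\<close> in \<open>t\<^sup>2\<close>, makes value and derivative vanish
at the vertex, so that every such pair satisfies the gluing conditions.
\<close>

definition flat :: "real poly \<Rightarrow> real poly \<Rightarrow> nat \<Rightarrow> real \<times> real" where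
  "flat P Q j = (poly_seq n ([:1, -2, 1:] * P) j, poly_seq n' ([:1, -2, 1:] * Q) j)"

lemma expbd_flat: "expbd (flat P Q)"
proof -
  obtain C r where 1: "\<And>j. norm (poly_seq n ([:1, -2, 1:] * P) j) \<le> C * r ^ j" "C \<ge> 0" "r \<ge> 1"
    using expbdE[OF expbd_poly_seq] by blast
  obtain C' r' where 2: "\<And>j. norm (poly_seq n' ([:1, -2, 1:] * Q) j) \<le> C' * r' ^ j" "C' \<ge> 0" "r' \<ge> 1"
    using expbdE[OF expbd_poly_seq] by blast
  have "expbd (\<lambda>j. poly_seq n ([:1, -2, 1:] * P) j *\<^sub>R (1::real, 0::real) + poly_seq n' ([:1, -2, 1:] * Q) j *\<^sub>R (0, 1))"
  proof (rule expbd_add)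
    show "expbd (\<lambda>j. poly_seq n ([:1, -2, 1:] * P) j *\<^sub>R (1::real, 0::real))"
      by (rule expbdI[of _ C r]) (use 1 in simp)
    show "expbd (\<lambda>j. poly_seq n' ([:1, -2, 1:] * Q) j *\<^sub>R (0::real, 1::real))"
      by (rule expbdI[of _ C' r']) (use 2 in simp)
  qed
  then show ?thesis by (simp add: flat_def[abs_def])
qed

lemma val_flat: "val (flat P Q) t = (flat_poly n P t, flat_poly n' Q t)"
  unfolding val_def flat_def fst_conv snd_conv bser_poly_seq_flat ..

lemma glued_flat: "glued (flat P Q)"
  unfolding glued_def val_flat unfolding slope_def flat_def fst_conv snd_conv slope_flat by simp

text \<open>
With finitely many zeros, \<open>remainder_bound\<close> would hold for one fixed remainder and all large \<open>L\<close>, so that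
every pair in the domain would be a finite combination of eigenvectors. A sequence of finite support
with a nonzero entry at \<open>1\<close> is not a combination of geometric sequences.
\<close>

lemma zeros_infinite: "infinite {w. \<Delta> w = 0 \<and> w > 0}"
proof
  assume "finite {w. \<Delta> w = 0 \<and> w > 0}"
  then have "finite (insert 0 {w. \<Delta> w = 0 \<and> w > 0})" by simp
  then have fin: "finite {w. \<Delta> w = 0}"
    by (rule finite_subset[rotated]) (use zero_nonneg in force)
  define L0 where "L0 = Max (insert 0 {w. \<Delta> w = 0})"
  have L0: "L0 \<ge> 0" "\<And>w. \<Delta> w = 0 \<Longrightarrow> w \<le> L0" unfolding L0_def using fin by auto
  \<comment> \<open>the entry at 1 does not vanish, and all entries from 3 on do\<close>
  define x where "x = flat 1 0"
  define y where "y = remainder L0 x"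
  have x: "expbd x" "glued x" by (simp_all add: x_def expbd_flat glued_flat)
  have y: "expbd y" unfolding y_def by (rule expbd_remainder[OF x(1)])
  have yL: "remainder L x = y" if "L \<ge> L0" for L
  proof -
    have "(zeros L) = (zeros L0)" using L0 that by force
    then show ?thesis by (simp add: y_def remainder_def fun_eq_iff)
  qed
  define B where "B = ip (\<lambda>j. x j - x (Suc j)) (\<lambda>j. x j - x (Suc j))"
  have b: "(L + 1) * ip y y \<le> B" if "L \<ge> L0" for L
    using remainder_bound[OF x, of L] yL[OF that] L0(1) that by (simp add: B_def)
  have "ip y y \<le> 0"
  proof (rule ccontr)
    assume "\<not> ip y y \<le> 0"
    then have p: "ip y y > 0" by simp
    define L where "L = max L0 (B / ip y y)"
    have "B / ip y y * ip y y < (L + 1) * ip y y"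
      using p by (intro mult_strict_right_mono) (auto simp: L_def)
    then show False using b[of L] p by (simp add: L_def)
  qed
  then have v: "val y t = 0" if "0 < t" "t < 1" for t
    using ip_eq_0_val[OF y _ that(1)] that by simp
  have "fst (y j) = 0" for j
    by (rule bser_eq_0[OF expbd_fst[OF y], of n]) (use v in \<open>simp add: val_def prod_eq_iff\<close>)
  moreover define c where "c w = ip x (mode w) / ip (mode w) (mode w) * fst (amplitudes w)" for w
  ultimately have e: "fst (x j) = (\<Sum>w\<in>zeros L0. c w * (- w) ^ j)" for j
    unfolding y_def remainder_def c_def
    by (simp add: fst_sum mode_def mult_ac)
  have x0: "fst (x j) = 0" if "j \<ge> 3" for j
    using that by (simp add: x_def flat_def poly_seq_def coeff_eq_0)
  have "c w * w = 0" if "w \<in> (zeros L0)" for w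
    by (rule geometric_independent[OF zeros_finite _ that, of 3]) (use e x0 in metis)
  then have "fst (x 1) = 0" unfolding e by (intro sum.neutral) auto
  then show False using bcoef_pos[of n 1]
    by (simp add: x_def flat_def poly_seq_def)
qed

end

lemma unit_const:
  fixes c :: real
  shows "set_integrable lborel {0<..1::real} (\<lambda>t. c)" "(LINT t:{0<..1::real}|lborel. c) = c"
proof -
  have "integrable lborel (indicat_real {0<..1::real})"
    by (intro integrable_real_indicator) auto
  then show "set_integrable lborel {0<..1::real} (\<lambda>t. c)"
    unfolding set_integrable_def by (simp add: integrable_mult_left)
  show "(LINT t:{0<..1::real}|lborel. c) = c"
    by (simp add: set_lebesgue_integral_def)
qed

text \<open>
Cut \<open>F\<close> off near both end points, which costs little in square mean; the result divided by
\<open>t ^ n * (1 - t\<^sup>2)\<^sup>2\<close> is a continuous function of \<open>t\<^sup>2\<close>, to which the theorem of Weierstrass applies.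
\<close>

lemma polynomial_density:
  fixes F :: "real \<Rightarrow> real"
  assumes F: "continuous_on {0<..1} F" and M: "\<And>t. t \<in> {0<..1} \<Longrightarrow> \<bar>F t\<bar> \<le> M" and e: "e > 0"
  obtains P where "set_integrable lborel {0<..1} (\<lambda>t. (F t - flat_poly n P t)\<^sup>2 * t)"
    "(LINT t:{0<..1}|lborel. (F t - flat_poly n P t)\<^sup>2 * t) < e"
proof -
  have M0: "M \<ge> 0" using M[of 1] by simp
  define \<eta> where "\<eta> = min 1 (e / 8)"
  define \<delta> where "\<delta> = min (1/8) (e / (64 * (M\<^sup>2 + 1)))"
  have \<eta>: "\<eta> > 0" "\<eta>\<^sup>2 \<le> e / 8"
  proof -
    show "\<eta> > 0" using e by (simp add: \<eta>_def)
    have "\<eta> * \<eta> \<le> 1 * (e / 8)" using e by (intro mult_mono) (auto simp: \<eta>_def)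
    then show "\<eta>\<^sup>2 \<le> e / 8" by (simp add: power2_eq_square)
  qed
  have \<delta>: "\<delta> > 0" "\<delta> \<le> 1/8" "M\<^sup>2 * \<delta> \<le> e / 64"
  proof -
    have M1: "M\<^sup>2 + 1 > 0" by (smt (verit) zero_le_power2)
    show "\<delta> \<le> 1/8" unfolding \<delta>_def by (rule min.cobounded1)
    show "\<delta> > 0" using e M1 by (simp add: \<delta>_def)
    have "M\<^sup>2 * \<delta> \<le> (M\<^sup>2 + 1) * (e / (64 * (M\<^sup>2 + 1)))"
      using M1 e \<open>\<delta> > 0\<close> by (intro mult_mono) (auto simp: \<delta>_def)
    also have "\<dots> = e / 64"
    proof -
      have "K * (e / (64 * K)) = e / 64" if "K > 0" for K using that by simp
      from this[OF M1] show ?thesis .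
    qed
    finally show "M\<^sup>2 * \<delta> \<le> e / 64" .
  qed
  define cut where "cut t = max 0 (min 1 (t * (1 - t) / \<delta> - 1))" for t :: real
  have cut_0: "cut t = 0" if "t \<in> {0..1}" "t \<le> \<delta> \<or> t \<ge> 1 - \<delta>" for t
  proof -
    have "t * (1 - t) \<le> \<delta>"
      using that \<delta>(1) mult_left_le[of "1 - t" t] mult_right_le_one_le[of "1 - t" t]
      by (auto simp: mult.commute)
    then have "t * (1 - t) / \<delta> - 1 \<le> 0" using \<delta>(1) by (simp add: pos_divide_le_eq)
    then show ?thesis unfolding cut_def by linarith
  qed
  have cut_1: "cut t = 1" if "t \<in> {0..1}" "t \<ge> 4 * \<delta>" "t \<le> 1 - 4 * \<delta>" for t
  proof -
    have "t * (1 - t) \<ge> 2 * \<delta>"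
    proof (cases "t \<le> 1/2")
      case True
      have "4 * \<delta> * (1/2) \<le> t * (1 - t)" using True that \<delta> by (intro mult_mono) auto
      then show ?thesis by simp
    next
      case False
      have "(1/2) * (4 * \<delta>) \<le> t * (1 - t)" using False that \<delta> by (intro mult_mono) auto
      then show ?thesis by simp
    qed
    then have "t * (1 - t) / \<delta> - 1 \<ge> 1" using \<delta>(1) by (simp add: pos_le_divide_eq)
    then show ?thesis unfolding cut_def by linarith
  qed
  have cut_b: "0 \<le> cut t" "cut t \<le> 1" for t by (auto simp: cut_def)
  \<comment> \<open>clamping the argument keeps denominators away from zero where the cut-off vanishes anyway\<close>
  define c where "c t = max \<delta> (min (1 - \<delta>) t)" for t :: real
  have c: "\<delta> \<le> c t" "c t \<le> 1 - \<delta>" for t using \<delta> by (auto simp: c_def)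
  define r where "r s = cut (sqrt s) * F (c (sqrt s)) / (c (sqrt s) ^ n * (1 - (c (sqrt s))\<^sup>2)\<^sup>2)" for s
  have cI: "c t \<in> {0<..1}" for t using c[of t] \<delta>(1) by simp
  have cc: "continuous_on {0..1} (\<lambda>s. c (sqrt s))"
    unfolding c_def by (intro continuous_intros)
  have "continuous_on {0..1} (\<lambda>s. F (c (sqrt s)))"
    by (rule continuous_on_compose2[OF F cc]) (use cI in blast)
  moreover have cne: "c t ^ n * (1 - (c t)\<^sup>2)\<^sup>2 \<noteq> 0" for t
  proof -
    have "0 < c t" "c t < 1" using c[of t] \<delta> by linarith+
    then have "(c t)\<^sup>2 < 1" by (simp add: power_less_one_iff abs_square_less_1)
    then show ?thesis using \<open>0 < c t\<close> by simp
  qed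
  ultimately have rc: "continuous_on {0..1} r"
    unfolding r_def cut_def using \<delta> by (intro continuous_intros cc) auto
  have r_eq: "t ^ n * ((1 - t\<^sup>2)\<^sup>2 * r (t\<^sup>2)) = cut t * F t" if "t \<in> {0<..1}" for t
  proof (cases "t \<le> \<delta> \<or> t \<ge> 1 - \<delta>")
    case True
    then have "cut t = 0" using that cut_0 by simp
    then show ?thesis using that by (simp add: r_def)
  next
    case False
    then have "c t = t" by (simp add: c_def)
    then show ?thesis using that cne[of t] by (simp add: r_def)
  qed
  obtain g where g: "real_polynomial_function g" "\<And>s. s \<in> {0..1} \<Longrightarrow> \<bar>r s - g s\<bar> < \<eta>"
    using Stone_Weierstrass_real_polynomial_function[OF compact_Icc rc \<eta>(1)] by blast
  obtain a k where ak: "g = (\<lambda>x. \<Sum>i\<le>k. a i * x ^ i)"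
    using g(1) unfolding real_polynomial_function_iff_sum by blast
  define P where "P = (\<Sum>i\<le>k. monom (a i) i)"
  have Pg: "poly P s = g s" for s by (simp add: P_def ak poly_sum poly_monom)
  define q where "q t = flat_poly n P t" for t
  define bd where "bd t = 2 * M\<^sup>2 * (indicat_real {0..4*\<delta>} t + indicat_real {1 - 4*\<delta>..1} t) + 2 * \<eta>\<^sup>2" for t
  have bound: "(F t - q t)\<^sup>2 * t \<le> bd t" if t: "t \<in> {0<..1}" for t
  proof -
    have "\<bar>t ^ n * (1 - t\<^sup>2)\<^sup>2\<bar> \<le> 1"
    proof -
      have "t\<^sup>2 \<le> 1" using t by (simp add: power_le_one)
      then have "\<bar>1 - t\<^sup>2\<bar> \<le> 1" by simp
      then have "(1 - t\<^sup>2)\<^sup>2 \<le> 1" by (simp add: abs_square_le_1)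
      moreover have "t ^ n \<le> 1" using t by (simp add: power_le_one)
      ultimately have "t ^ n * (1 - t\<^sup>2)\<^sup>2 \<le> 1 * 1" using t by (intro mult_mono) auto
      then show ?thesis using t by simp
    qed
    moreover have "\<bar>r (t\<^sup>2) - g (t\<^sup>2)\<bar> \<le> \<eta>" using g(2)[of "t\<^sup>2"] t by (simp add: power_le_one)
    ultimately have "\<bar>t ^ n * (1 - t\<^sup>2)\<^sup>2\<bar> * \<bar>r (t\<^sup>2) - g (t\<^sup>2)\<bar> \<le> 1 * \<eta>" by (intro mult_mono) auto
    moreover have "cut t * F t - q t = (t ^ n * (1 - t\<^sup>2)\<^sup>2) * (r (t\<^sup>2) - g (t\<^sup>2))"
      unfolding r_eq[OF t, symmetric] q_def Pg by (simp add: algebra_simps)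
    ultimately have 2: "\<bar>cut t * F t - q t\<bar> \<le> \<eta>" by (simp add: abs_mult)
    have "\<bar>1 - cut t\<bar> * \<bar>F t\<bar> \<le> 1 * M" using cut_b[of t] M[OF t] by (intro mult_mono) auto
    then have "((1 - cut t) * F t)\<^sup>2 \<le> M\<^sup>2" using M0 by (simp add: abs_mult[symmetric] abs_le_square_iff[symmetric])
    then have 1: "((1 - cut t) * F t)\<^sup>2 \<le> M\<^sup>2 * (indicat_real {0..4*\<delta>} t + indicat_real {1 - 4*\<delta>..1} t)"
    proof (cases "t \<ge> 4 * \<delta> \<and> t \<le> 1 - 4 * \<delta>")
      case True
      then have "cut t = 1" using cut_1 t by simp
      then show ?thesis by simp
    next
      case False
      then have "1 \<le> indicat_real {0..4*\<delta>} t + indicat_real {1 - 4*\<delta>..1} t"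
        using t by (auto simp: indicator_def)
      then have "M\<^sup>2 * 1 \<le> M\<^sup>2 * (indicat_real {0..4*\<delta>} t + indicat_real {1 - 4*\<delta>..1} t)"
        by (intro mult_left_mono) auto
      then show ?thesis using \<open>((1 - cut t) * F t)\<^sup>2 \<le> M\<^sup>2\<close> by simp
    qed
    have 3: "(cut t * F t - q t)\<^sup>2 \<le> \<eta>\<^sup>2" using 2 \<eta>(1) abs_le_square_iff[of "cut t * F t - q t" \<eta>] by simp
    have "(F t - q t)\<^sup>2 * t \<le> (F t - q t)\<^sup>2" using t mult_left_le[of t "(F t - q t)\<^sup>2"] by simp
    also have "\<dots> \<le> 2 * ((1 - cut t) * F t)\<^sup>2 + 2 * (cut t * F t - q t)\<^sup>2"
    proof -
      have "(u + v)\<^sup>2 \<le> 2 * u\<^sup>2 + 2 * v\<^sup>2" for u v :: real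
        using sum_squares_bound[of u v] by (simp add: power2_sum)
      from this[of "(1 - cut t) * F t" "cut t * F t - q t"] show ?thesis by (simp add: algebra_simps)
    qed
    also have "\<dots> \<le> bd t" using 1 3 unfolding bd_def by simp
    finally show ?thesis .
  qed
  have ind: "set_integrable lborel {0<..1} (indicat_real {a..b})"
    "(LINT t:{0<..1}|lborel. indicat_real {a..b} t) \<le> b - a" if "a \<le> b" for a b :: real
  proof -
    have fin: "emeasure lborel ({0<..1} \<inter> {a..b}) < \<infinity>"
      by (rule order.strict_trans1[OF emeasure_mono[of _ "{a..b}"]]) (use that in auto)
    show "set_integrable lborel {0<..1} (indicat_real {a..b})"
      unfolding set_integrable_def using fin
      by (simp add: indicator_inter_arith[symmetric])
    have "(LINT t:{0<..1}|lborel. indicat_real {a..b} t) = measure lborel ({0<..1} \<inter> {a..b})"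
      by (simp add: set_lebesgue_integral_def indicator_inter_arith[symmetric])
    also have "\<dots> \<le> measure lborel {a..b}"
      using that by (intro measure_mono_fmeasurable) (auto intro!: fmeasurableI)
    finally show "(LINT t:{0<..1}|lborel. indicat_real {a..b} t) \<le> b - a" using that by simp
  qed
  have i1: "set_integrable lborel {0<..1} (indicat_real {0..4*\<delta>})" 
    and i2: "set_integrable lborel {0<..1} (indicat_real {1 - 4*\<delta>..1})"
    using \<delta>(1) by (simp_all add: ind)
  have i12: "set_integrable lborel {0<..1}
      (\<lambda>t. 2 * M\<^sup>2 * (indicat_real {0..4*\<delta>} t + indicat_real {1 - 4*\<delta>..1} t))"
    by (intro set_integrable_mult_right set_integral_add(1) i1 i2)
  have i3: "set_integrable lborel {0<..1::real} (\<lambda>t. 2 * \<eta>\<^sup>2)"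
    by (rule unit_const(1))
  have bdi: "set_integrable lborel {0<..1} bd"
    unfolding bd_def by (rule set_integral_add(1)[OF i12 i3])
  have qc: "continuous_on {0<..1} q" 
    unfolding q_def bser_poly_seq_flat[symmetric] by (rule bser_continuous[OF expbd_poly_seq])
  have int: "set_integrable lborel {0<..1} (\<lambda>t. (F t - q t)\<^sup>2 * t)"
  proof (rule set_integrable_bound[OF bdi])
    have "continuous_on {0<..1} (\<lambda>t. (F t - q t)\<^sup>2 * t)"
      by (intro continuous_on_mult continuous_on_power continuous_on_diff continuous_on_id F qc)
    from set_measurable_continuous_on[OF _ this]
    show "set_borel_measurable lborel {0<..1} (\<lambda>t. (F t - q t)\<^sup>2 * t)"
      by (simp add: set_borel_measurable_def)
    show "AE t in lborel. t \<in> {0<..1} \<longrightarrow> norm ((F t - q t)\<^sup>2 * t) \<le> norm (bd t)"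
      using bound by (auto intro!: AE_I2 order_trans[OF _ abs_ge_self])
  qed
  have "(LINT t:{0<..1}|lborel. (F t - q t)\<^sup>2 * t) \<le> (LINT t:{0<..1}|lborel. bd t)"
    by (rule set_integral_mono[OF int bdi bound])
  also have "\<dots> \<le> 2 * M\<^sup>2 * (4 * \<delta> + 4 * \<delta>) + 2 * \<eta>\<^sup>2"
  proof -
    have "(LINT t:{0<..1}|lborel. bd t) = 2 * M\<^sup>2 * ((LINT t:{0<..1}|lborel. indicat_real {0..4*\<delta>} t)
        + (LINT t:{0<..1}|lborel. indicat_real {1 - 4*\<delta>..1} t)) + 2 * \<eta>\<^sup>2"
      unfolding bd_def set_integral_add(2)[OF i12 i3] set_integral_mult_right 
        set_integral_add(2)[OF i1 i2] unit_const(2) ..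
    also have "\<dots> \<le> 2 * M\<^sup>2 * (4 * \<delta> + 4 * \<delta>) + 2 * \<eta>\<^sup>2"
      using ind(2)[of 0 "4 * \<delta>"] ind(2)[of "1 - 4 * \<delta>" 1] \<delta>(1)
      by (intro add_mono mult_left_mono order_refl) auto
    finally show ?thesis .
  qed
  also have "\<dots> \<le> 16 * (e / 64) + 2 * (e / 8)"
    using \<delta>(3) \<eta>(2) by (simp add: algebra_simps)
  also have "\<dots> < e" using e by simp
  finally show thesis using int that[of P] by (simp add: q_def)
qed

section \<open>The weighted square norm and the inversion of the half line\<close>

text \<open>
The radicand of \<open>normE\<close>, which is easier to add up than the norm itself.
\<close>

definition norm_sq :: "nat \<Rightarrow> (real \<Rightarrow> complex) \<Rightarrow> real" where
  "norm_sq m f = (LINT x:{0..1}|lborel. (cmod (f x))\<^sup>2 * x)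
           + (LINT x:{1..}|lborel. (cmod (f x))\<^sup>2 / x ^ (3 + 2 * m))"

lemma normE_norm_sq: "normE m f = sqrt (norm_sq m f)"
  by (simp add: normE_def norm_sq_def)

lemma normE_less: "e > 0 \<Longrightarrow> norm_sq m f < e\<^sup>2 \<Longrightarrow> normE m f < e"
  unfolding normE_norm_sq by (simp add: real_less_lsqrt)

lemma norm_sq_less: 
  assumes "normE m f < e" "e > 0" shows "norm_sq m f < e\<^sup>2"
  using assms unfolding normE_norm_sq by (metis less_eq_real_def real_sqrt_less_iff real_sqrt_abs abs_of_nonneg)

lemma sq_integrable_measurable:
  assumes "set_borel_measurable lborel {0..} f" "A \<in> sets borel" "A \<subseteq> {0..}" 
    and v: "v \<in> borel_measurable borel"
  shows "set_borel_measurable lborel A (\<lambda>x. (cmod (f x))\<^sup>2 * (v x :: real))"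
proof -
  have [measurable]: "(\<lambda>x. indicator {0..} x *\<^sub>R f x) \<in> borel_measurable borel" "A \<in> sets borel"
     "v \<in> borel_measurable borel"
    using assms by (simp_all add: set_borel_measurable_def)
  have "(\<lambda>x. indicat_real A x * ((cmod (indicator {0..} x *\<^sub>R f x))\<^sup>2 * v x)) \<in> borel_measurable borel"
    by measurable
  moreover have "(\<lambda>x. indicat_real A x * ((cmod (indicator {0..} x *\<^sub>R f x))\<^sup>2 * v x)) = (\<lambda>x. indicator A x *\<^sub>R ((cmod (f x))\<^sup>2 * v x))"
    using assms(3) by (auto simp: indicator_def fun_eq_iff)
  ultimately show ?thesis unfolding set_borel_measurable_def by (simp only: measurable_lborel2)
qed

text \<open>
The weak parallelogram bound replaces the triangle inequality in all approximation arguments.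
\<close>

lemma sq_integrable_add:
  assumes f: "sq_integrable m f" and g: "sq_integrable m g"
  shows "sq_integrable m (\<lambda>x. f x + g x)" 
    "norm_sq m (\<lambda>x. f x + g x) \<le> 2 * norm_sq m f + 2 * norm_sq m g"
proof -
  have meas: "set_borel_measurable lborel {0..} (\<lambda>x. f x + g x)"
    using f g unfolding sq_integrable_def set_borel_measurable_def
    by (auto simp: scaleR_add_right intro!: borel_measurable_add)
  have le: "(cmod (f x + g x))\<^sup>2 \<le> 2 * (cmod (f x))\<^sup>2 + 2 * (cmod (g x))\<^sup>2" for x
  proof -
    have "(cmod (f x + g x))\<^sup>2 \<le> (cmod (f x) + cmod (g x))\<^sup>2"
      by (intro power_mono norm_triangle_ineq) auto
    also have "\<dots> \<le> 2 * (cmod (f x))\<^sup>2 + 2 * (cmod (g x))\<^sup>2"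
      using sum_squares_bound[of "cmod (f x)" "cmod (g x)"] by (simp add: power2_sum)
    finally show ?thesis .
  qed
  have gen: "set_integrable lborel A (\<lambda>x. (cmod (f x + g x))\<^sup>2 * v x) \<and>
      (LINT x:A|lborel. (cmod (f x + g x))\<^sup>2 * v x) \<le> 2 * (LINT x:A|lborel. (cmod (f x))\<^sup>2 * v x) + 2 * (LINT x:A|lborel. (cmod (g x))\<^sup>2 * v x)"
    if A: "A \<in> sets borel" "A \<subseteq> {0..}" and v: "v \<in> borel_measurable borel" "\<And>x. x \<in> A \<Longrightarrow> v x \<ge> 0"
      and i: "set_integrable lborel A (\<lambda>x. (cmod (f x))\<^sup>2 * v x)" "set_integrable lborel A (\<lambda>x. (cmod (g x))\<^sup>2 * v x)"
    for A and v :: "real \<Rightarrow> real"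
  proof -
    have i': "set_integrable lborel A (\<lambda>x. 2 * ((cmod (f x))\<^sup>2 * v x))" "set_integrable lborel A (\<lambda>x. 2 * ((cmod (g x))\<^sup>2 * v x))"
      using i by simp_all
    have le': "(cmod (f x + g x))\<^sup>2 * v x \<le> 2 * ((cmod (f x))\<^sup>2 * v x) + 2 * ((cmod (g x))\<^sup>2 * v x)" if "x \<in> A" for x
      using mult_right_mono[OF le[of x] v(2)[OF that]] by (simp add: algebra_simps)
    have int: "set_integrable lborel A (\<lambda>x. (cmod (f x + g x))\<^sup>2 * v x)"
    proof (rule set_integrable_bound[OF set_integral_add(1)[OF i']])
      show "set_borel_measurable lborel A (\<lambda>x. (cmod (f x + g x))\<^sup>2 * v x)"
        by (rule sq_integrable_measurable[OF meas A v(1)])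
      show "AE x in lborel. x \<in> A \<longrightarrow> norm ((cmod (f x + g x))\<^sup>2 * v x) \<le> norm (2 * ((cmod (f x))\<^sup>2 * v x) + 2 * ((cmod (g x))\<^sup>2 * v x))"
        using le' v(2) by (auto intro!: AE_I2 order_trans[OF le'] simp: abs_mult)
    qed
    have "(LINT x:A|lborel. (cmod (f x + g x))\<^sup>2 * v x) \<le> (LINT x:A|lborel. 2 * ((cmod (f x))\<^sup>2 * v x) + 2 * ((cmod (g x))\<^sup>2 * v x))"
      by (rule set_integral_mono[OF int set_integral_add(1)[OF i'] le'])
    also have "\<dots> = 2 * (LINT x:A|lborel. (cmod (f x))\<^sup>2 * v x) + 2 * (LINT x:A|lborel. (cmod (g x))\<^sup>2 * v x)"
      unfolding set_integral_add(2)[OF i'] by simp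
    finally show ?thesis using int by simp
  qed
  have 1: "set_integrable lborel {0..1} (\<lambda>x. (cmod (f x + g x))\<^sup>2 * x) \<and>
      (LINT x:{0..1}|lborel. (cmod (f x + g x))\<^sup>2 * x) \<le> 2 * (LINT x:{0..1}|lborel. (cmod (f x))\<^sup>2 * x) + 2 * (LINT x:{0..1}|lborel. (cmod (g x))\<^sup>2 * x)"
    by (rule gen) (use f g in \<open>auto simp: sq_integrable_def\<close>)
  have 2: "set_integrable lborel {1..} (\<lambda>x. (cmod (f x + g x))\<^sup>2 * (1 / x ^ (3 + 2 * m))) \<and>
      (LINT x:{1..}|lborel. (cmod (f x + g x))\<^sup>2 * (1 / x ^ (3 + 2 * m))) \<le> 2 * (LINT x:{1..}|lborel. (cmod (f x))\<^sup>2 * (1 / x ^ (3 + 2 * m))) + 2 * (LINT x:{1..}|lborel. (cmod (g x))\<^sup>2 * (1 / x ^ (3 + 2 * m)))"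
    by (rule gen) (use f g in \<open>auto simp: sq_integrable_def\<close>)
  show "sq_integrable m (\<lambda>x. f x + g x)"
    using meas 1 2 by (simp add: sq_integrable_def)
  show "norm_sq m (\<lambda>x. f x + g x) \<le> 2 * norm_sq m f + 2 * norm_sq m g"
    using 1 2 by (simp add: norm_sq_def)
qed

lemma cmod_scale:
  "(\<lambda>x. (cmod (c * f x))\<^sup>2 * x) = (\<lambda>x. (cmod c)\<^sup>2 * ((cmod (f x))\<^sup>2 * x))"
  "(\<lambda>x. (cmod (c * f x))\<^sup>2 / x ^ k) = (\<lambda>x. (cmod c)\<^sup>2 * ((cmod (f x))\<^sup>2 / x ^ k))"
  by (simp_all add: norm_mult power_mult_distrib mult_ac)

lemma norm_sq_scale: "norm_sq m (\<lambda>x. c * f x) = (cmod c)\<^sup>2 * norm_sq m f"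
  unfolding norm_sq_def cmod_scale by (simp only: set_integral_mult_right distrib_left)

lemma sq_integrable_scale:
  assumes "sq_integrable m f" shows "sq_integrable m (\<lambda>x. c * f x)"
  unfolding sq_integrable_def cmod_scale
proof (intro conjI set_integrable_mult_right)
  have "(\<lambda>x. c * (indicator {0..} x *\<^sub>R f x)) \<in> borel_measurable lborel"
    using assms unfolding sq_integrable_def set_borel_measurable_def by (intro borel_measurable_times) auto
  moreover have "(\<lambda>x. c * (indicator {0..} x *\<^sub>R f x)) = (\<lambda>x. indicator {0..} x *\<^sub>R (c * f x))" by simp
  ultimately show "set_borel_measurable lborel {0..} (\<lambda>x. c * f x)"
    unfolding set_borel_measurable_def by (simp only:)
qed (use assms in \<open>simp_all add: sq_integrable_def\<close>)

lemma sq_integrable_diff: "sq_integrable m f \<Longrightarrow> sq_integrable m g \<Longrightarrow> sq_integrable m (\<lambda>x. f x - g x)"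
  using sq_integrable_add(1)[of m f "\<lambda>x. - 1 * g x"] sq_integrable_scale[of m g "-1"] by simp

lemma inversion_integral:
  fixes k :: "real \<Rightarrow> real"
  assumes k: "continuous_on {1..} k" and b: "\<And>x. x \<ge> 1 \<Longrightarrow> \<bar>k x\<bar> \<le> C * x ^ (2 * m)"
  shows "set_integrable lborel {0<..1} (\<lambda>t. t ^ (2 * m) * k (1 / t) * t)"
    and "set_integrable lborel {1..} (\<lambda>x. k x / x ^ (3 + 2 * m))"
    and "(LINT x:{1..}|lborel. k x / x ^ (3 + 2 * m)) = (LINT t:{0<..1}|lborel. t ^ (2 * m) * k (1 / t) * t)"
proof -
  define r where "r t = t ^ (2 * m) * k (1 / t) * t" for t
  define s where "s x = k x / x ^ (3 + 2 * m)" for x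
  have C0: "C \<ge> 0" using b[of 1] by simp
  have rc: "continuous_on {0<..1} r" unfolding r_def[abs_def]
    by (intro continuous_intros continuous_on_compose2[OF k]) auto
  have sc: "continuous_on {1..} s" unfolding s_def[abs_def]
    by (intro continuous_intros k) auto
  show ri: "set_integrable lborel {0<..1} (\<lambda>t. t ^ (2 * m) * k (1 / t) * t)"
    unfolding r_def[symmetric]
  proof (rule set_integrable_bound[OF unit_const(1)[of C]])
    show "set_borel_measurable lborel {0<..1} r"
      using set_measurable_continuous_on[OF _ rc] by (simp add: set_borel_measurable_def)
    have "\<bar>r t\<bar> \<le> C" if t: "t \<in> {0<..1}" for t
    proof -
      have "\<bar>r t\<bar> = t ^ (2 * m) * \<bar>k (1 / t)\<bar> * t" using t by (simp add: r_def abs_mult)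
      also have "\<dots> \<le> t ^ (2 * m) * (C * (1 / t) ^ (2 * m)) * 1"
        using t b[of "1 / t"] C0 by (intro mult_mono mult_nonneg_nonneg) auto
      also have "\<dots> = C" using t by (simp add: power_divide)
      finally show ?thesis .
    qed
    then show "AE t in lborel. t \<in> {0<..1} \<longrightarrow> norm (r t) \<le> norm C" using C0 by auto
  qed
  have im: "(\<lambda>t::real. 1 / t) ` {0<..1} = {1..}"
  proof (intro equalityI subsetI)
    fix x :: real assume "x \<in> {1..}"
    then show "x \<in> (\<lambda>t. 1 / t) ` {0<..1}" by (intro image_eqI[of _ _ "1 / x"]) auto
  qed auto
  have e: "\<bar>- 1 / t\<^sup>2\<bar> * s (1 / t) = r t" if "t \<in> {0<..1}" for t
    using that by (simp add: s_def r_def power_divide power_add field_simps power2_eq_square power3_eq_cube)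
  have cov: "(\<lambda>t. \<bar>- 1 / t\<^sup>2\<bar> * s (1 / t)) absolutely_integrable_on {0<..1} \<and>
           integral {0<..1} (\<lambda>t. \<bar>- 1 / t\<^sup>2\<bar> * s (1 / t)) = b
     \<longleftrightarrow> s absolutely_integrable_on ((\<lambda>t. 1 / t) ` {0<..1}) \<and> integral ((\<lambda>t. 1 / t) ` {0<..1}) s = b" for b
    by (rule has_absolute_integral_change_of_variables_1')
       (auto intro!: derivative_eq_intros inj_onI simp: power2_eq_square)
  have "r absolutely_integrable_on {0<..1}"
    using ri unfolding r_def[symmetric] set_integrable_def by (rule integrable_completion[THEN iffD2, rotated]) (use ri in \<open>auto simp: set_integrable_def r_def\<close>)
  moreover have "(\<lambda>t. \<bar>- 1 / t\<^sup>2\<bar> * s (1 / t)) absolutely_integrable_on {0<..1} \<longleftrightarrow> r absolutely_integrable_on {0<..1}"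
    by (rule set_integrable_cong[OF refl refl]) (rule e)
  moreover have "integral {0<..1} (\<lambda>t. \<bar>- 1 / t\<^sup>2\<bar> * s (1 / t)) = integral {0<..1} r"
    by (rule Henstock_Kurzweil_Integration.integral_cong) (rule e)
  ultimately have S: "s absolutely_integrable_on {1..}" "integral {1..} s = integral {0<..1} r"
    using cov[of "integral {0<..1} r"] unfolding im by blast+
  have "(\<lambda>x. indicator {1..} x *\<^sub>R s x) \<in> borel_measurable borel"
    using set_measurable_continuous_on[OF _ sc] by (simp add: set_borel_measurable_def)
  then show si: "set_integrable lborel {1..} (\<lambda>x. k x / x ^ (3 + 2 * m))"
    using S(1) unfolding s_def[symmetric] set_integrable_def by (subst (asm) integrable_completion) auto
  show "(LINT x:{1..}|lborel. k x / x ^ (3 + 2 * m)) = (LINT t:{0<..1}|lborel. t ^ (2 * m) * k (1 / t) * t)"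
    using set_borel_integral_eq_integral(2)[OF si] set_borel_integral_eq_integral(2)[OF ri] S(2)
    by (simp add: s_def[symmetric] r_def[symmetric])
qed

text \<open>
Functions for which all integrals exist and the substitution \<open>x = 1 / t\<close> applies: continuity, and growth
of order at most \<open>x ^ m\<close>.
\<close>

definition tame :: "nat \<Rightarrow> (real \<Rightarrow> complex) \<Rightarrow> bool" where
  "tame m h \<longleftrightarrow> continuous_on {0..} h \<and> (\<exists>C. \<forall>x\<ge>1. cmod (h x) \<le> C * x ^ m)"

lemma unit_interval_integral: "(LINT x:{0..1::real}|lborel. k x * x) = (LINT x:{0<..1}|lborel. k x * (x::real))" for k :: "real \<Rightarrow> real"
proof -
  have "(\<lambda>x. indicator {0..1} x *\<^sub>R (k x * x)) = (\<lambda>x. indicator {0<..1} x *\<^sub>R (k x * x))"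
    by (auto simp: indicator_def fun_eq_iff)
  then show ?thesis unfolding set_lebesgue_integral_def by (simp only:)
qed

lemma continuous_set_integrable_Icc:
  fixes k :: "real \<Rightarrow> real"
  assumes "continuous_on {0..1} k" shows "set_integrable lborel {0..1} k"
  unfolding set_integrable_def by (rule borel_integrable_compact) (use assms in auto)

lemma tame_pairing:
  fixes k :: "real \<Rightarrow> real"
  assumes k: "continuous_on {0..} k" and b: "\<And>x. x \<ge> 1 \<Longrightarrow> \<bar>k x\<bar> \<le> C * x ^ (2 * m)"
  shows "set_integrable lborel {0..1} (\<lambda>x. k x * x)" 
    "set_integrable lborel {1..} (\<lambda>x. k x / x ^ (3 + 2 * m))"
    "set_integrable lborel {0<..1} (\<lambda>t. (k t + t ^ (2 * m) * k (1 / t)) * t)"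
    "(LINT x:{0..1}|lborel. k x * x) + (LINT x:{1..}|lborel. k x / x ^ (3 + 2 * m))
      = (LINT t:{0<..1}|lborel. (k t + t ^ (2 * m) * k (1 / t)) * t)"
proof -
  have k1: "continuous_on {1..} k" by (rule continuous_on_subset[OF k]) auto
  have "continuous_on {0..1} (\<lambda>x. k x * x)"
    by (intro continuous_intros continuous_on_subset[OF k]) auto
  then show i: "set_integrable lborel {0..1} (\<lambda>x. k x * x)"
    by (rule continuous_set_integrable_Icc)
  have i': "set_integrable lborel {0<..1} (\<lambda>x. k x * x)"
    by (rule set_integrable_subset[OF i]) auto
  have inv: "set_integrable lborel {0<..1} (\<lambda>t. t ^ (2 * m) * k (1 / t) * t)"
    "set_integrable lborel {1..} (\<lambda>x. k x / x ^ (3 + 2 * m))"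
    "(LINT x:{1..}|lborel. k x / x ^ (3 + 2 * m)) = (LINT t:{0<..1}|lborel. t ^ (2 * m) * k (1 / t) * t)"
    by (rule inversion_integral[OF k1 b], assumption)+
  show "set_integrable lborel {1..} (\<lambda>x. k x / x ^ (3 + 2 * m))" by (rule inv(2))
  have e: "(\<lambda>t. (k t + t ^ (2 * m) * k (1 / t)) * t) = (\<lambda>t. k t * t + t ^ (2 * m) * k (1 / t) * t)"
    by (simp add: algebra_simps)
  show "set_integrable lborel {0<..1} (\<lambda>t. (k t + t ^ (2 * m) * k (1 / t)) * t)"
    unfolding e by (rule set_integral_add(1)[OF i' inv(1)])
  show "(LINT x:{0..1}|lborel. k x * x) + (LINT x:{1..}|lborel. k x / x ^ (3 + 2 * m))
      = (LINT t:{0<..1}|lborel. (k t + t ^ (2 * m) * k (1 / t)) * t)"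
    unfolding e set_integral_add(2)[OF i' inv(1)] inv(3) unit_interval_integral ..
qed

section \<open>Tame functions and the transfer to pairs\<close>

lemma tame_continuous: "tame m h \<Longrightarrow> continuous_on {0..} h"
  by (simp add: tame_def)

lemma tameE:
  assumes "tame m h" obtains C where "C \<ge> 0" "\<And>x. x \<ge> 1 \<Longrightarrow> cmod (h x) \<le> C * x ^ m"
proof -
  from assms obtain C where C: "\<And>x. x \<ge> 1 \<Longrightarrow> cmod (h x) \<le> C * x ^ m" by (auto simp: tame_def)
  have "cmod (h 1) \<le> C" using C[of 1] by simp
  then have "0 \<le> C" by (rule order_trans[OF norm_ge_zero])
  then show thesis using C that by blast
qed

lemma tame_add: 
  assumes "tame m f" "tame m g" shows "tame m (\<lambda>x. f x + g x)"
proof -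
  obtain C D where C: "\<And>x. x \<ge> 1 \<Longrightarrow> cmod (f x) \<le> C * x ^ m" and D: "\<And>x. x \<ge> 1 \<Longrightarrow> cmod (g x) \<le> D * x ^ m"
    using tameE assms by metis
  have "cmod (f x + g x) \<le> (C + D) * x ^ m" if "x \<ge> 1" for x
    using norm_triangle_ineq[of "f x" "g x"] C[OF that] D[OF that] by (simp add: distrib_right)
  moreover have "continuous_on {0..} (\<lambda>x. f x + g x)"
    using assms by (intro continuous_on_add tame_continuous)
  ultimately show ?thesis unfolding tame_def by blast
qed

lemma tame_scale: 
  assumes "tame m f" shows "tame m (\<lambda>x. c * f x)"
proof -
  obtain C where C: "\<And>x. x \<ge> 1 \<Longrightarrow> cmod (f x) \<le> C * x ^ m"
    using tameE assms by metis
  have "cmod (c * f x) \<le> (cmod c * C) * x ^ m" if "x \<ge> 1" for x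
    using mult_left_mono[OF C[OF that], of "cmod c"] by (simp add: norm_mult mult.assoc)
  moreover have "continuous_on {0..} (\<lambda>x. c * f x)"
    using assms by (intro continuous_on_mult continuous_on_const tame_continuous)
  ultimately show ?thesis unfolding tame_def by blast
qed

lemma tame_diff: "tame m f \<Longrightarrow> tame m g \<Longrightarrow> tame m (\<lambda>x. f x - g x)"
  using tame_add[of m f "\<lambda>x. -1 * g x"] tame_scale[of m g "-1"] by simp

lemma tame_zero: "tame m (\<lambda>x. 0)"
  by (auto simp: tame_def intro!: exI[of _ 0])

lemma tame_sum: "finite F \<Longrightarrow> (\<And>i. i \<in> F \<Longrightarrow> tame m (f i)) \<Longrightarrow> tame m (\<lambda>x. \<Sum>i\<in>F. f i x)"
proof (induction F rule: finite_induct)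
  case (insert i F)
  then have "tame m (\<lambda>x. f i x + (\<Sum>i\<in>F. f i x))" by (intro tame_add) blast+
  then show ?case using insert(1,2) by simp
qed (simp add: tame_zero)

lemma tame_square:
  assumes "tame m h"
  obtains C where "C \<ge> 0" "\<And>x. x \<ge> 1 \<Longrightarrow> \<bar>(cmod (h x))\<^sup>2\<bar> \<le> C * x ^ (2 * m)"
proof -
  obtain C where C: "C \<ge> 0" "\<And>x. x \<ge> 1 \<Longrightarrow> cmod (h x) \<le> C * x ^ m"
    using tameE[OF assms] by blast
  have "\<bar>(cmod (h x))\<^sup>2\<bar> \<le> C\<^sup>2 * x ^ (2 * m)" if "x \<ge> 1" for x
    using power_mono[OF C(2)[OF that], of 2] by (simp add: power_mult_distrib power_mult[symmetric] mult.commute)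
  then show thesis using that[of "C\<^sup>2"] by simp
qed

lemma tame_square_continuous: "tame m h \<Longrightarrow> continuous_on {0..} (\<lambda>x. (cmod (h x))\<^sup>2)"
  by (intro continuous_on_power continuous_on_norm tame_continuous)

lemma tame_sq_integrable:
  assumes "tame m h" shows "sq_integrable m h"
proof -
  obtain C where C: "\<And>x. x \<ge> 1 \<Longrightarrow> \<bar>(cmod (h x))\<^sup>2\<bar> \<le> C * x ^ (2 * m)" using tame_square[OF assms] by blast
  have "set_borel_measurable lborel {0..} h"
    using set_measurable_continuous_on[OF _ tame_continuous[OF assms]] by (simp add: set_borel_measurable_def)
  then show ?thesis
    unfolding sq_integrable_def
    by (intro conjI tame_pairing(1,2)[OF tame_square_continuous[OF assms] C])
qed

lemma tame_norm_sq:
  assumes "tame m h"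
  shows "norm_sq m h = (LINT t:{0<..1}|lborel. ((cmod (h t))\<^sup>2 + (cmod (of_real (t ^ m) * h (1 / t)))\<^sup>2) * t)"
    "set_integrable lborel {0<..1} (\<lambda>t. ((cmod (h t))\<^sup>2 + (cmod (of_real (t ^ m) * h (1 / t)))\<^sup>2) * t)"
proof -
  obtain C where C: "\<And>x. x \<ge> 1 \<Longrightarrow> \<bar>(cmod (h x))\<^sup>2\<bar> \<le> C * x ^ (2 * m)" using tame_square[OF assms] by blast
  have e: "(cmod (of_real (t ^ m) * h (1 / t)))\<^sup>2 = t ^ (2 * m) * (cmod (h (1 / t)))\<^sup>2" for t
    by (simp add: norm_mult norm_power power_mult_distrib power_mult[symmetric] mult.commute power_even_abs)
  show "norm_sq m h = (LINT t:{0<..1}|lborel. ((cmod (h t))\<^sup>2 + (cmod (of_real (t ^ m) * h (1 / t)))\<^sup>2) * t)"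
    unfolding norm_sq_def e by (rule tame_pairing(4)[OF tame_square_continuous[OF assms] C])
  show "set_integrable lborel {0<..1} (\<lambda>t. ((cmod (h t))\<^sup>2 + (cmod (of_real (t ^ m) * h (1 / t)))\<^sup>2) * t)"
    unfolding e by (rule tame_pairing(3)[OF tame_square_continuous[OF assms] C])
qed

lemma E_space_tame:
  assumes "e \<in> E_space" shows "tame m e"
proof -
  have c1: "continuous_on {0..1} e" and c2: "continuous_on {0<..1} (\<lambda>x. e (1 / x))"
    and bd: "bounded ((\<lambda>x. e (1 / x)) ` {0<..1})" using assms by (auto simp: E_space_def)
  from bd obtain C where "\<forall>z\<in>(\<lambda>x. e (1 / x)) ` {0<..1}. cmod z \<le> C"
    unfolding bounded_iff by blast
  then have C: "cmod (e (1 / t)) \<le> C" if "t \<in> {0<..1}" for t using that by blast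
  have "cmod (e 1) \<le> C" using C[of 1] by simp
  then have C0: "C \<ge> 0" by (rule order_trans[OF norm_ge_zero])
  have "cmod (e x) \<le> C * x ^ m" if x: "x \<ge> 1" for x
  proof -
    have "cmod (e x) \<le> C * 1" using C[of "1 / x"] x by simp
    also have "\<dots> \<le> C * x ^ m" using C0 x by (intro mult_left_mono) auto
    finally show ?thesis .
  qed
  moreover have "continuous_on {1..} e"
  proof -
    have "continuous_on {1..} (\<lambda>x. e (1 / (1 / x)))"
      by (rule continuous_on_compose2[OF c2]) (auto intro!: continuous_intros)
    then show ?thesis by simp
  qed
  with c1 have "continuous_on ({0..1} \<union> {1..}) e"
    by (intro continuous_on_closed_Un) auto
  moreover have "{0..1} \<union> {1..} = {0::real..}" by auto
  ultimately show ?thesis unfolding tame_def by auto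
qed

lemma set_integrable_inverse_cube:
  "set_integrable lborel {1..} (\<lambda>x::real. 1 / x ^ 3)"
  using inversion_integral(2)[of "\<lambda>x. 1" 1 0] by simp

text \<open>
Freezing the function beyond \<open>k\<close> gives bounded functions that converge to it by dominated convergence,
with the majorant \<open>4 * C\<^sup>2 / x ^ 3\<close>.
\<close>

lemma tame_E_compl:
  assumes h: "tame m h" shows "h \<in> E_compl m"
proof -
  obtain C where C: "C \<ge> 0" "\<And>x. x \<ge> 1 \<Longrightarrow> cmod (h x) \<le> C * x ^ m"
    using tameE[OF h] by blast
  define e where "e k x = h (min x (real (Suc k)))" for k x
  have e: "e k \<in> E_space" for k
  proof -
    have "continuous_on {0..1} (e k)"
      unfolding e_def by (rule continuous_on_compose2[OF tame_continuous[OF h]]) (auto intro!: continuous_intros)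
    moreover have "continuous_on {0<..1} (\<lambda>x. e k (1 / x))"
      unfolding e_def by (rule continuous_on_compose2[OF tame_continuous[OF h]]) (auto intro!: continuous_intros)
    moreover have "bounded (h ` {0..real (Suc k)})"
      by (intro compact_imp_bounded compact_continuous_image continuous_on_subset[OF tame_continuous[OF h]]) auto
    moreover have "e k ` {0..1} \<subseteq> h ` {0..real (Suc k)}" "(\<lambda>x. e k (1 / x)) ` {0<..1} \<subseteq> h ` {0..real (Suc k)}"
      unfolding e_def by (intro image_subsetI imageI, simp)+
    ultimately have "continuous_on {0..1} (e k)" "continuous_on {0<..1} (\<lambda>x. e k (1 / x))"
      "bounded (e k ` {0..1})" "bounded ((\<lambda>x. e k (1 / x)) ` {0<..1})"
      by (blast intro: bounded_subset)+
    then show ?thesis unfolding E_space_def by blast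
  qed
  have lim: "(\<lambda>k. norm_sq m (\<lambda>x. h x - e k x)) \<longlonglongrightarrow> 0"
  proof -
    have z: "(LINT x:{0..1}|lborel. (cmod (h x - e k x))\<^sup>2 * x) = 0" for k
    proof -
      have "(\<lambda>x. indicator {0..1} x *\<^sub>R ((cmod (h x - e k x))\<^sup>2 * x)) = (\<lambda>x::real. 0::real)"
        by (auto simp: indicator_def e_def min_def fun_eq_iff)
      then show ?thesis unfolding set_lebesgue_integral_def by (simp only: Bochner_Integration.integral_zero)
    qed
    have "(\<lambda>k. LINT x|lborel. indicator {1..} x *\<^sub>R ((cmod (h x - e k x))\<^sup>2 / x ^ (3 + 2 * m))) \<longlonglongrightarrow> (LINT x::real|lborel. (0::real))"
    proof (rule integral_dominated_convergence[where w = "\<lambda>x. indicator {1..} x *\<^sub>R ((4 * C\<^sup>2) * (1 / x ^ 3))"])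
      show "integrable lborel (\<lambda>x. indicator {1..} x *\<^sub>R ((4 * C\<^sup>2) * (1 / x ^ 3)))"
        using set_integrable_mult_right[OF set_integrable_inverse_cube] unfolding set_integrable_def by blast
      show "(\<lambda>x. indicator {1..} x *\<^sub>R ((cmod (h x - e k x))\<^sup>2 / x ^ (3 + 2 * m))) \<in> borel_measurable lborel" for k
      proof -
        have "sq_integrable m (\<lambda>x. h x - e k x)"
          by (intro tame_sq_integrable tame_diff h E_space_tame e)
        then show ?thesis
          unfolding sq_integrable_def set_integrable_def by (auto intro: borel_measurable_integrable)
      qed
      show "AE x in lborel. (\<lambda>k. indicator {1..} x *\<^sub>R ((cmod (h x - e k x))\<^sup>2 / x ^ (3 + 2 * m))) \<longlonglongrightarrow> 0"
      proof (rule AE_I2)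
        fix x :: real
        have "\<forall>\<^sub>F k in sequentially. x \<le> real (Suc k)"
          using eventually_ge_at_top[of "nat \<lceil>x\<rceil>"] by (rule eventually_mono) linarith
        then have "\<forall>\<^sub>F k in sequentially. indicator {1..} x *\<^sub>R ((cmod (h x - e k x))\<^sup>2 / x ^ (3 + 2 * m)) = 0"
          by (rule eventually_mono) (simp add: e_def min_def)
        then show "(\<lambda>k. indicator {1..} x *\<^sub>R ((cmod (h x - e k x))\<^sup>2 / x ^ (3 + 2 * m))) \<longlonglongrightarrow> 0"
          by (rule tendsto_eventually)
      qed
      show "AE x in lborel. norm (indicator {1..} x *\<^sub>R ((cmod (h x - e k x))\<^sup>2 / x ^ (3 + 2 * m))) \<le> indicator {1..} x *\<^sub>R ((4 * C\<^sup>2) * (1 / x ^ 3))" for k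
      proof (rule AE_I2)
        fix x :: real
        show "norm (indicator {1..} x *\<^sub>R ((cmod (h x - e k x))\<^sup>2 / x ^ (3 + 2 * m))) \<le> indicator {1..} x *\<^sub>R ((4 * C\<^sup>2) * (1 / x ^ 3))"
        proof (cases "x \<ge> 1")
          case True
          define y where "y = min x (real (Suc k))"
          have y: "1 \<le> y" "y \<le> x" using True by (auto simp: y_def)
          have "cmod (h y) \<le> C * y ^ m" by (rule C(2)[OF y(1)])
          also have "\<dots> \<le> C * x ^ m" using y C(1) by (intro mult_left_mono power_mono) auto
          finally have "cmod (h x - e k x) \<le> 2 * C * x ^ m"
            using C(2)[OF True] norm_triangle_ineq4[of "h x" "e k x"] by (simp add: e_def y_def)
          then have "(cmod (h x - e k x))\<^sup>2 \<le> (2 * C * x ^ m)\<^sup>2" by (intro power_mono) auto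
          also have "\<dots> = 4 * C\<^sup>2 * x ^ (2 * m)" by (simp add: power_mult_distrib power_mult[symmetric] mult.commute)
          finally have "(cmod (h x - e k x))\<^sup>2 / x ^ (3 + 2 * m) \<le> 4 * C\<^sup>2 * x ^ (2 * m) / x ^ (3 + 2 * m)"
            using True by (intro divide_right_mono) auto
          also have "\<dots> = 4 * C\<^sup>2 * (1 / x ^ 3)" using True by (simp add: power_add)
          finally show ?thesis using True by simp
        qed simp
      qed
    qed simp
    then show ?thesis unfolding norm_sq_def z by (simp add: set_lebesgue_integral_def)
  qed
  have "\<exists>u\<in>E_space. normE m (\<lambda>x. h x - u x) < \<epsilon>" if "\<epsilon> > 0" for \<epsilon>
  proof -
    have "\<forall>\<^sub>F k in sequentially. norm_sq m (\<lambda>x. h x - e k x) < \<epsilon>\<^sup>2"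
      using order_tendstoD(2)[OF lim, of "\<epsilon>\<^sup>2"] that by simp
    then obtain k where "norm_sq m (\<lambda>x. h x - e k x) < \<epsilon>\<^sup>2" by (auto simp: eventually_sequentially)
    then show ?thesis using normE_less[OF that] e by blast
  qed
  then show ?thesis unfolding E_compl_def using tame_sq_integrable[OF h] by blast
qed

context star_graph begin

text \<open>
The function on the half line that belongs to a pair on the unit interval.
\<close>

definition fun_of :: "(nat \<Rightarrow> real \<times> real) \<Rightarrow> real \<Rightarrow> complex" where
  "fun_of x t = of_real (if t \<le> 1 then fst (val x t) else t ^ m * snd (val x (1 / t)))"

lemma fun_of_diff: "expbd x \<Longrightarrow> expbd y \<Longrightarrow> fun_of (\<lambda>j. x j - y j) t = fun_of x t - fun_of y t"
  by (simp add: fun_of_def val_diff algebra_simps)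

lemma fun_of_scale: "expbd x \<Longrightarrow> fun_of (\<lambda>j. c *\<^sub>R x j) t = of_real c * fun_of x t"
  by (simp add: fun_of_def val_scale)

lemma fun_of_add: "expbd x \<Longrightarrow> expbd y \<Longrightarrow> fun_of (\<lambda>j. x j + y j) t = fun_of x t + fun_of y t"
  by (simp add: fun_of_def val_add algebra_simps)

lemma fun_of_zero: "fun_of (\<lambda>j. 0) t = 0"
  by (simp add: fun_of_def val_def bser_zero)

lemma fun_of_sum: 
  assumes "finite F" "\<And>w. w \<in> F \<Longrightarrow> expbd (x w)"
  shows "fun_of (\<lambda>j. \<Sum>w\<in>F. x w j) t = (\<Sum>w\<in>F. fun_of (x w) t)"
  using assms
proof (induction F rule: finite_induct)
  case (insert w F)
  then have "fun_of (\<lambda>j. x w j + (\<Sum>w\<in>F. x w j)) t = fun_of (x w) t + fun_of (\<lambda>j. \<Sum>w\<in>F. x w j) t" 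
    by (intro fun_of_add expbd_sum) blast+
  then show ?case using insert by simp
qed (simp add: fun_of_zero)

lemma tame_fun_of:
  assumes x: "expbd x" "glued x" shows "tame m (fun_of x)"
proof -
  have c: "continuous_on ({0..1} \<union> {1..}) (\<lambda>t. if t \<le> 1 then fst (val x t) else t ^ m * snd (val x (1 / t)))"
  proof (rule continuous_on_If)
    show "continuous_on {1..} (\<lambda>t. t ^ m * snd (val x (1 / t)))"
      by (intro continuous_intros continuous_on_compose2[OF val_continuous(2)[OF x(1), of UNIV]]) auto
    show "fst (val x t) = t ^ m * snd (val x (1 / t))" if "t \<in> {0..1}" "\<not> t \<le> 1" for t using that by simp
    show "fst (val x t) = t ^ m * snd (val x (1 / t))" if "t \<in> {1..}" "t \<le> 1" for t
      using that x(2) by (auto simp: glued_def dest: antisym)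
  qed (auto intro: val_continuous x)
  moreover have "{0..1} \<union> {1..} = {0::real..}" by auto
  ultimately have "continuous_on {0..} (fun_of x)"
    unfolding fun_of_def[abs_def] by (intro continuous_on_of_real) simp
  moreover have "bounded ((\<lambda>t. snd (val x t)) ` {0..1})"
    by (intro compact_imp_bounded compact_continuous_image val_continuous x) auto
  then obtain C where "\<forall>z\<in>(\<lambda>t. snd (val x t)) ` {0..1}. norm z \<le> C"
    unfolding bounded_iff by blast
  then have C: "\<bar>snd (val x t)\<bar> \<le> C" if "t \<in> {0..1}" for t using that by force
  have "cmod (fun_of x t) \<le> C * t ^ m" if "t \<ge> 1" for t
  proof -
    have "fun_of x t = of_real (t ^ m * snd (val x (1 / t)))"
      using that x(2) by (auto simp: fun_of_def glued_def dest: antisym)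
    then have "cmod (fun_of x t) = t ^ m * \<bar>snd (val x (1 / t))\<bar>"
      using that by (simp only: norm_of_real abs_mult) simp
    also have "\<dots> \<le> t ^ m * C" using that C[of "1 / t"] by (intro mult_left_mono) auto
    finally show ?thesis by (simp add: mult.commute)
  qed
  ultimately show ?thesis unfolding tame_def by blast
qed

lemma fun_of_left: "t \<in> {0<..1} \<Longrightarrow> fun_of x t = of_real (fst (val x t))"
  by (simp add: fun_of_def)

lemma fun_of_right: 
  assumes "glued x" "t \<in> {0<..1}" shows "of_real (t ^ m) * fun_of x (1 / t) = of_real (snd (val x t))"
proof (cases "t = 1")
  case True
  then show ?thesis using assms by (simp add: fun_of_def glued_def)
next
  case False
  then show ?thesis using assms by (simp add: fun_of_def power_one_over)
qed

lemma herm_fun_of: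
  assumes x: "expbd x" "glued x" and y: "expbd y" "glued y"
  shows "herm m (fun_of x) (fun_of y) = of_real (ip x y)"
proof -
  define k where "k t = Re (fun_of x t) * Re (fun_of y t)" for t
  have re: "fun_of z t = of_real (Re (fun_of z t))" for z t by (simp add: fun_of_def)
  have pr: "fun_of x t * cnj (fun_of y t) = of_real (k t)" for t
    by (subst (1 2) re) (simp add: k_def)
  obtain C where C: "C \<ge> 0" "\<And>t. t \<ge> 1 \<Longrightarrow> cmod (fun_of x t) \<le> C * t ^ m" using tameE[OF tame_fun_of[OF x]] by blast
  obtain D where D: "D \<ge> 0" "\<And>t. t \<ge> 1 \<Longrightarrow> cmod (fun_of y t) \<le> D * t ^ m" using tameE[OF tame_fun_of[OF y]] by blast
  have kb: "\<bar>k t\<bar> \<le> (C * D) * t ^ (2 * m)" if "t \<ge> 1" for t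
  proof -
    have "\<bar>k t\<bar> = cmod (fun_of x t) * cmod (fun_of y t)"
      by (subst (1 2) re) (simp add: k_def abs_mult)
    also have "\<dots> \<le> (C * t ^ m) * (D * t ^ m)" using C D that by (intro mult_mono) auto
    also have "\<dots> = (C * D) * t ^ (2 * m)" unfolding mult_2 power_add by (simp add: mult_ac)
    finally show ?thesis .
  qed
  have kc: "continuous_on {0..} k"
    unfolding k_def by (intro continuous_on_mult continuous_on_Re tame_continuous[OF tame_fun_of] x y)
  have "herm m (fun_of x) (fun_of y) = (LINT t:{0..1}|lborel. complex_of_real (k t * t)) + (LINT t:{1..}|lborel. complex_of_real (k t / t ^ (3 + 2 * m)))"
    unfolding herm_def pr by simp
  also have "\<dots> = of_real ((LINT t:{0..1}|lborel. k t * t) + (LINT t:{1..}|lborel. k t / t ^ (3 + 2 * m)))"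
    unfolding set_integral_complex_of_real by simp
  also have "(LINT t:{0..1}|lborel. k t * t) + (LINT t:{1..}|lborel. k t / t ^ (3 + 2 * m)) = (LINT t:{0<..1}|lborel. (k t + t ^ (2 * m) * k (1 / t)) * t)"
    by (rule tame_pairing(4)[OF kc kb])
  also have "\<dots> = (LINT t:{0<..1}|lborel. (dot (val x t) (val y t)) * t)"
  proof (rule set_lebesgue_integral_cong, simp, intro allI impI)
    fix t :: real assume t: "t \<in> {0<..1}"
    have "k t = fst (val x t) * fst (val y t)" using t by (simp add: k_def fun_of_left)
    moreover have "t ^ (2 * m) * k (1 / t) = snd (val x t) * snd (val y t)"
    proof -
      have "t ^ m * Re (fun_of z (1 / t)) = snd (val z t)" if "glued z" for z
        using arg_cong[OF fun_of_right[OF that t], of Re] by simp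
      note right = this[OF x(2)] this[OF y(2)]
      have "t ^ (2 * m) * k (1 / t) = (t ^ m * Re (fun_of x (1 / t))) * (t ^ m * Re (fun_of y (1 / t)))"
        unfolding k_def mult_2 power_add by (simp only: mult_ac)
      then show ?thesis unfolding right .
    qed
    ultimately show "(k t + t ^ (2 * m) * k (1 / t)) * t = (dot (val x t) (val y t)) * t" by simp
  qed
  also have "\<dots> = (LINT t:{0..1}|lborel. (dot (val x t) (val y t)) * t)"
    by (rule unit_interval_integral[symmetric])
  also have "\<dots> = ip x y"
  proof -
    have "set_integrable lborel {0..1} (\<lambda>t. (dot (val x t) (val y t)) * t)"
      by (intro continuous_set_integrable_Icc continuous_on_mult continuous_on_add val_continuous continuous_on_id x y)
    from set_borel_integral_eq_integral(2)[OF this] show ?thesis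
      unfolding ip_def by (simp add: mult.commute)
  qed
  finally show ?thesis .
qed

lemma norm_sq_herm: "of_real (norm_sq k f) = herm k f f"
proof -
  have e: "f x * cnj (f x) = of_real ((cmod (f x))\<^sup>2)" for x by (rule complex_norm_square[symmetric])
  have "herm k f f = (LINT t:{0..1}|lborel. complex_of_real ((cmod (f t))\<^sup>2 * t)) + (LINT t:{1..}|lborel. complex_of_real ((cmod (f t))\<^sup>2 / t ^ (3 + 2 * k)))"
    unfolding herm_def e by simp
  also have "\<dots> = of_real (norm_sq k f)"
    unfolding norm_sq_def set_integral_complex_of_real by simp
  finally show ?thesis ..
qed

lemma norm_sq_fun_of:
  assumes "expbd x" "glued x" shows "norm_sq m (fun_of x) = ip x x"
  using herm_fun_of[OF assms assms] norm_sq_herm[of m "fun_of x"] of_real_eq_iff by metis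

end

section \<open>Families of eigenvectors are Hilbert bases\<close>

lemma herm_scale: "herm m (\<lambda>x. a * f x) (\<lambda>x. b * g x) = a * cnj b * herm m f g"
proof -
  have e: "(\<lambda>x. a * f x * cnj (b * g x) * of_real x) = (\<lambda>x. (a * cnj b) * (f x * cnj (g x) * of_real x))"
    "(\<lambda>x. a * f x * cnj (b * g x) / of_real (x ^ (3 + 2 * m))) = (\<lambda>x. (a * cnj b) * (f x * cnj (g x) / of_real (x ^ (3 + 2 * m))))"
    by (simp_all add: fun_eq_iff mult_ac)
  show ?thesis unfolding herm_def e by (simp only: set_integral_mult_right distrib_left)
qed

context star_graph begin

text \<open>
Approximate by a pair of flat polynomials, and that pair by its partial expansion. The statement holds
for all large \<open>L\<close> so that real and imaginary parts can share one \<open>L\<close>.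
\<close>

lemma real_approximation:
  assumes h: "tame m (\<lambda>x. of_real (h x))" and d: "\<delta> > 0"
  obtains L0 where "L0 \<ge> 0" "\<And>L. L \<ge> L0 \<Longrightarrow> \<exists>c :: real \<Rightarrow> real. norm_sq m (\<lambda>x. of_real (h x) -
      (\<Sum>w\<in>zeros L. of_real (c w) * fun_of (mode w) x)) < \<delta>"
proof -
  obtain C where C: "C \<ge> 0" "\<And>x. x \<ge> 1 \<Longrightarrow> cmod (of_real (h x)) \<le> C * x ^ m"
    using tameE[OF h] by blast
  have "continuous_on {0..} (\<lambda>x. Re (of_real (h x)))"
    by (intro continuous_on_Re tame_continuous[OF h])
  then have hc: "continuous_on {0..} h" by simp
  have hc1: "continuous_on {0<..1} h" by (rule continuous_on_subset[OF hc]) auto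
  have "bounded (h ` {0..1})"
    by (intro compact_imp_bounded compact_continuous_image continuous_on_subset[OF hc]) auto
  then obtain M where M: "\<forall>z\<in>h ` {0..1}. norm z \<le> M" unfolding bounded_iff by blast
  have Mb: "\<bar>h t\<bar> \<le> M" if "t \<in> {0<..1}" for t
  proof -
    have "h t \<in> h ` {0..1}" using that by auto
    then show ?thesis using M by force
  qed
  have gc: "continuous_on {0<..1} (\<lambda>t. t ^ m * h (1 / t))"
  proof (intro continuous_on_mult continuous_on_power continuous_on_id)
    have "continuous_on {0<..1} (\<lambda>t. 1 / t :: real)" by (intro continuous_on_divide continuous_on_const continuous_on_id) auto
    then show "continuous_on {0<..1} (\<lambda>t. h (1 / t))"
      by (rule continuous_on_compose2[OF hc]) auto
  qed
  have gb: "\<bar>t ^ m * h (1 / t)\<bar> \<le> C" if "t \<in> {0<..1}" for t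
  proof -
    have "\<bar>t ^ m * h (1 / t)\<bar> = t ^ m * \<bar>h (1 / t)\<bar>" using that by (simp add: abs_mult)
    also have "\<dots> \<le> t ^ m * (C * (1 / t) ^ m)" using C(2)[of "1 / t"] that by (intro mult_left_mono) auto
    also have "\<dots> = C" using that by (simp add: power_divide)
    finally show ?thesis .
  qed
  have d8: "\<delta> / 8 > 0" using d by simp
  obtain P where P: "set_integrable lborel {0<..1} (\<lambda>t. (h t - flat_poly n P t)\<^sup>2 * t)"
    "(LINT t:{0<..1}|lborel. (h t - flat_poly n P t)\<^sup>2 * t) < \<delta> / 8"
    using polynomial_density[OF hc1 Mb d8, of n] by blast
  obtain Q where Q: "set_integrable lborel {0<..1} (\<lambda>t. (t ^ m * h (1 / t) - flat_poly n' Q t)\<^sup>2 * t)"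
    "(LINT t:{0<..1}|lborel. (t ^ m * h (1 / t) - flat_poly n' Q t)\<^sup>2 * t) < \<delta> / 8"
    using polynomial_density[OF gc gb d8, of n'] by blast
  define x where "x = flat P Q"
  have x: "expbd x" "glued x" by (simp_all add: x_def expbd_flat glued_flat)
  have t1: "tame m (\<lambda>t. of_real (h t) - fun_of x t)" by (intro tame_diff h tame_fun_of x)
  have "norm_sq m (\<lambda>t. of_real (h t) - fun_of x t) = (LINT t:{0<..1}|lborel. 
      ((h t - flat_poly n P t)\<^sup>2 * t + (t ^ m * h (1 / t) - flat_poly n' Q t)\<^sup>2 * t))"
    unfolding tame_norm_sq(1)[OF t1]
  proof (rule set_lebesgue_integral_cong, simp, intro allI impI)
    fix t :: real assume t: "t \<in> {0<..1}"
    have 1: "of_real (h t) - fun_of x t = complex_of_real (h t - fst (val x t))"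
      using fun_of_left[OF t] by simp
    have 2: "of_real (t ^ m) * (of_real (h (1 / t)) - fun_of x (1 / t)) = complex_of_real (t ^ m * h (1 / t) - snd (val x t))"
      unfolding right_diff_distrib fun_of_right[OF x(2) t] by simp
    show "((cmod (of_real (h t) - fun_of x t))\<^sup>2 + (cmod (of_real (t ^ m) * (of_real (h (1 / t)) - fun_of x (1 / t))))\<^sup>2) * t
       = (h t - flat_poly n P t)\<^sup>2 * t + (t ^ m * h (1 / t) - flat_poly n' Q t)\<^sup>2 * t"
      unfolding 1 2 norm_of_real power2_abs unfolding x_def val_flat by (simp add: distrib_right)
  qed
  also have "\<dots> < \<delta> / 8 + \<delta> / 8"
    unfolding set_integral_add(2)[OF P(1) Q(1)] using P(2) Q(2) by (rule add_strict_mono)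
  finally have a1: "norm_sq m (\<lambda>t. of_real (h t) - fun_of x t) < \<delta> / 4" by simp
  define B where "B = ip (\<lambda>j. x j - x (Suc j)) (\<lambda>j. x j - x (Suc j))"
  have B0: "B \<ge> 0" unfolding B_def by (intro ip_nonneg expbd_diff expbd_Suc x)
  define L0 where "L0 = 4 * B / \<delta>"
  have L0: "L0 \<ge> 0" using B0 d by (simp add: L0_def)
  have "\<exists>c :: real \<Rightarrow> real. norm_sq m (\<lambda>t. of_real (h t) -
      (\<Sum>w\<in>zeros L. of_real (c w) * fun_of (mode w) t)) < \<delta>" if L: "L \<ge> L0" for L
  proof -
    define c where "c w = ip x (mode w) / ip (mode w) (mode w)" for w
    have r: "expbd (remainder L x)" "glued (remainder L x)"
      by (intro expbd_remainder glued_remainder x)+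
    have "fun_of (remainder L x) t = fun_of x t - (\<Sum>w\<in>zeros L. of_real (c w) * fun_of (mode w) t)" for t
      unfolding remainder_def[abs_def] fun_of_diff[OF x(1) expbd_modes] c_def
      by (simp add: fun_of_sum zeros_finite expbd_scale expbd_mode fun_of_scale)
    then have split: "(\<lambda>t. of_real (h t) - (\<Sum>w\<in>zeros L. of_real (c w) * fun_of (mode w) t))
       = (\<lambda>t. (of_real (h t) - fun_of x t) + fun_of (remainder L x) t)"
      by simp
    have Lp: "L + 1 > 0" "L \<ge> 0" using L L0 by simp_all
    have "\<delta> * (4 * B / \<delta>) \<le> \<delta> * L" using L d unfolding L0_def by (intro mult_left_mono) auto
    then have "4 * B \<le> \<delta> * L" using d by simp
    also have "\<dots> < \<delta> * (L + 1)" using d by simp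
    finally have "B < \<delta> / 4 * (L + 1)" by simp
    moreover have "(L + 1) * ip (remainder L x) (remainder L x) \<le> B"
      unfolding B_def by (rule remainder_bound[OF x Lp(2)])
    ultimately have "(L + 1) * ip (remainder L x) (remainder L x) < (L + 1) * (\<delta> / 4)" by (simp add: mult.commute)
    then have "norm_sq m (fun_of (remainder L x)) < \<delta> / 4"
      unfolding norm_sq_fun_of[OF r] using Lp(1) by (simp only: mult_less_cancel_left_pos)
    moreover have "norm_sq m (\<lambda>t. (of_real (h t) - fun_of x t) + fun_of (remainder L x) t)
        \<le> 2 * norm_sq m (\<lambda>t. of_real (h t) - fun_of x t) + 2 * norm_sq m (fun_of (remainder L x))"
      by (intro sq_integrable_add(2) tame_sq_integrable t1 tame_fun_of r)
    ultimately have "norm_sq m (\<lambda>t. (of_real (h t) - fun_of x t) + fun_of (remainder L x) t) < \<delta>"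
      using a1 by linarith
    then show ?thesis unfolding split[symmetric] by blast
  qed
  with L0 show thesis by (rule that)
qed

lemma modes_total:
  assumes f: "f \<in> E_compl m" and e: "\<epsilon> > 0"
  obtains L and c :: "real \<Rightarrow> complex" where 
    "normE m (\<lambda>x. f x - (\<Sum>w\<in>zeros L. c w * fun_of (mode w) x)) < \<epsilon>"
proof -
  define \<eta> where "\<eta> = \<epsilon> / 2"
  have "\<eta> > 0" using e by (simp add: \<eta>_def)
  then obtain g where g: "g \<in> E_space" "normE m (\<lambda>x. f x - g x) < \<eta>"
    using f unfolding E_compl_def by blast
  have g1: "norm_sq m (\<lambda>x. f x - g x) < \<eta>\<^sup>2" by (rule norm_sq_less[OF g(2) \<open>\<eta> > 0\<close>])
  have gt: "tame m g" by (rule E_space_tame[OF g(1)])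
  have tp: "tame m (\<lambda>x. of_real (p (g x)))" if p: "p = Re \<or> p = Im" for p
  proof -
    obtain C where C: "\<And>x. x \<ge> 1 \<Longrightarrow> cmod (g x) \<le> C * x ^ m" using tameE[OF gt] by blast
    have "cmod (of_real (p (g x))) \<le> C * x ^ m" if "x \<ge> 1" for x
      using C[OF that] p abs_Re_le_cmod[of "g x"] abs_Im_le_cmod[of "g x"] by auto
    moreover have "continuous_on {0..} (\<lambda>x. of_real (p (g x)) :: complex)"
      using p tame_continuous[OF gt] by (auto intro!: continuous_on_of_real continuous_on_Re continuous_on_Im)
    ultimately show ?thesis unfolding tame_def by blast
  qed
  have d: "\<epsilon>\<^sup>2 / 16 > 0" using e by simp
  obtain L1 where L1: "\<And>L. L \<ge> L1 \<Longrightarrow> \<exists>c :: real \<Rightarrow> real. norm_sq m (\<lambda>x. of_real (Re (g x)) -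
      (\<Sum>w\<in>zeros L. of_real (c w) * fun_of (mode w) x)) < \<epsilon>\<^sup>2 / 16"
    using real_approximation[OF tp[of Re] d] by blast
  obtain L2 where L2: "\<And>L. L \<ge> L2 \<Longrightarrow> \<exists>c :: real \<Rightarrow> real. norm_sq m (\<lambda>x. of_real (Im (g x)) -
      (\<Sum>w\<in>zeros L. of_real (c w) * fun_of (mode w) x)) < \<epsilon>\<^sup>2 / 16"
    using real_approximation[OF tp[of Im] d] by blast
  define L where "L = max L1 L2"
  define S where "S c x = (\<Sum>w\<in>zeros L. of_real (c w) * fun_of (mode w) x)" for c :: "real \<Rightarrow> real" and x
  obtain a where a: "norm_sq m (\<lambda>x. of_real (Re (g x)) - S a x) < \<epsilon>\<^sup>2 / 16" using L1[of L] by (auto simp: L_def S_def)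
  obtain b where b: "norm_sq m (\<lambda>x. of_real (Im (g x)) - S b x) < \<epsilon>\<^sup>2 / 16" using L2[of L] by (auto simp: L_def S_def)
  have St: "tame m (S c)" for c
    unfolding S_def[abs_def] by (intro tame_sum zeros_finite tame_scale tame_fun_of expbd_mode glued_mode) auto
  define c where "c w = of_real (a w) + \<i> * of_real (b w)" for w
  define X where "X x = of_real (Re (g x)) - S a x" for x
  define Y where "Y x = \<i> * (of_real (Im (g x)) - S b x)" for x
  have X: "sq_integrable m X" unfolding X_def by (intro tame_sq_integrable tame_diff tp St) simp
  have Y: "sq_integrable m Y" unfolding Y_def by (intro tame_sq_integrable tame_scale tame_diff tp St) simp
  have FG: "sq_integrable m (\<lambda>x. f x - g x)"
    by (rule sq_integrable_diff[OF _ tame_sq_integrable[OF gt]]) (use f in \<open>simp add: E_compl_def\<close>)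
  have "f x - (\<Sum>w\<in>zeros L. c w * fun_of (mode w) x) = (f x - g x) + (X x + Y x)" for x
  proof -
    have "(\<Sum>w\<in>zeros L. c w * fun_of (mode w) x) = S a x + \<i> * S b x"
      unfolding S_def c_def sum_distrib_left sum.distrib[symmetric] by (intro sum.cong) (auto simp: algebra_simps)
    moreover have "g x = of_real (Re (g x)) + \<i> * of_real (Im (g x))" by (rule complex_eq)
    ultimately show ?thesis unfolding X_def Y_def by (simp add: algebra_simps)
  qed
  then have "norm_sq m (\<lambda>x. f x - (\<Sum>w\<in>zeros L. c w * fun_of (mode w) x)) = norm_sq m (\<lambda>x. (f x - g x) + (X x + Y x))"
    by (simp only:)
  also have "\<dots> \<le> 2 * norm_sq m (\<lambda>x. f x - g x) + 2 * norm_sq m (\<lambda>x. X x + Y x)"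
    by (intro sq_integrable_add FG X Y)
  also have "\<dots> \<le> 2 * norm_sq m (\<lambda>x. f x - g x) + 2 * (2 * norm_sq m X + 2 * norm_sq m Y)"
    using sq_integrable_add(2)[OF X Y] by simp
  also have "\<dots> < 2 * \<eta>\<^sup>2 + 2 * (2 * (\<epsilon>\<^sup>2 / 16) + 2 * (\<epsilon>\<^sup>2 / 16))"
  proof -
    have "norm_sq m Y = norm_sq m (\<lambda>x. of_real (Im (g x)) - S b x)" unfolding Y_def norm_sq_scale by simp
    then have "norm_sq m X < \<epsilon>\<^sup>2 / 16" "norm_sq m Y < \<epsilon>\<^sup>2 / 16" using a b by (simp_all add: X_def[abs_def])
    then show ?thesis using g1 by (intro add_strict_mono mult_strict_left_mono) simp_all
  qed
  also have "\<dots> = \<epsilon>\<^sup>2" by (simp add: \<eta>_def power_divide)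
  finally show thesis using that normE_less[OF e] by blast
qed

text \<open>
Passing from eigenvectors indexed by zeros of \<open>\<Delta>\<close> to an arbitrary indexing and scaling.
\<close>

lemma family_of_modes:
  assumes u: "\<And>w. \<Delta> w = 0 \<Longrightarrow> u (\<iota> w) = (\<lambda>x. \<gamma> w * fun_of (mode w) x) \<and> \<gamma> w \<noteq> 0"
    and bij: "bij_betw \<iota> {w. \<Delta> w = 0} J"
  shows "hilbert_basis m J u"
    and "J \<subseteq> I \<Longrightarrow> (\<And>i. i \<in> I \<Longrightarrow> u i \<in> E_compl m) \<Longrightarrow> total_family m I u"
proof -
  have J: "\<exists>w. \<Delta> w = 0 \<and> i = \<iota> w" if "i \<in> J" for i
    using bij that by (auto simp: bij_betw_def)
  have inj: "inj_on \<iota> {w. \<Delta> w = 0}" and im: "\<iota> ` {w. \<Delta> w = 0} = J" using bij by (auto simp: bij_betw_def)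
  have E: "u i \<in> E_compl m" if i: "i \<in> J" for i
  proof -
    obtain w where w: "\<Delta> w = 0" "i = \<iota> w" using J[OF i] by blast
    show ?thesis unfolding w(2) u[OF w(1), THEN conjunct1]
      by (intro tame_E_compl tame_scale tame_fun_of expbd_mode glued_mode w)
  qed
  show tot: "total_family m I u" if "J \<subseteq> I" "\<And>i. i \<in> I \<Longrightarrow> u i \<in> E_compl m" for I
    unfolding total_family_def
  proof (intro conjI ballI allI impI)
    fix f and \<epsilon> :: real assume f\<epsilon>: "f \<in> E_compl m" "\<epsilon> > 0"
    obtain L and c :: "real \<Rightarrow> complex" where 
      c: "normE m (\<lambda>x. f x - (\<Sum>w\<in>zeros L. c w * fun_of (mode w) x)) < \<epsilon>"
      by (rule modes_total[OF f\<epsilon>])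
    define F where "F = \<iota> ` (zeros L)"
    define d where "d i = (let w = the_inv_into {w. \<Delta> w = 0} \<iota> i in c w / \<gamma> w)" for i
    have inj': "inj_on \<iota> (zeros L)" by (rule inj_on_subset[OF inj]) auto
    have "(\<Sum>i\<in>F. d i * u i x) = (\<Sum>w\<in>zeros L. c w * fun_of (mode w) x)" for x
      unfolding F_def sum.reindex[OF inj'] 
    proof (intro sum.cong refl)
      fix w assume "w \<in> (zeros L)"
      then have w: "\<Delta> w = 0" by simp
      have "the_inv_into {w. \<Delta> w = 0} \<iota> (\<iota> w) = w" using the_inv_into_f_f[OF inj] w by simp
      then show "((\<lambda>i. d i * u i x) \<circ> \<iota>) w = c w * fun_of (mode w) x"
        using u[OF w] by (simp add: d_def)
    qed
    then have "normE m (\<lambda>x. f x - (\<Sum>i\<in>F. d i * u i x)) < \<epsilon>" using c by simp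
    moreover have "finite F" "F \<subseteq> I" using zeros_finite im that(1) by (auto simp: F_def)
    ultimately show "\<exists>F c. finite F \<and> F \<subseteq> I \<and> normE m (\<lambda>x. f x - (\<Sum>i\<in>F. c i * u i x)) < \<epsilon>" by blast
  qed (rule that(2))
  have "orthogonal_family m J u"
    unfolding orthogonal_family_def
  proof (intro conjI ballI impI)
    fix i assume i: "i \<in> J"
    then show "u i \<in> E_compl m" by (rule E)
    obtain w where w: "\<Delta> w = 0" "i = \<iota> w" using J[OF i] by blast
    have "norm_sq m (u i) > 0"
      unfolding w(2) u[OF w(1), THEN conjunct1] norm_sq_scale norm_sq_fun_of[OF expbd_mode glued_mode[OF w(1)]]
      using u[OF w(1)] ip_mode_pos by simp
    then show "normE m (u i) \<noteq> 0" by (simp add: normE_norm_sq)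
  next
    fix i j assume ij: "i \<in> J" "j \<in> J" "i \<noteq> j"
    obtain v where v: "\<Delta> v = 0" "i = \<iota> v" using J[OF ij(1)] by blast
    obtain w where w: "\<Delta> w = 0" "j = \<iota> w" using J[OF ij(2)] by blast
    have "v \<noteq> w" using v w ij by blast
    then show "herm m (u i) (u j) = 0"
      unfolding v(2) w(2) u[OF w(1), THEN conjunct1] u[OF v(1), THEN conjunct1] herm_scale
        herm_fun_of[OF expbd_mode glued_mode[OF v(1)] expbd_mode glued_mode[OF w(1)]]
      using ip_mode_orthogonal[OF v(1) w(1)] by simp
  qed
  then show "hilbert_basis m J u"
    unfolding hilbert_basis_def using tot[OF subset_refl E] by blast
qed

end


text \<open>
Surjectivity by induction: the successor of an element is the least element outside the initial segment
that it determines. The set \<open>A\<close> in the auxiliary fact is either empty or such a segment, so that the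
first element and successors are found in the same way.
\<close>

lemma rank_bij:
  fixes Z :: "real set"
  assumes inf: "infinite Z" and fin: "\<And>L. finite {v \<in> Z. v \<le> L}"
  shows "bij_betw (\<lambda>w. card {v \<in> Z. v \<le> w}) Z {1..}"
proof -
  let ?r = "\<lambda>w. card {v \<in> Z. v \<le> w}"
  have mono: "?r v < ?r w" if "v \<in> Z" "w \<in> Z" "v < w" for v w
    by (rule psubset_card_mono[OF fin]) (use that in force)
  have inj: "inj_on ?r Z"
  proof (rule inj_onI)
    fix v w assume "v \<in> Z" "w \<in> Z" "?r v = ?r w"
    then show "v = w" using mono[of v w] mono[of w v] by (cases v w rule: linorder_cases) auto
  qed
  have succ: "\<exists>w\<in>Z. {v \<in> Z. v \<le> w} = insert w {v \<in> Z. v \<in> A} \<and> w \<notin> A"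
    if A: "finite {v \<in> Z. v \<in> A}" "\<And>v w. w \<in> A \<Longrightarrow> v \<le> w \<Longrightarrow> v \<in> A" for A
  proof -
    have "infinite (Z - {v \<in> Z. v \<in> A})" using inf A(1) by (rule Diff_infinite_finite[rotated])
    then have "Z - {v \<in> Z. v \<in> A} \<noteq> {}" by (rule infinite_imp_nonempty)
    then obtain z where z: "z \<in> Z" "z \<notin> A" by blast
    define B where "B = {v \<in> Z. v \<le> z \<and> v \<notin> A}"
    have B: "finite B" "B \<noteq> {}"
      using z finite_subset[OF _ fin[of z], of B] by (auto simp: B_def)
    define w where "w = Min B"
    have w: "w \<in> B" "\<And>v. v \<in> B \<Longrightarrow> w \<le> v" unfolding w_def using B by auto
    have "v \<in> A" if "v \<in> Z" "v \<le> w" "v \<noteq> w" for v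
    proof (rule ccontr)
      assume "v \<notin> A"
      then have "v \<in> B" using that w(1) by (auto simp: B_def)
      then show False using w(2)[of v] that by auto
    qed
    moreover have "v \<le> w" if "v \<in> A" for v
      using A(2)[OF that, of w] w(1) by (cases "v \<le> w") (auto simp: B_def)
    ultimately have "{v \<in> Z. v \<le> w} = insert w {v \<in> Z. v \<in> A}" using w(1) by (auto simp: B_def)
    then show ?thesis using w(1) by (auto simp: B_def)
  qed
  have surj: "\<exists>w\<in>Z. ?r w = Suc k" for k
  proof (induction k)
    case 0
    obtain w where "w \<in> Z" "{v \<in> Z. v \<le> w} = insert w {v \<in> Z. v \<in> {}}" using succ[of "{}"] by auto
    then show ?case by (intro bexI[of _ w]) auto
  next
    case (Suc k)
    then obtain v where v: "v \<in> Z" "?r v = Suc k" by blast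
    obtain w where "w \<in> Z" "{u \<in> Z. u \<le> w} = insert w {u \<in> Z. u \<in> {..v}}" "w \<notin> {..v}"
      using succ[of "{..v}"] fin[of v] by auto
    then show ?case using v fin[of v] by (intro bexI[of _ w]) auto
  qed
  have "?r w \<ge> 1" if "w \<in> Z" for w
    using that fin[of w] by (auto simp: Suc_le_eq card_gt_0_iff)
  then have "?r ` Z = {1..}"
  proof (intro equalityI subsetI)
    fix k :: nat assume "k \<in> {1..}"
    then obtain j where "k = Suc j" by (cases k) auto
    then show "k \<in> ?r ` Z" using surj[of j] by force
  qed auto
  with inj show ?thesis by (simp add: bij_betw_def)
qed

section \<open>Bessel functions and the numbering of the eigenvalues\<close>

lemma expbd_mult_power: 
  assumes "expbd p" shows "expbd (\<lambda>k. p k * (c::real) ^ k)"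
proof -
  obtain C r where *: "C \<ge> 0" "r \<ge> 1" "\<And>j. norm (p j) \<le> C * r ^ j"
    using expbdE[OF assms] by blast
  have "norm (p j * c ^ j) \<le> C * (r * \<bar>c\<bar>) ^ j" for j
  proof -
    have "norm (p j * c ^ j) = norm (p j) * \<bar>c\<bar> ^ j" by (simp add: abs_mult power_abs)
    also have "\<dots> \<le> (C * r ^ j) * \<bar>c\<bar> ^ j" using * by (intro mult_right_mono) auto
    finally show ?thesis by (simp add: power_mult_distrib mult.assoc)
  qed
  then show ?thesis by (rule expbdI)
qed

lemma bser_complex:
  assumes p: "expbd p"
  shows "bser n (\<lambda>k. complex_of_real (p k)) (of_real (l * t)) = of_real (l ^ n * bser n (\<lambda>k. p k * (l\<^sup>2) ^ k) t)"
proof -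
  have "(\<Sum>j. of_real (bcoef n j) * complex_of_real (p j) * ((of_real (l * t))\<^sup>2) ^ j)
      = (\<Sum>j. complex_of_real (bcoef n j * (p j * (l\<^sup>2) ^ j) * (t\<^sup>2) ^ j))"
    by (simp add: power_mult_distrib mult_ac)
  also have "\<dots> = of_real (\<Sum>j. bcoef n j * (p j * (l\<^sup>2) ^ j) * (t\<^sup>2) ^ j)"
    using bser_summable[OF expbd_mult_power[OF p, of "l\<^sup>2"], of n "t\<^sup>2"]
    by (intro suminf_of_real[symmetric]) simp
  finally show ?thesis by (simp add: bser_def power_mult_distrib mult_ac)
qed

text \<open>
The sequence of signs in the Bessel series, that is \<open>geom 1\<close>. The dependence on the argument \<open>l * t\<close>
moves into a geometric sequence of ratio \<open>- l\<^sup>2\<close>.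
\<close>

definition alt_sign :: "nat \<Rightarrow> real" where "alt_sign k = (- 1) ^ k"

lemma expbd_alt: "expbd alt_sign"
  by (rule expbdI[of _ 1 1]) (simp add: alt_sign_def)

lemma expbd_of_real: "expbd p \<Longrightarrow> expbd (\<lambda>k. complex_of_real (p k))"
  by (simp add: expbd_def)

lemma alt_sign_geom: "(\<lambda>k. alt_sign k * (l\<^sup>2) ^ k) = geom (l\<^sup>2)"
  by (simp add: alt_sign_def geom_def fun_eq_iff power_mult_distrib[symmetric])

lemma bessel_J_nat_bser: "bessel_J_nat n z = (1/2) ^ n * bser n (\<lambda>k. complex_of_real (alt_sign k)) z"
proof -
  have sm: "summable (\<lambda>k. of_real (bcoef n k) * complex_of_real (alt_sign k) * (z\<^sup>2) ^ k)"
    by (rule bser_summable[OF expbd_of_real[OF expbd_alt]])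
  have "(-1) ^ k / (fact k * fact (k + n)) * (z / 2) ^ (2 * k + n)
      = ((1/2) ^ n * z ^ n) * (of_real (bcoef n k) * complex_of_real (alt_sign k) * (z\<^sup>2) ^ k)" for k
  proof -
    have "(z / 2) ^ (2 * k + n) = (1/2) ^ n * z ^ n * ((z\<^sup>2) ^ k / 4 ^ k)"
    proof -
      have "(z / 2) ^ (2 * k) = (z\<^sup>2) ^ k / 4 ^ k" unfolding power_mult power_divide by simp
      then show ?thesis unfolding power_add by (simp add: power_divide mult.commute)
    qed
    moreover have "complex_of_real (bcoef n k) = 1 / (4 ^ k * fact k * fact (k + n))"
      by (simp add: bcoef_def add.commute)
    ultimately show ?thesis by (simp add: alt_sign_def mult_ac)
  qed
  then have "bessel_J_nat n z = (\<Sum>k. ((1/2) ^ n * z ^ n) * (of_real (bcoef n k) * complex_of_real (alt_sign k) * (z\<^sup>2) ^ k))"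
    unfolding bessel_J_nat_def by simp
  also have "\<dots> = ((1/2) ^ n * z ^ n) * (\<Sum>k. of_real (bcoef n k) * complex_of_real (alt_sign k) * (z\<^sup>2) ^ k)"
    by (rule suminf_mult[OF sm])
  finally show ?thesis by (simp add: bser_def mult.assoc)
qed

lemma bessel_J_nat_real: "bessel_J_nat n (of_real (l * t)) = of_real ((l / 2) ^ n * bser n (geom (l\<^sup>2)) t)"
  unfolding bessel_J_nat_bser bser_complex[OF expbd_alt] alt_sign_geom by (simp add: power_divide)

lemma bessel_J_nat_deriv:
  assumes "l \<noteq> 0"
  shows "(bessel_J_nat n has_field_derivative of_real ((l / 2) ^ n * bslope n (l\<^sup>2)) / of_real l) (at (of_real l))"
proof -
  have e: "euler n (\<lambda>k. complex_of_real (alt_sign k)) = (\<lambda>k. complex_of_real (euler n alt_sign k))"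
    by (simp add: euler_def fun_eq_iff)
  have e2: "(\<lambda>k. euler n alt_sign k * (l\<^sup>2) ^ k) = euler n (geom (l\<^sup>2))"
    unfolding alt_sign_geom[symmetric] by (simp add: euler_def fun_eq_iff mult.assoc)
  have "(bser n (\<lambda>k. complex_of_real (alt_sign k)) has_field_derivative 
      bser n (euler n (\<lambda>k. complex_of_real (alt_sign k))) (of_real l) / of_real l) (at (of_real l))"
    by (rule bser_deriv[OF expbd_of_real[OF expbd_alt]]) (use assms in simp)
  from DERIV_cmult[OF this, of "(1/2) ^ n"]
  have "(bessel_J_nat n has_field_derivative
     (1/2) ^ n * (bser n (euler n (\<lambda>k. complex_of_real (alt_sign k))) (of_real l) / of_real l)) (at (of_real l))"
    unfolding bessel_J_nat_bser[abs_def] .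
  also have "(1/2) ^ n * (bser n (euler n (\<lambda>k. complex_of_real (alt_sign k))) (of_real l) / of_real l)
     = of_real ((l / 2) ^ n * bslope n (l\<^sup>2)) / of_real l"
    unfolding e bslope_def using bser_complex[OF expbd_euler[OF expbd_alt], of n n l 1] e2
    by (simp add: power_divide)
  finally show ?thesis .
qed

definition bessel_sign :: "int \<Rightarrow> complex" where
  "bessel_sign \<nu> = (if \<nu> \<ge> 0 then 1 else (-1) ^ nat (- \<nu>))"

lemma bessel_sign_nonzero: "bessel_sign \<nu> \<noteq> 0" by (simp add: bessel_sign_def)

lemma bessel_J_nat_eq: "bessel_J \<nu> = (\<lambda>z. bessel_sign \<nu> * bessel_J_nat (nat \<bar>\<nu>\<bar>) z)"
  by (auto simp: bessel_J_def bessel_sign_def fun_eq_iff)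

lemma bessel_J_real: "bessel_J \<nu> (of_real (l * t)) = bessel_sign \<nu> * of_real ((l / 2) ^ nat \<bar>\<nu>\<bar> * bser (nat \<bar>\<nu>\<bar>) (geom (l\<^sup>2)) t)"
  unfolding bessel_J_nat_eq bessel_J_nat_real ..

lemma bessel_J_at: "bessel_J \<nu> (of_real l) = bessel_sign \<nu> * of_real ((l / 2) ^ nat \<bar>\<nu>\<bar> * bval (nat \<bar>\<nu>\<bar>) (l\<^sup>2))"
  using bessel_J_real[of \<nu> l 1] by (simp add: bval_def)

lemma bessel_J_zero_iff: "l \<noteq> 0 \<Longrightarrow> bessel_J \<nu> (of_real l) = 0 \<longleftrightarrow> bval (nat \<bar>\<nu>\<bar>) (l\<^sup>2) = 0"
  unfolding bessel_J_at by (simp add: bessel_sign_nonzero)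

lemma bessel_J_deriv:
  "l \<noteq> 0 \<Longrightarrow> (bessel_J \<nu> has_field_derivative bessel_sign \<nu> * of_real ((l / 2) ^ nat \<bar>\<nu>\<bar> * bslope (nat \<bar>\<nu>\<bar>) (l\<^sup>2)) / of_real l) (at (of_real l))"
  unfolding bessel_J_nat_eq times_divide_eq_right[symmetric] by (intro DERIV_cmult bessel_J_nat_deriv)

text \<open>
Multiplying out the derivative gives \<open>- (z A' B + z B' A - m A B) / z\<close> with \<open>A\<close>, \<open>B\<close> the two Bessel
functions, and \<open>z A'\<close>, \<open>z B'\<close> are the end slopes up to the same factors as \<open>A\<close>, \<open>B\<close>.
\<close>

lemma Zset_iff:
  "of_real l \<in> Zset m \<nu> \<longleftrightarrow> l \<noteq> 0 \<and> char_fn (nat \<bar>\<nu>\<bar>) (nat \<bar>\<nu> - int m\<bar>) m (l\<^sup>2) = 0"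
proof (cases "l = 0")
  case False
  define n where "n = nat \<bar>\<nu>\<bar>"
  define n' where "n' = nat \<bar>\<nu> - int m\<bar>"
  define z where "z = complex_of_real l"
  define k where "k = bessel_sign \<nu> * bessel_sign (\<nu> - int m) * of_real ((l / 2) ^ n * (l / 2) ^ n')"
  have z: "z \<noteq> 0" using False by (simp add: z_def)
  define A where "A = bessel_J \<nu> z"
  define B where "B = bessel_J (\<nu> - int m) z"
  define A' where "A' = bessel_sign \<nu> * of_real ((l / 2) ^ n * bslope n (l\<^sup>2))"
  define B' where "B' = bessel_sign (\<nu> - int m) * of_real ((l / 2) ^ n' * bslope n' (l\<^sup>2))"
  have "((\<lambda>w. bessel_J \<nu> w * bessel_J (\<nu> - int m) w / w ^ m) has_field_derivative
      ((A' / z * B + B' / z * A) * z ^ m - A * B * (of_nat m * (1 * z ^ (m - Suc 0)))) / (z ^ m * z ^ m)) (at z)"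
    unfolding A_def B_def A'_def B'_def n_def n'_def z_def
    by (intro DERIV_divide DERIV_mult bessel_J_deriv False DERIV_power DERIV_ident) (use False in simp)
  then have "L_fun m \<nu> z = - (z ^ m) * (((A' / z * B + B' / z * A) * z ^ m - A * B * (of_nat m * (1 * z ^ (m - Suc 0)))) / (z ^ m * z ^ m))"
    unfolding L_fun_def by (simp only: DERIV_imp_deriv)
  also have "\<dots> = - ((A' * B + B' * A - of_nat m * A * B) / z)"
    using z by (cases m) (simp_all add: field_simps)
  also have "A' * B + B' * A - of_nat m * A * B = k * of_real (char_fn n n' m (l\<^sup>2))"
    unfolding A_def B_def A'_def B'_def z_def bessel_J_at k_def char_fn_def n_def[symmetric] n'_def[symmetric]
    by (simp add: algebra_simps)
  finally have "L_fun m \<nu> z = 0 \<longleftrightarrow> char_fn n n' m (l\<^sup>2) = 0"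
    using z False by (simp add: k_def bessel_sign_nonzero)
  then show ?thesis using z False by (simp add: Zset_def z_def n_def n'_def)
qed (simp add: Zset_def)

lemma geom_0: "bser n (geom 0) t = t ^ n * bcoef n 0"
proof -
  have "(\<Sum>j. bcoef n j * geom 0 j * (t\<^sup>2) ^ j) = (\<Sum>j\<in>{0}. bcoef n j * geom 0 j * (t\<^sup>2) ^ j)"
    by (rule suminf_finite) (auto simp: geom_def power_0_left)
  then show ?thesis by (simp add: bser_def geom_def)
qed

lemma bslope_0: "bslope n 0 = real n * bcoef n 0"
proof -
  have "(\<Sum>j. bcoef n j * euler n (geom 0) j * (1\<^sup>2) ^ j) = (\<Sum>j\<in>{0}. bcoef n j * euler n (geom 0) j * (1\<^sup>2) ^ j)"
    by (rule suminf_finite) (auto simp: geom_def euler_def power_0_left)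
  then show ?thesis by (simp add: bslope_def bser_def geom_def euler_def)
qed

text \<open>
At \<open>w = 0\<close> the regular solutions are \<open>t ^ n\<close> and \<open>t ^ n'\<close>.
\<close>

lemma char_fn_0: "char_fn n n' m 0 = 0 \<longleftrightarrow> n + n' = m"
proof -
  have "char_fn n n' m 0 = (real n + real n' - real m) * (bcoef n 0 * bcoef n' 0)"
    by (simp add: char_fn_def bslope_0 bval_def geom_0 algebra_simps)
  then show ?thesis using bcoef_pos[of n 0] bcoef_pos[of n' 0] by auto
qed

lemma monomial_E_compl:
  assumes "j \<le> m" shows "monomial j \<in> E_compl m"
proof (rule tame_E_compl)
  have "cmod (monomial j x) \<le> 1 * x ^ m" if "x \<ge> 1" for x
    using that assms by (simp add: monomial_def norm_power power_increasing)
  moreover have "continuous_on {0..} (monomial j)"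
    unfolding monomial_def[abs_def] by (intro continuous_on_of_real continuous_on_power continuous_on_id)
  ultimately show "tame m (monomial j)" unfolding tame_def by blast
qed

theorem mainTheorem6:
  fixes m :: nat and \<nu> :: int
  assumes "m \<ge> 1 \<Longrightarrow> \<forall>z\<in>Zset m \<nu>. bessel_J \<nu> z * bessel_J (\<nu> - int m) z \<noteq> 0"
  shows "(\<nu> \<le> -1 \<or> \<nu> \<ge> int m + 1 \<longrightarrow> hilbert_basis m {1..} (phi m \<nu>)) \<and>
         (0 \<le> \<nu> \<and> \<nu> \<le> int m \<longrightarrow>
            total_family m ({..m} <+> {1..}) (mono_phi m \<nu>) \<and>
            hilbert_basis m ({nat \<nu>} <+> {1..}) (mono_phi m \<nu>))"
proof -
  define n where "n = nat \<bar>\<nu>\<bar>"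
  define n' where "n' = nat \<bar>\<nu> - int m\<bar>"
  have mle: "m \<le> n + n'" unfolding n_def n'_def by linarith
  have nonres: "m = 0 \<and> n = n' \<or> (\<forall>w. char_fn n n' m w = 0 \<longrightarrow> bval n w \<noteq> 0 \<and> bval n' w \<noteq> 0)"
  proof (cases "m = 0")
    case True
    then show ?thesis by (simp add: n_def n'_def)
  next
    case False
    have "bval n w \<noteq> 0 \<and> bval n' w \<noteq> 0" if c: "char_fn n n' m w = 0" for w
    proof (cases "w > 0")
      case True
      then have "of_real (sqrt w) \<in> Zset m \<nu>" using c by (simp add: Zset_iff n_def n'_def)
      then have "bessel_J \<nu> (of_real (sqrt w)) \<noteq> 0 \<and> bessel_J (\<nu> - int m) (of_real (sqrt w)) \<noteq> 0"
        using assms False by fastforce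
      then show ?thesis using True by (simp add: bessel_J_zero_iff n_def n'_def)
    next
      case False
      then show ?thesis using bser_geom_pos[of w 1 n] bser_geom_pos[of w 1 n'] by (simp add: bval_def)
    qed
    then show ?thesis by blast
  qed
  interpret star_graph n n' m by unfold_locales (rule mle nonres)+
  define Zp where "Zp = {w. \<Delta> w = 0 \<and> w > 0}"
  define rank where "rank w = card {v \<in> Zp. v \<le> w}" for w
  have rank: "bij_betw rank Zp {1..}"
    unfolding rank_def[abs_def]
  proof (rule rank_bij)
    show "infinite Zp" unfolding Zp_def by (rule zeros_infinite)
    show "finite {v \<in> Zp. v \<le> L}" for L
      by (rule finite_subset[OF _ zeros_finite[of L]]) (auto simp: Zp_def)
  qed
  have ev: "eigenvalues m \<nu> = (\<lambda>w. w / 4) ` Zp"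
  proof (intro equalityI subsetI)
    fix t assume "t \<in> eigenvalues m \<nu>"
    then obtain l where "t = l\<^sup>2 / 4" "l \<noteq> 0" "\<Delta> (l\<^sup>2) = 0"
      by (auto simp: eigenvalues_def Zset_iff n_def n'_def)
    then show "t \<in> (\<lambda>w. w / 4) ` Zp" by (intro image_eqI[of _ _ "l\<^sup>2"]) (auto simp: Zp_def)
  next
    fix t assume "t \<in> (\<lambda>w. w / 4) ` Zp"
    then obtain w where w: "t = w / 4" "w > 0" "\<Delta> w = 0" by (auto simp: Zp_def)
    then have "of_real (sqrt w) \<in> Zset m \<nu>" by (simp add: Zset_iff n_def n'_def)
    moreover have "t = (sqrt w)\<^sup>2 / 4" using w by simp
    ultimately show "t \<in> eigenvalues m \<nu>" unfolding eigenvalues_def by blast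
  qed
  have cnt: "card {t \<in> eigenvalues m \<nu>. t \<le> l\<^sup>2 / 4} = rank (l\<^sup>2)" for l :: real
  proof -
    have "{t \<in> eigenvalues m \<nu>. t \<le> l\<^sup>2 / 4} = (\<lambda>w. w / 4) ` {v \<in> Zp. v \<le> l\<^sup>2}"
      unfolding ev by auto
    then show ?thesis by (simp add: rank_def card_image inj_on_def)
  qed
  have lam: "lam m \<nu> (rank w) = sqrt w" if w: "w \<in> Zp" for w
    unfolding lam_def cnt
  proof (rule the_equality)
    show "sqrt w > 0 \<and> of_real (sqrt w) \<in> Zset m \<nu> \<and> rank ((sqrt w)\<^sup>2) = rank w"
      using w by (simp add: Zset_iff Zp_def n_def n'_def)
    fix l :: real assume l: "l > 0 \<and> of_real l \<in> Zset m \<nu> \<and> rank (l\<^sup>2) = rank w"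
    then have "l\<^sup>2 \<in> Zp" by (simp add: Zset_iff Zp_def n_def n'_def)
    then have "l\<^sup>2 = w" using l w rank by (auto simp: bij_betw_def inj_on_def)
    then show "l = sqrt w" using l by (simp add: real_sqrt_unique)
  qed
  define \<gamma> where "\<gamma> w = bessel_sign \<nu> * of_real ((sqrt w / 2) ^ n) / (if bval n w = 0 then 1 else of_real (bval n' w))" for w
  have phi: "phi m \<nu> (rank w) = (\<lambda>x. \<gamma> w * fun_of (mode w) x) \<and> \<gamma> w \<noteq> 0" if w: "w \<in> Zp" for w
  proof -
    define l where "l = sqrt w"
    have l: "l > 0" "l\<^sup>2 = w" and z: "\<Delta> w = 0" using w by (simp_all add: l_def Zp_def)
    have Jn: "bessel_J \<nu> (of_real (l * x)) = bessel_sign \<nu> * of_real ((l / 2) ^ n * bser n (geom w) x)" for x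
      unfolding bessel_J_real l n_def ..
    have Jn': "bessel_J (\<nu> - int m) (of_real (l * x)) = bessel_sign (\<nu> - int m) * of_real ((l / 2) ^ n' * bser n' (geom w) x)" for x
      unfolding bessel_J_real l n'_def ..
    have J1: "bessel_J \<nu> (of_real l) = bessel_sign \<nu> * of_real ((l / 2) ^ n * bval n w)"
      "bessel_J (\<nu> - int m) (of_real l) = bessel_sign (\<nu> - int m) * of_real ((l / 2) ^ n' * bval n' w)"
      unfolding bessel_J_at l n_def n'_def by simp_all
    have l0: "complex_of_real ((l / 2) ^ k) \<noteq> 0" for k using l by simp
    show ?thesis using z
    proof (cases rule: zero_cases)
      case 1
      have "\<not> (m = 0 \<and> bessel_J \<nu> (of_real l) = 0)" using 1 l0 bessel_sign_nonzero[of \<nu>] by (simp add: J1)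
      then have phi_eq: "phi m \<nu> (rank w) x = (if x \<le> 1 then bessel_J \<nu> (of_real (l * x))
          else bessel_J \<nu> (of_real l) / bessel_J (\<nu> - int m) (of_real l)
             * of_real (x ^ m) * bessel_J (\<nu> - int m) (of_real (l / x)))" for x
        by (simp only: phi_def lam[OF w] l_def[symmetric] Let_def if_False)
      have \<gamma>: "\<gamma> w = bessel_sign \<nu> * of_real ((l / 2) ^ n) / of_real (bval n' w)"
        using 1 by (simp add: \<gamma>_def l_def)
      have fun_eq: "fun_of (mode w) x = of_real (if x \<le> 1 then bval n' w * bser n (geom w) x
          else x ^ m * (bval n w * bser n' (geom w) (1 / x)))" for x
        unfolding fun_of_def mode_def[abs_def] val_geom using 1 by (simp add: amplitudes_def)
      have "phi m \<nu> (rank w) x = \<gamma> w * fun_of (mode w) x" for x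
      proof (cases "x \<le> 1")
        case True
        then show ?thesis unfolding phi_eq \<gamma> fun_eq Jn using 1 by simp
      next
        case False
        have gen: "s * of_real (p * a) / (s' * of_real (p' * b)) * of_real y * (s' * of_real (p' * c))
            = s * of_real p / of_real b * of_real (y * (a * c))"
          if "s' \<noteq> 0" "p' \<noteq> 0" "b \<noteq> 0" for s s' :: complex and p p' a b c y :: real
          using that by simp
        have "bessel_J (\<nu> - int m) (of_real (l / x)) = bessel_sign (\<nu> - int m) * of_real ((l / 2) ^ n' * bser n' (geom w) (1 / x))"
          using Jn'[of "1 / x"] by simp
        moreover have "(l / 2) ^ n' \<noteq> 0" using l by simp
        ultimately show ?thesis
          unfolding phi_eq \<gamma> fun_eq J1 if_not_P[OF False] using gen[OF bessel_sign_nonzero _ 1(2)] by (simp only:)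
      qed
      moreover have "\<gamma> w \<noteq> 0" using 1 l0[of n] bessel_sign_nonzero[of \<nu>] by (simp add: \<gamma>_def l_def[symmetric])
      ultimately show ?thesis by blast
    next
      case 2
      have c: "m = 0 \<and> bessel_J \<nu> (of_real l) = 0" using 2 by (simp add: J1)
      have phi_eq: "phi m \<nu> (rank w) x = (if x \<le> 1 then - bessel_J \<nu> (of_real (l * x)) else bessel_J \<nu> (of_real (l / x)))" for x
        unfolding phi_def lam[OF w] l_def[symmetric] Let_def using c by (simp only: if_True simp_thms)
      have \<gamma>: "\<gamma> w = bessel_sign \<nu> * of_real ((l / 2) ^ n)"
        using 2(3) by (simp add: \<gamma>_def l_def)
      have mv: "amplitudes w = (-1, 1)" using 2(3) by (simp add: amplitudes_def)
      have fun_eq: "fun_of (mode w) x = of_real (if x \<le> 1 then - bser n (geom w) x else bser n (geom w) (1 / x))" for x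
        unfolding fun_of_def mode_def[abs_def] val_geom mv unfolding 2(2)[symmetric] 2(1) by simp
      have "bessel_J \<nu> (of_real (l / x)) = bessel_sign \<nu> * of_real ((l / 2) ^ n * bser n (geom w) (1 / x))" for x
        using Jn[of "1 / x"] by simp
      then have "phi m \<nu> (rank w) x = \<gamma> w * fun_of (mode w) x" for x
        unfolding phi_eq \<gamma> fun_eq Jn by simp
      moreover have "\<gamma> w \<noteq> 0" using 2 l0[of n] bessel_sign_nonzero[of \<nu>] by (simp add: \<gamma>_def l_def[symmetric])
      ultimately show ?thesis by blast
    qed
  qed
  show ?thesis
  proof (intro conjI impI)
    assume "\<nu> \<le> - 1 \<or> \<nu> \<ge> int m + 1"
    then have "n + n' \<noteq> m" unfolding n_def n'_def by linarith
    then have "w > 0" if "\<Delta> w = 0" for w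
      using zero_nonneg[OF that] char_fn_0[of n n' m] that by (cases "w = 0") auto
    then have "{w. \<Delta> w = 0} = Zp" by (auto simp: Zp_def)
    then show "hilbert_basis m {1..} (phi m \<nu>)"
      using family_of_modes(1)[of "phi m \<nu>" rank \<gamma> "{1..}"] phi rank by blast
  next
    assume \<nu>: "0 \<le> \<nu> \<and> \<nu> \<le> int m"
    then have nn: "n = nat \<nu>" "n + n' = m" unfolding n_def n'_def by linarith+
    define \<iota> where "\<iota> w = (if w = 0 then Inl (nat \<nu>) else Inr (rank w))" for w
    define \<gamma>' where "\<gamma>' w = (if w = 0 then 1 / of_real (bcoef n 0 * bcoef n' 0) else \<gamma> w)" for w
    have "w = 0 \<or> w > 0" if "\<Delta> w = 0" for w
      using zero_nonneg[OF that] by auto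
    moreover have "\<Delta> 0 = 0" using char_fn_0[of n n' m] nn(2) by simp
    ultimately have Z: "{w. \<Delta> w = 0} = insert 0 Zp" by (auto simp: Zp_def)
    have u: "mono_phi m \<nu> (\<iota> w) = (\<lambda>x. \<gamma>' w * fun_of (mode w) x) \<and> \<gamma>' w \<noteq> 0" if "\<Delta> w = 0" for w
    proof (cases "w = 0")
      case False
      then have "w \<in> Zp" using that Z by blast
      then show ?thesis using phi[of w] False by (simp add: mono_phi_def \<iota>_def \<gamma>'_def)
    next
      case True
      have b: "bcoef n 0 \<noteq> 0" "bcoef n' 0 \<noteq> 0" using bcoef_pos[of n 0] bcoef_pos[of n' 0] by simp_all
      have "fun_of (mode 0) x = of_real (bcoef n 0 * bcoef n' 0 * x ^ n)" for x
      proof (cases "x \<le> 1")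
        case True
        then show ?thesis
          using b unfolding fun_of_def mode_def[abs_def] val_geom by (simp add: amplitudes_def bval_def geom_0)
      next
        case False
        have "x ^ m * (1 / x) ^ n' = x ^ n"
          using False nn(2)[symmetric] by (simp add: power_add power_divide)
        from arg_cong[OF this, of complex_of_real] show ?thesis
          using b False unfolding fun_of_def mode_def[abs_def] val_geom by (simp add: amplitudes_def bval_def geom_0)
      qed
      then show ?thesis
        using True b by (simp add: mono_phi_def \<iota>_def \<gamma>'_def monomial_def fun_eq_iff nn(1))
    qed
    have bij: "bij_betw \<iota> {w. \<Delta> w = 0} ({nat \<nu>} <+> {1..})"
      unfolding Z bij_betw_def
    proof (intro conjI)
      have p: "w \<noteq> 0" if "w \<in> Zp" for w using that by (simp add: Zp_def)
      have r: "inj_on rank Zp" "rank ` Zp = {1..}" using rank by (auto simp: bij_betw_def)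
      show "inj_on \<iota> (insert 0 Zp)"
        using r(1) p by (auto simp: inj_on_def \<iota>_def)
      have "\<iota> ` insert 0 Zp = insert (Inl (nat \<nu>)) (Inr ` rank ` Zp)"
        using p by (auto simp: \<iota>_def image_image image_iff)
      then show "\<iota> ` insert 0 Zp = {nat \<nu>} <+> {1..}" unfolding r(2) by (auto simp: Plus_def)
    qed
    show "hilbert_basis m ({nat \<nu>} <+> {1..}) (mono_phi m \<nu>)"
      by (rule family_of_modes(1)[OF u bij])
    then have E: "mono_phi m \<nu> i \<in> E_compl m" if "i \<in> {nat \<nu>} <+> {1..}" for i
      using that unfolding hilbert_basis_def total_family_def by blast
    show "total_family m ({..m} <+> {1..}) (mono_phi m \<nu>)"
    proof (rule family_of_modes(2)[OF u bij])
      show "{nat \<nu>} <+> {1::nat..} \<subseteq> {..m} <+> {1..}" using \<nu> by (auto simp: Plus_def nat_le_iff)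
      fix i :: "nat + nat" assume i: "i \<in> {..m} <+> {1..}"
      show "mono_phi m \<nu> i \<in> E_compl m"
      proof (cases i)
        case (Inl j)
        then show ?thesis using i monomial_E_compl[of j m] by (auto simp: mono_phi_def Plus_def)
      next
        case (Inr k)
        then show ?thesis using i by (intro E) (auto simp: Plus_def)
      qed
    qed
  qed
qed

end
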